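(* Let $\mathcal{D}$ be a $k$-linear, Hom-finite triangulated category with a cluster-tilting object $T$ and a Serre functor. Let $T[1]\text{-tilt}\,\mathcal{D}$ be the set of isomorphism classes of basic $T[1]$-cluster tilting objects in $\mathcal{D}$, and for $M,N\in T[1]\text{-tilt}\,\mathcal{D}$ write $M\geq N$ if $M\ast[T[1]]\supseteq N\ast[T[1]]$. Then the relation $\geq$ gives a partial order on $T[1]\text{-tilt}\,\mathcal{D}$.
   Context: Conventions: $k$ is an algebraically closed field; triangulated categories are Krull-Schmidt, with shift $[1]$. A Serre functor is a $k$-linear equivalence $\mathbb{S}:\mathcal{D}\to\mathcal{D}$ with bifunctorial isomorphisms $\mathrm{Hom}_{\mathcal{D}}(A,B)\simeq \mathrm{Hom}_k(\mathrm{Hom}_{\mathcal{D}}(B,\mathbb{S}A),k)$. For an object $M$, $\mathrm{add}\,M$ is the full subcategory of direct summands of finite direct sums of copies of $M$; $[M](X,Y)$ is the subgroup of $\mathrm{Hom}_{\mathcal{D}}(X,Y)$ of morphisms factoring through $\mathrm{add}\,M$; $|X|$ is the number of non-isomorphic indecomposable direct summands of $X$; basic means that the indecomposable summands are pairwise non-isomorphic. An object $T$ is cluster-tilting if $\mathrm{add}\,T=\{X\mid \mathrm{Hom}_{\mathcal{D}}(T,X[1])=0\}=\{X\mid \mathrm{Hom}_{\mathcal{D}}(X,T[1])=0\}$. An object $X$ is $T[1]$-rigid if $[T[1]](X,X[1])=0$, and $T[1]$-cluster tilting if it is $T[1]$-rigid and $|X|=|T|$. $M\ast[T[1]]$ is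 the full subcategory of all $X\in\mathcal{D}$ admitting a triangle $M_X\to X\xrightarrow{\eta_X} C_X\to M_X[1]$ with $M_X\in\mathrm{add}\,M$ and $\eta_X$ factoring through $\mathrm{add}\,T[1]$. *)

theory Defs
  imports
    "HOL-Algebra.Algebraic_Closure"
    "Jordan_Normal_Form.Missing_VectorSpace"
begin

no_notation var (\<open>X\<index>\<close>)

section \<open>Linear categories\<close>

text \<open>
  Morphisms are untyped and there is one composition. The hom-spaces
  need not be disjoint; every notion below that depends on the source or target
  of a morphism takes these objects as arguments.
  \<open>Comp C g f\<close> is the composite \<open>g \<circ> f\<close>.
\<close>

record ('o, 'k, 'm) lin_category =
  Obj :: "'o set"
  Hom :: "'o \<Rightarrow> 'o \<Rightarrow> ('k, 'm) module"
  Id :: "'o \<Rightarrow> 'm"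
  Comp :: "'m \<Rightarrow> 'm \<Rightarrow> 'm" (infixr \<open>\<bullet>\<index>\<close> 75)

abbreviation Mor :: "('o, 'k, 'm, 'z) lin_category_scheme \<Rightarrow> 'o \<Rightarrow> 'o \<Rightarrow> 'm set"
  where "Mor C A B \<equiv> carrier (Hom C A B)"

locale klinear_category =
  fixes K :: "'k ring" and C :: "('o, 'k, 'm, 'z) lin_category_scheme" (structure)
  assumes hom_vectorspace:
      "\<lbrakk>A \<in> Obj C; B \<in> Obj C\<rbrakk> \<Longrightarrow> vectorspace K (Hom C A B)"
    and Id_in: "A \<in> Obj C \<Longrightarrow> Id C A \<in> Mor C A A"
    and Comp_in:
      "\<lbrakk>A \<in> Obj C; B \<in> Obj C; D \<in> Obj C; f \<in> Mor C A B; g \<in> Mor C B D\<rbrakk>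
       \<Longrightarrow> g \<bullet> f \<in> Mor C A D"
    and Comp_Id_right: "\<lbrakk>A \<in> Obj C; B \<in> Obj C; f \<in> Mor C A B\<rbrakk> \<Longrightarrow> f \<bullet> Id C A = f"
    and Comp_Id_left: "\<lbrakk>A \<in> Obj C; B \<in> Obj C; f \<in> Mor C A B\<rbrakk> \<Longrightarrow> Id C B \<bullet> f = f"
    and Comp_assoc:
      "\<lbrakk>A \<in> Obj C; B \<in> Obj C; D \<in> Obj C; E \<in> Obj C;
        f \<in> Mor C A B; g \<in> Mor C B D; h \<in> Mor C D E\<rbrakk>
       \<Longrightarrow> (h \<bullet> g) \<bullet> f = h \<bullet> (g \<bullet> f)"
    and Comp_linear_left:
      "\<lbrakk>A \<in> Obj C; B \<in> Obj C; D \<in> Obj C; f \<in> Mor C A B\<rbrakk>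
       \<Longrightarrow> (\<lambda>g. g \<bullet> f) \<in> module_hom K (Hom C B D) (Hom C A D)"
    and Comp_linear_right:
      "\<lbrakk>A \<in> Obj C; B \<in> Obj C; D \<in> Obj C; g \<in> Mor C B D\<rbrakk>
       \<Longrightarrow> (\<lambda>f. g \<bullet> f) \<in> module_hom K (Hom C A B) (Hom C A D)"

definition hom_finite :: "'k ring \<Rightarrow> ('o, 'k, 'm, 'z) lin_category_scheme \<Rightarrow> bool"
  where "hom_finite K C \<longleftrightarrow>
    (\<forall>A\<in>Obj C. \<forall>B\<in>Obj C. vectorspace.fin_dim K (Hom C A B))"

definition iso_mor :: "('o, 'k, 'm, 'z) lin_category_scheme \<Rightarrow> 'o \<Rightarrow> 'o \<Rightarrow> 'm \<Rightarrow> bool"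
  where "iso_mor C A B f \<longleftrightarrow> f \<in> Mor C A B \<and>
    (\<exists>g\<in>Mor C B A. Comp C g f = Id C A \<and> Comp C f g = Id C B)"

definition iso_rel :: "('o, 'k, 'm, 'z) lin_category_scheme \<Rightarrow> ('o \<times> 'o) set"
  where "iso_rel C = {(A, B). A \<in> Obj C \<and> B \<in> Obj C \<and> (\<exists>f. iso_mor C A B f)}"

definition zero_object :: "('o, 'k, 'm, 'z) lin_category_scheme \<Rightarrow> 'o \<Rightarrow> bool"
  where "zero_object C Z \<longleftrightarrow> Z \<in> Obj C \<and>
    (\<forall>A\<in>Obj C. Mor C A Z = {\<zero>\<^bsub>Hom C A Z\<^esub>} \<and> Mor C Z A = {\<zero>\<^bsub>Hom C Z A\<^esub>})"

text \<open>
  \<open>direct_sum C Xs S\<close>: the object \<open>S\<close> is a biproduct of the finite list \<open>Xs\<close>.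
  For the empty list the last equation reads \<open>0 = Id C S\<close>, i.e. \<open>S\<close> is a zero object.
\<close>

definition direct_sum :: "('o, 'k, 'm, 'z) lin_category_scheme \<Rightarrow> 'o list \<Rightarrow> 'o \<Rightarrow> bool"
  where "direct_sum C Xs S \<longleftrightarrow> set Xs \<subseteq> Obj C \<and> S \<in> Obj C \<and>
    (\<exists>u p.
      (\<forall>i<length Xs. u i \<in> Mor C (Xs ! i) S \<and> p i \<in> Mor C S (Xs ! i)) \<and>
      (\<forall>i<length Xs. \<forall>j<length Xs.
        Comp C (p i) (u j) = (if i = j then Id C (Xs ! i) else \<zero>\<^bsub>Hom C (Xs ! j) (Xs ! i)\<^esub>)) \<and>
      (\<Oplus>\<^bsub>Hom C S S\<^esub> i\<in>{..<length Xs}. Comp C (u i) (p i)) = Id C S)"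

locale klinear_additive_category = klinear_category +
  assumes direct_sum_exists: "set Xs \<subseteq> Obj C \<Longrightarrow> \<exists>S. direct_sum C Xs S"

definition direct_summand :: "('o, 'k, 'm, 'z) lin_category_scheme \<Rightarrow> 'o \<Rightarrow> 'o \<Rightarrow> bool"
  where "direct_summand C Y X \<longleftrightarrow> (\<exists>Z. direct_sum C [Y, Z] X)"

definition indecomposable :: "('o, 'k, 'm, 'z) lin_category_scheme \<Rightarrow> 'o \<Rightarrow> bool"
  where "indecomposable C X \<longleftrightarrow> X \<in> Obj C \<and> \<not> zero_object C X \<and>
    (\<forall>A B. direct_sum C [A, B] X \<longrightarrow> zero_object C A \<or> zero_object C B)"

text \<open>The endomorphism ring is nonzero and its non-units are closed under addition.\<close>

definition local_endomorphisms :: "('o, 'k, 'm, 'z) lin_category_scheme \<Rightarrow> 'o \<Rightarrow> bool"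
  where "local_endomorphisms C X \<longleftrightarrow> Id C X \<noteq> \<zero>\<^bsub>Hom C X X\<^esub> \<and>
    (\<forall>f\<in>Mor C X X. \<forall>g\<in>Mor C X X.
      \<not> iso_mor C X X f \<longrightarrow> \<not> iso_mor C X X g \<longrightarrow> \<not> iso_mor C X X (f \<oplus>\<^bsub>Hom C X X\<^esub> g))"

definition krull_schmidt :: "('o, 'k, 'm, 'z) lin_category_scheme \<Rightarrow> bool"
  where "krull_schmidt C \<longleftrightarrow>
    (\<forall>X\<in>Obj C. \<exists>Xs. direct_sum C Xs X \<and> (\<forall>Y\<in>set Xs. local_endomorphisms C Y))"

text \<open>
  The number \<open>|X|\<close>; the quotient is finite in a Krull-Schmidt category, so the
  value \<open>0\<close> of \<^const>\<open>card\<close> on infinite sets does not occur there.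
\<close>

definition num_summands :: "('o, 'k, 'm, 'z) lin_category_scheme \<Rightarrow> 'o \<Rightarrow> nat"
  where "num_summands C X =
    card ({Y \<in> Obj C. indecomposable C Y \<and> direct_summand C Y X} // iso_rel C)"

definition basic :: "('o, 'k, 'm, 'z) lin_category_scheme \<Rightarrow> 'o \<Rightarrow> bool"
  where "basic C X \<longleftrightarrow>
    (\<exists>Xs. direct_sum C Xs X \<and> (\<forall>Y\<in>set Xs. indecomposable C Y) \<and>
      (\<forall>i<length Xs. \<forall>j<length Xs. i \<noteq> j \<longrightarrow> (Xs ! i, Xs ! j) \<notin> iso_rel C))"

text \<open>\<open>Add C M\<close> is the class of objects of \<open>add M\<close>.\<close>

definition Add :: "('o, 'k, 'm, 'z) lin_category_scheme \<Rightarrow> 'o \<Rightarrow> 'o set"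
  where "Add C M =
    {X \<in> Obj C. \<exists>n S. direct_sum C (replicate n M) S \<and> direct_summand C X S}"

text \<open>\<open>factors_through C M X Y\<close> is \<open>[M](X, Y)\<close>.\<close>

definition factors_through ::
    "('o, 'k, 'm, 'z) lin_category_scheme \<Rightarrow> 'o \<Rightarrow> 'o \<Rightarrow> 'o \<Rightarrow> 'm set"
  where "factors_through C M X Y =
    {Comp C g f | f g Z. Z \<in> Add C M \<and> f \<in> Mor C X Z \<and> g \<in> Mor C Z Y}"


section \<open>Linear equivalences and Serre functors\<close>

text \<open>An endofunctor is given by its action \<open>F\<close> on objects and \<open>F'\<close> on morphisms.\<close>

definition klinear_functor ::
    "'k ring \<Rightarrow> ('o, 'k, 'm, 'z) lin_category_scheme \<Rightarrow> ('o \<Rightarrow> 'o) \<Rightarrow> ('m \<Rightarrow> 'm) \<Rightarrow> bool"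
  where "klinear_functor K C F F' \<longleftrightarrow>
    (\<forall>A\<in>Obj C. F A \<in> Obj C \<and> F' (Id C A) = Id C (F A)) \<and>
    (\<forall>A\<in>Obj C. \<forall>B\<in>Obj C. F' \<in> module_hom K (Hom C A B) (Hom C (F A) (F B))) \<and>
    (\<forall>A\<in>Obj C. \<forall>B\<in>Obj C. \<forall>D\<in>Obj C. \<forall>f\<in>Mor C A B. \<forall>g\<in>Mor C B D.
      F' (Comp C g f) = Comp C (F' g) (F' f))"

definition natural_iso ::
    "('o, 'k, 'm, 'z) lin_category_scheme \<Rightarrow> ('o \<Rightarrow> 'o) \<Rightarrow> ('m \<Rightarrow> 'm) \<Rightarrow> ('o \<Rightarrow> 'o) \<Rightarrow> ('m \<Rightarrow> 'm)
      \<Rightarrow> ('o \<Rightarrow> 'm) \<Rightarrow> bool"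
  where "natural_iso C F F' G G' \<eta> \<longleftrightarrow>
    (\<forall>A\<in>Obj C. iso_mor C (F A) (G A) (\<eta> A)) \<and>
    (\<forall>A\<in>Obj C. \<forall>B\<in>Obj C. \<forall>f\<in>Mor C A B. Comp C (\<eta> B) (F' f) = Comp C (G' f) (\<eta> A))"

definition klinear_autoequivalence ::
    "'k ring \<Rightarrow> ('o, 'k, 'm, 'z) lin_category_scheme \<Rightarrow> ('o \<Rightarrow> 'o) \<Rightarrow> ('m \<Rightarrow> 'm) \<Rightarrow> bool"
  where "klinear_autoequivalence K C F F' \<longleftrightarrow> klinear_functor K C F F' \<and>
    (\<exists>G G' \<eta> \<epsilon>. klinear_functor K C G G' \<and>
      natural_iso C id id (G \<circ> F) (G' \<circ> F') \<eta> \<and>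
      natural_iso C (F \<circ> G) (F' \<circ> G') id id \<epsilon>)"

definition field_as_module :: "'k ring \<Rightarrow> ('k, 'k) module"
  where "field_as_module K =
    \<lparr>carrier = carrier K, monoid.mult = monoid.mult K, one = one K, zero = zero K, add = add K,
     smult = monoid.mult K\<rparr>"

text \<open>
  \<open>Hom\<^sub>k(V, k)\<close>; functionals are extensional, i.e. \<^const>\<open>undefined\<close> outside \<open>V\<close>,
  as in \<^const>\<open>ring.func_space\<close>, whose pointwise operations are used.
\<close>

definition dual_space :: "'k ring \<Rightarrow> ('k, 'v) module \<Rightarrow> ('k, 'v \<Rightarrow> 'k) module"
  where "dual_space K V =
    (ring.func_space K (carrier V))
      \<lparr>carrier := module_hom K V (field_as_module K) \<inter> extensional (carrier V)\<rparr>"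

text \<open>
  \<open>\<eta> A B : Hom(A, B) \<rightarrow> Hom\<^sub>k(Hom(B, S A), k)\<close> are the bifunctorial isomorphisms. The
  last clause is naturality along \<open>a : A' \<rightarrow> A\<close> and \<open>b : B \<rightarrow> B'\<close>, evaluated
  at \<open>g : B' \<rightarrow> S A'\<close>.
\<close>

definition serre_functor ::
    "'k ring \<Rightarrow> ('o, 'k, 'm, 'z) lin_category_scheme \<Rightarrow> ('o \<Rightarrow> 'o) \<Rightarrow> ('m \<Rightarrow> 'm) \<Rightarrow> bool"
  where "serre_functor K C S S' \<longleftrightarrow> klinear_autoequivalence K C S S' \<and>
    (\<exists>\<eta>.
      (\<forall>A\<in>Obj C. \<forall>B\<in>Obj C.
        \<eta> A B \<in> module_hom K (Hom C A B) (dual_space K (Hom C B (S A))) \<and>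
        bij_betw (\<eta> A B) (Mor C A B) (carrier (dual_space K (Hom C B (S A))))) \<and>
      (\<forall>A\<in>Obj C. \<forall>A'\<in>Obj C. \<forall>B\<in>Obj C. \<forall>B'\<in>Obj C.
        \<forall>a\<in>Mor C A' A. \<forall>b\<in>Mor C B B'. \<forall>f\<in>Mor C A B. \<forall>g\<in>Mor C B' (S A').
          \<eta> A' B' (Comp C b (Comp C f a)) g = \<eta> A B f (Comp C (S' a) (Comp C g b))))"


section \<open>Triangulated categories\<close>

text \<open>
  \<open>(X, Y, Z, f, g, h) \<in> Triangles D\<close> says that \<open>X \<rightarrow>\<^sup>f Y \<rightarrow>\<^sup>g Z \<rightarrow>\<^sup>h X[1]\<close> is a distinguished triangle.
  \<open>Shift D\<close> and \<open>ShiftM D\<close> are the actions of \<open>[1]\<close> on objects and morphisms; it is only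
  required to be an autoequivalence, which covers the case of an automorphism.
\<close>

record ('o, 'k, 'm) tri_category = "('o, 'k, 'm) lin_category" +
  Shift :: "'o \<Rightarrow> 'o"
  ShiftM :: "'m \<Rightarrow> 'm"
  Triangles :: "('o \<times> 'o \<times> 'o \<times> 'm \<times> 'm \<times> 'm) set"

definition candidate_triangle ::
    "('o, 'k, 'm, 'z) tri_category_scheme \<Rightarrow> 'o \<Rightarrow> 'o \<Rightarrow> 'o \<Rightarrow> 'm \<Rightarrow> 'm \<Rightarrow> 'm \<Rightarrow> bool"
  where "candidate_triangle D X Y Z f g h \<longleftrightarrow> X \<in> Obj D \<and> Y \<in> Obj D \<and> Z \<in> Obj D \<and>
    f \<in> Mor D X Y \<and> g \<in> Mor D Y Z \<and> h \<in> Mor D Z (Shift D X)"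

locale klinear_triangulated_category = klinear_additive_category K D
  for K :: "'k ring" and D :: "('o, 'k, 'm, 'z) tri_category_scheme" (structure) +
  assumes shift: "klinear_autoequivalence K D (Shift D) (ShiftM D)"
    and triangle_candidate:
      "(X, Y, Z, f, g, h) \<in> Triangles D \<Longrightarrow> candidate_triangle D X Y Z f g h"
    and TR1_iso:
      "\<lbrakk>(X, Y, Z, f, g, h) \<in> Triangles D; candidate_triangle D X' Y' Z' f' g' h';
        iso_mor D X X' a; iso_mor D Y Y' b; iso_mor D Z Z' c;
        b \<bullet> f = f' \<bullet> a; c \<bullet> g = g' \<bullet> b; ShiftM D a \<bullet> h = h' \<bullet> c\<rbrakk>
       \<Longrightarrow> (X', Y', Z', f', g', h') \<in> Triangles D"
    and TR1_id:
      "\<lbrakk>X \<in> Obj D; zero_object D Z\<rbrakk>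
       \<Longrightarrow> (X, X, Z, Id D X, \<zero>\<^bsub>Hom D X Z\<^esub>, \<zero>\<^bsub>Hom D Z (Shift D X)\<^esub>) \<in> Triangles D"
    and TR1_cone:
      "\<lbrakk>X \<in> Obj D; Y \<in> Obj D; f \<in> Mor D X Y\<rbrakk> \<Longrightarrow> \<exists>Z g h. (X, Y, Z, f, g, h) \<in> Triangles D"
    and TR2:
      "candidate_triangle D X Y Z f g h \<Longrightarrow>
       (X, Y, Z, f, g, h) \<in> Triangles D \<longleftrightarrow>
       (Y, Z, Shift D X, g, h, \<ominus>\<^bsub>Hom D (Shift D X) (Shift D Y)\<^esub> (ShiftM D f)) \<in> Triangles D"
    and TR3:
      "\<lbrakk>(X, Y, Z, f, g, h) \<in> Triangles D; (X', Y', Z', f', g', h') \<in> Triangles D;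
        a \<in> Mor D X X'; b \<in> Mor D Y Y'; b \<bullet> f = f' \<bullet> a\<rbrakk>
       \<Longrightarrow> \<exists>c\<in>Mor D Z Z'. c \<bullet> g = g' \<bullet> b \<and> ShiftM D a \<bullet> h = h' \<bullet> c"
    and TR4:
      "\<lbrakk>(X, Y, Z', f, i, i') \<in> Triangles D; (Y, Z, X', g, j, j') \<in> Triangles D;
        (X, Z, Y', g \<bullet> f, k, k') \<in> Triangles D\<rbrakk>
       \<Longrightarrow> \<exists>u v. (Z', Y', X', u, v, ShiftM D i \<bullet> j') \<in> Triangles D \<and>
             u \<bullet> i = k \<bullet> g \<and> k' \<bullet> u = i' \<and> v \<bullet> k = j \<and> j' \<bullet> v = ShiftM D f \<bullet> k'"


section \<open>Relative cluster tilting objects\<close>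

definition cluster_tilting :: "('o, 'k, 'm, 'z) tri_category_scheme \<Rightarrow> 'o \<Rightarrow> bool"
  where "cluster_tilting D T \<longleftrightarrow> T \<in> Obj D \<and>
    Add D T = {X \<in> Obj D. Mor D T (Shift D X) = {\<zero>\<^bsub>Hom D T (Shift D X)\<^esub>}} \<and>
    Add D T = {X \<in> Obj D. Mor D X (Shift D T) = {\<zero>\<^bsub>Hom D X (Shift D T)\<^esub>}}"

text \<open>In the following definitions \<open>T\<close> is the cluster-tilting object itself, not \<open>T[1]\<close>.\<close>

definition shift_rigid :: "('o, 'k, 'm, 'z) tri_category_scheme \<Rightarrow> 'o \<Rightarrow> 'o \<Rightarrow> bool"
  where "shift_rigid D T X \<longleftrightarrow> X \<in> Obj D \<and>
    factors_through D (Shift D T) X (Shift D X) = {\<zero>\<^bsub>Hom D X (Shift D X)\<^esub>}"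

definition shift_cluster_tilting :: "('o, 'k, 'm, 'z) tri_category_scheme \<Rightarrow> 'o \<Rightarrow> 'o \<Rightarrow> bool"
  where "shift_cluster_tilting D T X \<longleftrightarrow>
    shift_rigid D T X \<and> num_summands D X = num_summands D T"

text \<open>\<open>star_shift D T M\<close> is \<open>M * [T[1]]\<close>.\<close>

definition star_shift :: "('o, 'k, 'm, 'z) tri_category_scheme \<Rightarrow> 'o \<Rightarrow> 'o \<Rightarrow> 'o set"
  where "star_shift D T M =
    {X \<in> Obj D. \<exists>M' C f \<eta> h. M' \<in> Add D M \<and> (M', X, C, f, \<eta>, h) \<in> Triangles D \<and>
      \<eta> \<in> factors_through D (Shift D T) X C}"

definition shift_tilt :: "('o, 'k, 'm, 'z) tri_category_scheme \<Rightarrow> 'o \<Rightarrow> 'o set set"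
  where "shift_tilt D T = {X \<in> Obj D. basic D X \<and> shift_cluster_tilting D T X} // iso_rel D"

text \<open>
  The relation on isomorphism classes is tested on all representatives, so its
  reflexivity on \<open>shift_tilt D T\<close> includes independence of the representatives.
\<close>

definition tilt_ge :: "('o, 'k, 'm, 'z) tri_category_scheme \<Rightarrow> 'o \<Rightarrow> 'o set \<Rightarrow> 'o set \<Rightarrow> bool"
  where "tilt_ge D T P Q \<longleftrightarrow> (\<forall>M\<in>P. \<forall>N\<in>Q. star_shift D T M \<supseteq> star_shift D T N)"

end

theory Submission
  imports Defs
begin

text \<open>
  Reflexivity and transitivity are formal. For antisymmetry let \<open>M * [T[1]] = N * [T[1]]\<close>. Then
  \<open>N\<close> lies in \<open>M * [T[1]]\<close>, so a morphism from an object of \<open>add T[1]\<close> to \<open>N[1]\<close> lifts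
  to some \<open>M'[1]\<close> with \<open>M'\<close> in \<open>add M\<close>; rigidity of \<open>M\<close> gives \<open>[T[1]](M, N[1]) = 0\<close>, and
  symmetrically \<open>[T[1]](N, M[1]) = 0\<close>. Since \<open>|M| = |N| = |T|\<close>, it remains to show that a finite
  family of pairwise non-isomorphic indecomposables \<open>X\<close> with \<open>[T[1]](X, X'[1]) = 0\<close> for all
  members \<open>X, X'\<close> has at most \<open>|T|\<close> members.

  Each \<open>X\<close> has a triangle \<open>P \<rightarrow>\<^sup>f Q \<rightarrow> X \<rightarrow> P[1]\<close> with \<open>P, Q\<close> in \<open>add T\<close>. If the family
  is too large, its indices \<open>[Q] - [P]\<close> satisfy an integral relation with coefficients \<open>a\<^sub>X\<close>.
  For a subfunctor \<open>I\<close> of \<open>Hom(-, Y)\<close> with \<open>I(P) = I(Q)f\<close>, the kernel of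
  \<open>I(Q) \<rightarrow> I(P)\<close> has dimension \<open>dim I(Q) - dim I(P)\<close>, so these dimensions satisfy the same
  relation. Comparing \<open>Hom(-, Y)\<close> with its subfunctor of morphisms factoring through the \<open>X\<close> whose
  coefficient has the sign opposite to \<open>a\<^sub>Y\<close> shows that \<open>Q \<rightarrow> Y\<close> factors in this way. By
  Nakayama's lemma \<open>Hom(T, Y) = 0\<close> whenever \<open>a\<^sub>Y \<noteq> 0\<close>, so \<open>Y\<close> is the shift of a summand of
  \<open>T\<close>; but the indices of distinct such \<open>Y\<close> are linearly independent.
\<close>

text \<open>The number |T| enters as a rank: indices are integer vectors with one coordinate per
  isomorphism class of indecomposable summands of \<open>T\<close>, so more than |T| of them are
  linearly dependent. Dependence alone is no contradiction, since it speaks of presentations and not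
  of maps between members of the family; the obstacle is to turn it into morphisms. This is where
  [T[1]](X, X'[1]) = 0 acts: X -> P[1] ends in add T[1], so every map P -> X' extends along
  \<open>f\<close> to \<open>Q\<close>. Hence Hom(-, Y) and its subfunctors of sums of maps through
  members of the family all satisfy I(P) = I(Q)f, and two instances of the same numerical relation
  can be subtracted. Choosing the subfunctor by sign makes the terms of the difference, multiplied
  by the coefficient of \<open>Y\<close>, nonnegative, so that no cancellation hides a nonzero term.
  A coefficient never has the sign opposite to itself, so the factorizations Q -> X' -> Y obtained
  avoid \<open>Y\<close>; composites Y -> X' -> Y are then radical, which is what Nakayama's lemma
  requires.\<close>

lemma additive_finsum:
  assumes G: "abelian_group G" and H: "abelian_group H"
    and h: "h \<in> carrier G \<rightarrow> carrier H"
    and add: "\<And>x y. \<lbrakk>x \<in> carrier G; y \<in> carrier G\<rbrakk> \<Longrightarrow> h (x \<oplus>\<^bsub>G\<^esub> y) = h x \<oplus>\<^bsub>H\<^esub> h y"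
    and z: "h \<zero>\<^bsub>G\<^esub> = \<zero>\<^bsub>H\<^esub>"
    and f: "f \<in> I \<rightarrow> carrier G"
  shows "h (\<Oplus>\<^bsub>G\<^esub>i\<in>I. f i) = (\<Oplus>\<^bsub>H\<^esub>i\<in>I. h (f i))"
proof -
  interpret G: abelian_group G by fact
  interpret H: abelian_group H by fact
  show ?thesis
    using f
  \<comment> \<open>For an infinite index set both sums take the default value zero, so the claim
    reduces to \<open>h\<close> preserving zero.\<close>
  proof (induct I rule: infinite_finite_induct)
    case (insert i I)
    have fi: "f i \<in> carrier G" and fI: "f \<in> I \<rightarrow> carrier G" using insert by auto
    have hf: "(\<lambda>i. h (f i)) \<in> I \<rightarrow> carrier H" "h (f i) \<in> carrier H" using h fi fI by auto
    show ?case
      using insert fi fI hf by (simp add: add)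
  qed (simp_all add: z)
qed

section \<open>Arithmetic of morphisms\<close>

context klinear_category
begin

abbreviation (input) Hm where "Hm A B \<equiv> Hom C A B"

text \<open>Hom-spaces may overlap and the axioms speak only of members of \<open>Obj C\<close>.
  Bundling the memberships of source, target and morphism gives one typing judgement that discharges
  the side conditions of all axioms.\<close>

definition arr :: "'m \<Rightarrow> 'o \<Rightarrow> 'o \<Rightarrow> bool" where
  "arr f A B \<longleftrightarrow> A \<in> Obj C \<and> B \<in> Obj C \<and> f \<in> Mor C A B"

lemma arrD: "arr f A B \<Longrightarrow> A \<in> Obj C" "arr f A B \<Longrightarrow> B \<in> Obj C" "arr f A B \<Longrightarrow> f \<in> Mor C A B"
  by (simp_all add: arr_def)

lemma hom_group: "\<lbrakk>A \<in> Obj C; B \<in> Obj C\<rbrakk> \<Longrightarrow> abelian_group (Hm A B)"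
  using hom_vectorspace[of A B] by (simp add: vectorspace_def module_def)

lemma hom_module: "\<lbrakk>A \<in> Obj C; B \<in> Obj C\<rbrakk> \<Longrightarrow> module K (Hm A B)"
  using hom_vectorspace[of A B] by (simp add: vectorspace_def)

lemma arr_comp [intro]: "\<lbrakk>arr f A B; arr g B E\<rbrakk> \<Longrightarrow> arr (g \<bullet> f) A E"
  unfolding arr_def using Comp_in[of A B E f g] by blast

lemma arr_id [intro]: "A \<in> Obj C \<Longrightarrow> arr (Id C A) A A"
  by (simp add: arr_def Id_in)

lemma arr_zero [intro]: "\<lbrakk>A \<in> Obj C; B \<in> Obj C\<rbrakk> \<Longrightarrow> arr \<zero>\<^bsub>Hm A B\<^esub> A B"
  unfolding arr_def using hom_group[of A B] by (simp add: abelian_group_def abelian_monoid.zero_closed)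

lemma arr_add [intro]: "\<lbrakk>arr f A B; arr g A B\<rbrakk> \<Longrightarrow> arr (f \<oplus>\<^bsub>Hm A B\<^esub> g) A B"
  unfolding arr_def using hom_group[of A B] by (simp add: abelian_group_def abelian_monoid.a_closed)

lemma arr_neg [intro]: "arr f A B \<Longrightarrow> arr (\<ominus>\<^bsub>Hm A B\<^esub> f) A B"
  unfolding arr_def using hom_group[of A B] by (simp add: abelian_group.a_inv_closed)

lemma arr_smult [intro]: "\<lbrakk>c \<in> carrier K; arr f A B\<rbrakk> \<Longrightarrow> arr (c \<odot>\<^bsub>Hm A B\<^esub> f) A B"
  unfolding arr_def using hom_module[of A B] by (simp add: module.smult_closed)

lemma arr_finsum: "\<lbrakk>A \<in> Obj C; B \<in> Obj C; \<And>i. i \<in> I \<Longrightarrow> arr (f i) A B\<rbrakk> \<Longrightarrow> arr (\<Oplus>\<^bsub>Hm A B\<^esub>i\<in>I. f i) A B"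
  unfolding arr_def using hom_group[of A B]
  by (auto simp: abelian_group_def intro!: abelian_monoid.finsum_closed)

lemma comp_id_right [simp]: "arr f A B \<Longrightarrow> f \<bullet> Id C A = f"
  unfolding arr_def using Comp_Id_right[of A B f] by blast

lemma comp_id_left [simp]: "arr f A B \<Longrightarrow> Id C B \<bullet> f = f"
  unfolding arr_def using Comp_Id_left[of A B f] by blast

lemma comp_id_id [simp]: "A \<in> Obj C \<Longrightarrow> Id C A \<bullet> Id C A = Id C A"
  using comp_id_right[OF arr_id] .

lemma comp_assoc: "\<lbrakk>arr f A B; arr g B E; arr h E F\<rbrakk> \<Longrightarrow> (h \<bullet> g) \<bullet> f = h \<bullet> (g \<bullet> f)"
  unfolding arr_def using Comp_assoc[of A B E F f g h] by blast

lemma comp_add_left: "\<lbrakk>arr f A B; arr g B E; arr h B E\<rbrakk>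
    \<Longrightarrow> (g \<oplus>\<^bsub>Hm B E\<^esub> h) \<bullet> f = (g \<bullet> f) \<oplus>\<^bsub>Hm A E\<^esub> (h \<bullet> f)"
  unfolding arr_def using module_hom_add[OF Comp_linear_left[of A B E f]] by blast

lemma comp_add_right: "\<lbrakk>arr f A B; arr g A B; arr h B E\<rbrakk>
    \<Longrightarrow> h \<bullet> (f \<oplus>\<^bsub>Hm A B\<^esub> g) = (h \<bullet> f) \<oplus>\<^bsub>Hm A E\<^esub> (h \<bullet> g)"
  unfolding arr_def using module_hom_add[OF Comp_linear_right[of A B E h]] by blast

lemma comp_smult_left: "\<lbrakk>arr f A B; arr g B E; c \<in> carrier K\<rbrakk>
    \<Longrightarrow> (c \<odot>\<^bsub>Hm B E\<^esub> g) \<bullet> f = c \<odot>\<^bsub>Hm A E\<^esub> (g \<bullet> f)"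
  unfolding arr_def using module_hom_smult[OF Comp_linear_left[of A B E f]] by blast

lemma comp_smult_right: "\<lbrakk>arr f A B; arr g B E; c \<in> carrier K\<rbrakk>
    \<Longrightarrow> g \<bullet> (c \<odot>\<^bsub>Hm A B\<^esub> f) = c \<odot>\<^bsub>Hm A E\<^esub> (g \<bullet> f)"
  unfolding arr_def using module_hom_smult[OF Comp_linear_right[of A B E g]] by blast

lemma add_zero_right: "arr f A B \<Longrightarrow> f \<oplus>\<^bsub>Hm A B\<^esub> \<zero>\<^bsub>Hm A B\<^esub> = f"
  unfolding arr_def using hom_group[of A B] by (simp add: abelian_group_def abelian_monoid.r_zero)

lemma add_zero_left: "arr f A B \<Longrightarrow> \<zero>\<^bsub>Hm A B\<^esub> \<oplus>\<^bsub>Hm A B\<^esub> f = f"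
  unfolding arr_def using hom_group[of A B] by (simp add: abelian_group_def abelian_monoid.l_zero)

lemma add_commute: "\<lbrakk>arr f A B; arr g A B\<rbrakk> \<Longrightarrow> f \<oplus>\<^bsub>Hm A B\<^esub> g = g \<oplus>\<^bsub>Hm A B\<^esub> f"
  unfolding arr_def using hom_group[of A B] by (simp add: abelian_group_def abelian_monoid.a_comm)

lemma add_assoc: "\<lbrakk>arr f A B; arr g A B; arr h A B\<rbrakk>
    \<Longrightarrow> (f \<oplus>\<^bsub>Hm A B\<^esub> g) \<oplus>\<^bsub>Hm A B\<^esub> h = f \<oplus>\<^bsub>Hm A B\<^esub> (g \<oplus>\<^bsub>Hm A B\<^esub> h)"
  unfolding arr_def using hom_group[of A B] by (simp add: abelian_group_def abelian_monoid.a_assoc)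

lemma add_neg: "arr f A B \<Longrightarrow> f \<oplus>\<^bsub>Hm A B\<^esub> \<ominus>\<^bsub>Hm A B\<^esub> f = \<zero>\<^bsub>Hm A B\<^esub>"
  unfolding arr_def using hom_group[of A B] by (simp add: abelian_group.r_neg)

lemma neg_neg: "arr f A B \<Longrightarrow> \<ominus>\<^bsub>Hm A B\<^esub> (\<ominus>\<^bsub>Hm A B\<^esub> f) = f"
  unfolding arr_def using hom_group[of A B] by (simp add: abelian_group.minus_minus)

lemma neg_eqI: "\<lbrakk>arr f A B; arr g A B; f \<oplus>\<^bsub>Hm A B\<^esub> g = \<zero>\<^bsub>Hm A B\<^esub>\<rbrakk> \<Longrightarrow> \<ominus>\<^bsub>Hm A B\<^esub> f = g"
  by (metis add_assoc add_commute add_neg add_zero_left add_zero_right arr_neg)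

lemma add_cancel_zero: "\<lbrakk>arr f A B; arr g A B; f \<oplus>\<^bsub>Hm A B\<^esub> g = f\<rbrakk> \<Longrightarrow> g = \<zero>\<^bsub>Hm A B\<^esub>"
  by (metis add_assoc add_commute add_neg add_zero_left arr_neg)

lemma comp_zero_left [simp]: "\<lbrakk>arr f A B; E \<in> Obj C\<rbrakk> \<Longrightarrow> \<zero>\<^bsub>Hm B E\<^esub> \<bullet> f = \<zero>\<^bsub>Hm A E\<^esub>"
proof -
  assume f: "arr f A B" and E: "E \<in> Obj C"
  let ?z = "\<zero>\<^bsub>Hm B E\<^esub>"
  have z: "arr ?z B E" using arrD(2)[OF f] E by blast
  have "?z \<bullet> f \<oplus>\<^bsub>Hm A E\<^esub> ?z \<bullet> f = ?z \<bullet> f"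
    using comp_add_left[OF f z z] add_zero_right[OF z] by simp
  then show ?thesis using add_cancel_zero[OF arr_comp[OF f z] arr_comp[OF f z]] by simp
qed

lemma comp_zero_right [simp]: "\<lbrakk>arr f B E; A \<in> Obj C\<rbrakk> \<Longrightarrow> f \<bullet> \<zero>\<^bsub>Hm A B\<^esub> = \<zero>\<^bsub>Hm A E\<^esub>"
proof -
  assume f: "arr f B E" and A: "A \<in> Obj C"
  let ?z = "\<zero>\<^bsub>Hm A B\<^esub>"
  have z: "arr ?z A B" using arrD(1)[OF f] A by blast
  have "f \<bullet> ?z \<oplus>\<^bsub>Hm A E\<^esub> f \<bullet> ?z = f \<bullet> ?z"
    using comp_add_right[OF z z f] add_zero_right[OF z] by simp
  then show ?thesis using add_cancel_zero[OF arr_comp[OF z f] arr_comp[OF z f]] by simp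
qed

lemma comp_neg_left: "\<lbrakk>arr f A B; arr g B E\<rbrakk> \<Longrightarrow> (\<ominus>\<^bsub>Hm B E\<^esub> g) \<bullet> f = \<ominus>\<^bsub>Hm A E\<^esub> (g \<bullet> f)"
proof (rule neg_eqI[symmetric])
  assume f: "arr f A B" and g: "arr g B E"
  show "g \<bullet> f \<oplus>\<^bsub>Hm A E\<^esub> (\<ominus>\<^bsub>Hm B E\<^esub> g) \<bullet> f = \<zero>\<^bsub>Hm A E\<^esub>"
    using comp_add_left[OF f g arr_neg[OF g]] add_neg[OF g] comp_zero_left[OF f arrD(2)[OF g]] by simp
qed blast+

lemma comp_neg_right: "\<lbrakk>arr f A B; arr g B E\<rbrakk> \<Longrightarrow> g \<bullet> (\<ominus>\<^bsub>Hm A B\<^esub> f) = \<ominus>\<^bsub>Hm A E\<^esub> (g \<bullet> f)"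
proof (rule neg_eqI[symmetric])
  assume f: "arr f A B" and g: "arr g B E"
  show "g \<bullet> f \<oplus>\<^bsub>Hm A E\<^esub> g \<bullet> (\<ominus>\<^bsub>Hm A B\<^esub> f) = \<zero>\<^bsub>Hm A E\<^esub>"
    using comp_add_right[OF f arr_neg[OF f] g] add_neg[OF f] comp_zero_right[OF g arrD(1)[OF f]] by simp
qed blast+

lemma comp_finsum_left:
  assumes "arr f A B" "E \<in> Obj C" "\<And>i. i \<in> I \<Longrightarrow> arr (g i) B E"
  shows "(\<Oplus>\<^bsub>Hm B E\<^esub>i\<in>I. g i) \<bullet> f = (\<Oplus>\<^bsub>Hm A E\<^esub>i\<in>I. g i \<bullet> f)"
proof (rule additive_finsum[of "Hm B E" "Hm A E" "\<lambda>g. g \<bullet> f"])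
  show "abelian_group (Hm B E)" "abelian_group (Hm A E)"
    using hom_group arrD[OF assms(1)] assms(2) by auto
  show "(\<lambda>g. g \<bullet> f) \<in> Mor C B E \<rightarrow> Mor C A E" "g \<in> I \<rightarrow> Mor C B E"
    using arr_comp[OF assms(1), of _ E] arrD[OF assms(1)] assms(2,3) by (auto simp: arr_def)
  show "(x \<oplus>\<^bsub>Hm B E\<^esub> y) \<bullet> f = x \<bullet> f \<oplus>\<^bsub>Hm A E\<^esub> y \<bullet> f" if "x \<in> Mor C B E" "y \<in> Mor C B E" for x y
    using comp_add_left[OF assms(1), of x E y] that arrD[OF assms(1)] assms(2) by (simp add: arr_def)
  show "\<zero>\<^bsub>Hm B E\<^esub> \<bullet> f = \<zero>\<^bsub>Hm A E\<^esub>" using comp_zero_left[OF assms(1,2)] .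
qed

lemma comp_finsum_right:
  assumes "arr f B E" "A \<in> Obj C" "\<And>i. i \<in> I \<Longrightarrow> arr (g i) A B"
  shows "f \<bullet> (\<Oplus>\<^bsub>Hm A B\<^esub>i\<in>I. g i) = (\<Oplus>\<^bsub>Hm A E\<^esub>i\<in>I. f \<bullet> g i)"
proof (rule additive_finsum[of "Hm A B" "Hm A E" "\<lambda>g. f \<bullet> g"])
  show "abelian_group (Hm A B)" "abelian_group (Hm A E)"
    using hom_group arrD[OF assms(1)] assms(2) by auto
  show "(\<lambda>g. f \<bullet> g) \<in> Mor C A B \<rightarrow> Mor C A E" "g \<in> I \<rightarrow> Mor C A B"
    using arr_comp[OF _ assms(1), of _ A] arrD[OF assms(1)] assms(2,3) by (auto simp: arr_def)
  show "f \<bullet> (x \<oplus>\<^bsub>Hm A B\<^esub> y) = f \<bullet> x \<oplus>\<^bsub>Hm A E\<^esub> f \<bullet> y" if "x \<in> Mor C A B" "y \<in> Mor C A B" for x y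
    using comp_add_right[OF _ _ assms(1), of x A y] that arrD[OF assms(1)] assms(2) by (simp add: arr_def)
  show "f \<bullet> \<zero>\<^bsub>Hm A B\<^esub> = \<zero>\<^bsub>Hm A E\<^esub>" using comp_zero_right[OF assms(1,2)] .
qed

lemma finsum_arr_cong:
  assumes "I = J" "\<And>i. i \<in> J \<Longrightarrow> f i = g i" "\<And>i. i \<in> J \<Longrightarrow> arr (g i) A B" "A \<in> Obj C" "B \<in> Obj C"
  shows "(\<Oplus>\<^bsub>Hm A B\<^esub>i\<in>I. f i) = (\<Oplus>\<^bsub>Hm A B\<^esub>i\<in>J. g i)"
proof -
  interpret abelian_group "Hm A B" using assms hom_group by blast
  show ?thesis by (rule finsum_cong') (use assms in \<open>auto simp: arr_def\<close>)
qed

lemma finsum_arr_zero: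
  assumes "\<And>i. i \<in> I \<Longrightarrow> f i = \<zero>\<^bsub>Hm A B\<^esub>" "A \<in> Obj C" "B \<in> Obj C"
  shows "(\<Oplus>\<^bsub>Hm A B\<^esub>i\<in>I. f i) = \<zero>\<^bsub>Hm A B\<^esub>"
proof -
  interpret abelian_group "Hm A B" using assms hom_group by blast
  show ?thesis by (subst finsum_cong'[of _ I "\<lambda>_. \<zero>\<^bsub>Hm A B\<^esub>"]) (use assms in auto)
qed

lemma finsum_arr_single:
  assumes "finite I" "k \<in> I" "\<And>i. \<lbrakk>i \<in> I; i \<noteq> k\<rbrakk> \<Longrightarrow> f i = \<zero>\<^bsub>Hm A B\<^esub>" "arr (f k) A B"
  shows "(\<Oplus>\<^bsub>Hm A B\<^esub>i\<in>I. f i) = f k"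
proof -
  have ob: "A \<in> Obj C" "B \<in> Obj C" using assms arrD by blast+
  interpret abelian_group "Hm A B" using ob hom_group by blast
  have "(\<Oplus>\<^bsub>Hm A B\<^esub>i\<in>I. f i) = (\<Oplus>\<^bsub>Hm A B\<^esub>i\<in>I. if k = i then f i else \<zero>\<^bsub>Hm A B\<^esub>)"
    by (rule finsum_arr_cong) (use assms ob in auto)
  also have "\<dots> = f k"
  proof (rule finsum_singleton)
    show "f \<in> I \<rightarrow> Mor C A B"
    proof
      fix i assume "i \<in> I"
      then show "f i \<in> Mor C A B" using assms(3)[of i] arrD(3)[OF assms(4)] ob by (cases "i = k") auto
    qed
  qed (use assms in auto)
  finally show ?thesis .
qed

lemma finsum_arr_remove:
  assumes "finite I" "k \<in> I" "\<And>i. i \<in> I \<Longrightarrow> arr (f i) A B"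
  shows "(\<Oplus>\<^bsub>Hm A B\<^esub>i\<in>I. f i) = f k \<oplus>\<^bsub>Hm A B\<^esub> (\<Oplus>\<^bsub>Hm A B\<^esub>i\<in>I - {k}. f i)"
proof -
  have ob: "A \<in> Obj C" "B \<in> Obj C" using assms arrD by blast+
  interpret abelian_group "Hm A B" using ob hom_group by blast
  have "(\<Oplus>\<^bsub>Hm A B\<^esub>i\<in>insert k (I - {k}). f i) = f k \<oplus>\<^bsub>Hm A B\<^esub> (\<Oplus>\<^bsub>Hm A B\<^esub>i\<in>I - {k}. f i)"
    by (rule finsum_insert) (use assms ob in \<open>auto simp: arr_def\<close>)
  then show ?thesis using assms(2) by (simp add: insert_absorb)
qed

section \<open>Isomorphisms, retracts, direct sums\<close>

lemma iso_mor_iff: "\<lbrakk>A \<in> Obj C; B \<in> Obj C\<rbrakk> \<Longrightarrow> iso_mor C A B f \<longleftrightarrow>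
    arr f A B \<and> (\<exists>g. arr g B A \<and> g \<bullet> f = Id C A \<and> f \<bullet> g = Id C B)"
  by (auto simp: iso_mor_def arr_def)

lemma iso_morI: "\<lbrakk>arr f A B; arr g B A; g \<bullet> f = Id C A; f \<bullet> g = Id C B\<rbrakk> \<Longrightarrow> iso_mor C A B f"
  by (auto simp: iso_mor_def arr_def)

lemma iso_relI: "\<lbrakk>arr f A B; arr g B A; g \<bullet> f = Id C A; f \<bullet> g = Id C B\<rbrakk> \<Longrightarrow> (A, B) \<in> iso_rel C"
  using iso_morI[of f A B g] by (auto simp: iso_rel_def arr_def)

lemma iso_relE:
  assumes "(A, B) \<in> iso_rel C"
  obtains f g where "arr f A B" "arr g B A" "g \<bullet> f = Id C A" "f \<bullet> g = Id C B"
  using assms unfolding iso_rel_def iso_mor_def arr_def by blast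

lemma iso_rel_refl: "A \<in> Obj C \<Longrightarrow> (A, A) \<in> iso_rel C"
  by (rule iso_relI[of "Id C A" A A "Id C A"]) auto

lemma iso_rel_sym: "(A, B) \<in> iso_rel C \<Longrightarrow> (B, A) \<in> iso_rel C"
  by (metis iso_relE iso_relI)

text \<open>Reassociation brings the middle pair \<open>g' \<bullet> g\<close> together, where it
  cancels; composites of isomorphisms and of retractions are checked in this shape.\<close>

lemma comp_cancel_mid:
  assumes "arr f A B" "arr g B E" "arr g' E B" "arr h B F" "g' \<bullet> g = Id C B"
  shows "(h \<bullet> g') \<bullet> (g \<bullet> f) = h \<bullet> f"
  using comp_assoc[OF arr_comp[OF assms(1,2)] assms(3,4)] comp_assoc[OF assms(1-3)] assms(1,5) by simp

lemma iso_rel_trans: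
  assumes "(A, B) \<in> iso_rel C" "(B, E) \<in> iso_rel C"
  shows "(A, E) \<in> iso_rel C"
proof -
  obtain f g where f: "arr f A B" "arr g B A" "g \<bullet> f = Id C A" "f \<bullet> g = Id C B"
    using assms(1) by (rule iso_relE)
  obtain f' g' where f': "arr f' B E" "arr g' E B" "g' \<bullet> f' = Id C B" "f' \<bullet> g' = Id C E"
    using assms(2) by (rule iso_relE)
  show ?thesis
    by (rule iso_relI[of "f' \<bullet> f" A E "g \<bullet> g'"])
      (use f f' comp_cancel_mid[OF f(1) f'(1,2) f(2)] comp_cancel_mid[OF f'(2) f(2,1) f'(1)] in auto)
qed

lemma equiv_iso_rel: "equiv (Obj C) (iso_rel C)"
proof -
  have "iso_rel C \<subseteq> Obj C \<times> Obj C" by (auto simp: iso_rel_def)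
  moreover have "refl_on (Obj C) (iso_rel C)" using iso_rel_refl calculation unfolding refl_on_def by blast
  moreover have "sym (iso_rel C)" using iso_rel_sym by (rule symI)
  moreover have "trans (iso_rel C)" using iso_rel_trans by (rule transI)
  ultimately show ?thesis by (simp add: equiv_def)
qed

text \<open>Every morphism into or out of \<open>Z\<close> equals its composite with
  \<open>Id C Z\<close> and is therefore zero.\<close>

lemma zero_objectI:
  assumes "Z \<in> Obj C" "Id C Z = \<zero>\<^bsub>Hm Z Z\<^esub>"
  shows "zero_object C Z"
proof -
  have "f = \<zero>\<^bsub>Hm A Z\<^esub>" if "arr f A Z" for f A
    using that assms by (metis arrD(1) comp_id_left comp_zero_left)
  moreover have "f = \<zero>\<^bsub>Hm Z A\<^esub>" if "arr f Z A" for f A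
    using that assms by (metis arrD(2) comp_id_right comp_zero_right)
  ultimately show ?thesis
    using assms arr_zero unfolding zero_object_def arr_def by blast
qed

lemma zero_objectD:
  assumes "zero_object C Z"
  shows "Z \<in> Obj C" "Id C Z = \<zero>\<^bsub>Hm Z Z\<^esub>"
    "arr f A Z \<Longrightarrow> f = \<zero>\<^bsub>Hm A Z\<^esub>" "arr f Z A \<Longrightarrow> f = \<zero>\<^bsub>Hm Z A\<^esub>"
  using assms Id_in[of Z] unfolding zero_object_def arr_def by blast+

text \<open>A summand without a chosen complement. Arguments in local endomorphism rings need only
  \<open>u\<close> and \<open>p\<close>; complements, whose construction needs direct sums to exist,
  are supplied by \<open>direct_sum_split_off\<close>.\<close>

definition retract :: "'o \<Rightarrow> 'o \<Rightarrow> bool" where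
  "retract Y X \<longleftrightarrow> (\<exists>u p. arr u Y X \<and> arr p X Y \<and> p \<bullet> u = Id C Y)"

lemma retract_trans:
  assumes "retract X Y" "retract Y Z" shows "retract X Z"
proof -
  obtain u p where u: "arr u X Y" "arr p Y X" "p \<bullet> u = Id C X" using assms(1) unfolding retract_def by blast
  obtain v q where v: "arr v Y Z" "arr q Z Y" "q \<bullet> v = Id C Y" using assms(2) unfolding retract_def by blast
  show ?thesis unfolding retract_def
    using comp_cancel_mid[OF u(1) v(1,2) u(2)] u v by (metis arr_comp)
qed

lemma iso_retract: "(A, B) \<in> iso_rel C \<Longrightarrow> retract A B"
  by (elim iso_relE) (auto simp: retract_def)

section \<open>Biproducts of finite lists\<close>

lemma direct_sumE:
  assumes "direct_sum C Xs S"
  obtains u p where "S \<in> Obj C" "\<And>i. i < length Xs \<Longrightarrow> Xs ! i \<in> Obj C"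
    "\<And>i. i < length Xs \<Longrightarrow> arr (u i) (Xs ! i) S" "\<And>i. i < length Xs \<Longrightarrow> arr (p i) S (Xs ! i)"
    "\<And>i. i < length Xs \<Longrightarrow> p i \<bullet> u i = Id C (Xs ! i)"
    "\<And>i j. \<lbrakk>i < length Xs; j < length Xs; i \<noteq> j\<rbrakk> \<Longrightarrow> p i \<bullet> u j = \<zero>\<^bsub>Hm (Xs ! j) (Xs ! i)\<^esub>"
    "(\<Oplus>\<^bsub>Hm S S\<^esub>i\<in>{..<length Xs}. u i \<bullet> p i) = Id C S"
proof -
  obtain u p where *: "\<forall>i<length Xs. u i \<in> Mor C (Xs ! i) S \<and> p i \<in> Mor C S (Xs ! i)"
      "\<forall>i<length Xs. \<forall>j<length Xs.
        p i \<bullet> u j = (if i = j then Id C (Xs ! i) else \<zero>\<^bsub>Hom C (Xs ! j) (Xs ! i)\<^esub>)"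
      "(\<Oplus>\<^bsub>Hom C S S\<^esub> i\<in>{..<length Xs}. u i \<bullet> p i) = Id C S"
    using assms unfolding direct_sum_def by blast
  have ob: "S \<in> Obj C" "\<And>i. i < length Xs \<Longrightarrow> Xs ! i \<in> Obj C"
    using assms unfolding direct_sum_def by auto
  show ?thesis
    by (rule that[of u p]) (use * ob in \<open>auto simp: arr_def\<close>)
qed

lemma direct_sumI:
  assumes "S \<in> Obj C"
    "\<And>i. i < length Xs \<Longrightarrow> arr (u i) (Xs ! i) S" "\<And>i. i < length Xs \<Longrightarrow> arr (p i) S (Xs ! i)"
    "\<And>i. i < length Xs \<Longrightarrow> p i \<bullet> u i = Id C (Xs ! i)"
    "\<And>i j. \<lbrakk>i < length Xs; j < length Xs; i \<noteq> j\<rbrakk> \<Longrightarrow> p i \<bullet> u j = \<zero>\<^bsub>Hm (Xs ! j) (Xs ! i)\<^esub>"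
    "(\<Oplus>\<^bsub>Hm S S\<^esub>i\<in>{..<length Xs}. u i \<bullet> p i) = Id C S"
  shows "direct_sum C Xs S"
  unfolding direct_sum_def
  by (intro conjI exI[of _ u] exI[of _ p])
    (use assms in \<open>auto simp: arr_def in_set_conv_nth\<close>)

lemma direct_sum_obj: "direct_sum C Xs S \<Longrightarrow> S \<in> Obj C" "direct_sum C Xs S \<Longrightarrow> set Xs \<subseteq> Obj C"
  by (auto simp: direct_sum_def)

lemma direct_sum_Nil: "direct_sum C [] Z \<longleftrightarrow> zero_object C Z"
proof
  assume *: "direct_sum C [] Z"
  then have Z: "Z \<in> Obj C" by (simp add: direct_sum_def)
  then interpret abelian_group "Hm Z Z" using hom_group by blast
  show "zero_object C Z"
    using * Z by (intro zero_objectI) (auto simp: direct_sum_def)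
next
  assume "zero_object C Z"
  then show "direct_sum C [] Z"
    using hom_group[of Z Z] zero_objectD[of Z]
    by (auto intro!: direct_sumI[of _ _ undefined undefined] simp: abelian_group_def abelian_monoid.finsum_empty)
qed

lemma direct_sum_singleton: "Y \<in> Obj C \<Longrightarrow> direct_sum C [Y] Y"
  by (rule direct_sumI[of _ _ "\<lambda>_. Id C Y" "\<lambda>_. Id C Y"])
    (auto intro!: finsum_arr_single[of "{..<Suc 0}" 0])

text \<open>The identity of \<open>S\<close>, written as the sum of the
  \<open>u i \<bullet> p i\<close>, is inserted between \<open>f\<close> and
  \<open>g\<close>.\<close>

lemma direct_sum_comp:
  assumes "\<And>i. i < length Xs \<Longrightarrow> arr (u i) (Xs ! i) S" "\<And>i. i < length Xs \<Longrightarrow> arr (p i) S (Xs ! i)"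
    and "(\<Oplus>\<^bsub>Hm S S\<^esub>i\<in>{..<length Xs}. u i \<bullet> p i) = Id C S"
    and "arr f A S" "arr g S B"
  shows "g \<bullet> f = (\<Oplus>\<^bsub>Hm A B\<^esub>i\<in>{..<length Xs}. (g \<bullet> u i) \<bullet> (p i \<bullet> f))"
proof -
  have "g \<bullet> f = g \<bullet> ((\<Oplus>\<^bsub>Hm S S\<^esub>i\<in>{..<length Xs}. u i \<bullet> p i) \<bullet> f)" using assms by auto
  also have "\<dots> = g \<bullet> (\<Oplus>\<^bsub>Hm A S\<^esub>i\<in>{..<length Xs}. (u i \<bullet> p i) \<bullet> f)"
    by (subst comp_finsum_left) (use assms arrD in auto)
  also have "\<dots> = (\<Oplus>\<^bsub>Hm A B\<^esub>i\<in>{..<length Xs}. g \<bullet> ((u i \<bullet> p i) \<bullet> f))"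
    by (subst comp_finsum_right) (use assms arrD in auto)
  also have "\<dots> = (\<Oplus>\<^bsub>Hm A B\<^esub>i\<in>{..<length Xs}. (g \<bullet> u i) \<bullet> (p i \<bullet> f))"
  proof (rule finsum_arr_cong)
    fix i assume "i \<in> {..<length Xs}"
    then have u: "arr (u i) (Xs ! i) S" and p: "arr (p i) S (Xs ! i)" using assms by auto
    show "g \<bullet> (u i \<bullet> p i) \<bullet> f = (g \<bullet> u i) \<bullet> p i \<bullet> f"
      using comp_assoc[OF assms(4) p u] comp_assoc[OF arr_comp[OF assms(4) p] u assms(5)] by simp
    show "arr ((g \<bullet> u i) \<bullet> p i \<bullet> f) A B" using u p assms(4,5) by blast
  qed (use arrD[OF assms(4)] arrD[OF assms(5)] in auto)
  finally show ?thesis .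
qed

end

context klinear_category
begin

lemma inclusion_projection_sum:
  assumes "\<And>i. i < n \<Longrightarrow> arr (v i) (W i) S" "\<And>i. i < n \<Longrightarrow> arr (h i) A (W i)"
    and "\<And>i j. \<lbrakk>i < n; j < n\<rbrakk> \<Longrightarrow> q i \<bullet> v j = (if i = j then Id C (W i) else \<zero>\<^bsub>Hm (W j) (W i)\<^esub>)"
    and "k < (n::nat)" "arr (q k) S (W k)"
  shows "q k \<bullet> (\<Oplus>\<^bsub>Hm A S\<^esub>j\<in>{..<n}. v j \<bullet> h j) = h k"
proof -
  have ob: "A \<in> Obj C" "\<And>i. i < n \<Longrightarrow> W i \<in> Obj C" "S \<in> Obj C"
    using assms(2,4,5) arrD by blast+
  have eq: "q k \<bullet> (v j \<bullet> h j) = (if j = k then h k else \<zero>\<^bsub>Hm A (W k)\<^esub>)" if j: "j < n" for j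
  proof -
    have "q k \<bullet> (v j \<bullet> h j) = (q k \<bullet> v j) \<bullet> h j"
      using comp_assoc[OF assms(2)[OF j] assms(1)[OF j] assms(5)] by simp
    then show ?thesis
      using assms(3)[OF assms(4) j] assms(2)[OF j] ob assms(4) by auto
  qed
  have "q k \<bullet> (\<Oplus>\<^bsub>Hm A S\<^esub>j\<in>{..<n}. v j \<bullet> h j) = (\<Oplus>\<^bsub>Hm A (W k)\<^esub>j\<in>{..<n}. q k \<bullet> (v j \<bullet> h j))"
    by (rule comp_finsum_right) (use assms ob in auto)
  also have "\<dots> = q k \<bullet> (v k \<bullet> h k)"
    by (rule finsum_arr_single) (use assms(2,4) eq in auto)
  finally show ?thesis using eq[OF assms(4)] by simp
qed

text \<open>Inclusions and projections are composed with the given isomorphisms, and the sum is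
  reindexed along \<open>\<sigma>\<close>. Together with \<open>direct_sum_unique\<close> this
  reduces an isomorphism of two objects to a matching of their summands.\<close>

lemma direct_sum_iso_summands:
  assumes X: "direct_sum C Xs X" and \<sigma>: "bij_betw \<sigma> {..<length Ys} {..<length Xs}"
    and iso: "\<And>i. i < length Ys \<Longrightarrow> (Xs ! \<sigma> i, Ys ! i) \<in> iso_rel C"
  shows "direct_sum C Ys X"
proof -
  let ?n = "length Ys"
  obtain u p where up: "X \<in> Obj C" "\<And>i. i < length Xs \<Longrightarrow> Xs ! i \<in> Obj C"
    "\<And>i. i < length Xs \<Longrightarrow> arr (u i) (Xs ! i) X" "\<And>i. i < length Xs \<Longrightarrow> arr (p i) X (Xs ! i)"
    "\<And>i. i < length Xs \<Longrightarrow> p i \<bullet> u i = Id C (Xs ! i)"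
    "\<And>i j. \<lbrakk>i < length Xs; j < length Xs; i \<noteq> j\<rbrakk> \<Longrightarrow> p i \<bullet> u j = \<zero>\<^bsub>Hm (Xs ! j) (Xs ! i)\<^esub>"
    "(\<Oplus>\<^bsub>Hm X X\<^esub>i\<in>{..<length Xs}. u i \<bullet> p i) = Id C X"
    using direct_sumE[OF X] by blast
  have \<sigma>': "\<sigma> i < length Xs" if "i < ?n" for i using \<sigma> that by (auto simp: bij_betw_def)
  have "\<forall>i. \<exists>a b. i < ?n \<longrightarrow> arr a (Xs ! \<sigma> i) (Ys ! i) \<and> arr b (Ys ! i) (Xs ! \<sigma> i) \<and>
      b \<bullet> a = Id C (Xs ! \<sigma> i) \<and> a \<bullet> b = Id C (Ys ! i)"
    using iso by (metis iso_relE)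
  then obtain a b where ab: "\<And>i. i < ?n \<Longrightarrow> arr (a i) (Xs ! \<sigma> i) (Ys ! i)"
    "\<And>i. i < ?n \<Longrightarrow> arr (b i) (Ys ! i) (Xs ! \<sigma> i)"
    "\<And>i. i < ?n \<Longrightarrow> b i \<bullet> a i = Id C (Xs ! \<sigma> i)" "\<And>i. i < ?n \<Longrightarrow> a i \<bullet> b i = Id C (Ys ! i)"
    by metis
  have u: "arr (u (\<sigma> i)) (Xs ! \<sigma> i) X" and p: "arr (p (\<sigma> i)) X (Xs ! \<sigma> i)" if "i < ?n" for i
    using up(3,4) \<sigma>' that by auto
  show ?thesis
  proof (rule direct_sumI[of X Ys "\<lambda>i. u (\<sigma> i) \<bullet> b i" "\<lambda>i. a i \<bullet> p (\<sigma> i)"])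
    show "X \<in> Obj C" by fact
    fix i assume i: "i < ?n"
    show "arr (u (\<sigma> i) \<bullet> b i) (Ys ! i) X" "arr (a i \<bullet> p (\<sigma> i)) X (Ys ! i)"
      using u[OF i] p[OF i] ab(1,2)[OF i] by auto
    show "(a i \<bullet> p (\<sigma> i)) \<bullet> u (\<sigma> i) \<bullet> b i = Id C (Ys ! i)"
      using comp_cancel_mid[OF ab(2)[OF i] u[OF i] p[OF i] ab(1)[OF i]] up(5)[OF \<sigma>'[OF i]] ab(4)[OF i] by simp
    fix j assume j: "j < ?n" "i \<noteq> j"
    then have "\<sigma> i \<noteq> \<sigma> j" using \<sigma> i by (auto simp: bij_betw_def inj_on_def)
    then have z: "p (\<sigma> i) \<bullet> u (\<sigma> j) = \<zero>\<^bsub>Hm (Xs ! \<sigma> j) (Xs ! \<sigma> i)\<^esub>"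
      using up(6) \<sigma>' i j by blast
    have "(a i \<bullet> p (\<sigma> i)) \<bullet> u (\<sigma> j) \<bullet> b j = a i \<bullet> (p (\<sigma> i) \<bullet> u (\<sigma> j)) \<bullet> b j"
      using comp_assoc[OF _ p[OF i] ab(1)[OF i]] comp_assoc[OF ab(2)[OF j(1)] u[OF j(1)] p[OF i]]
        arr_comp[OF ab(2)[OF j(1)] u[OF j(1)]] by simp
    also have "\<dots> = \<zero>\<^bsub>Hm (Ys ! j) (Ys ! i)\<^esub>"
      unfolding z using ab(1)[OF i] ab(2)[OF j(1)] comp_zero_left[OF ab(2)[OF j(1)], of "Xs ! \<sigma> i"]
        comp_zero_right[OF ab(1)[OF i], of "Ys ! j"] arrD[OF ab(1)[OF i]] arrD[OF ab(2)[OF j(1)]] by simp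
    finally show "(a i \<bullet> p (\<sigma> i)) \<bullet> u (\<sigma> j) \<bullet> b j = \<zero>\<^bsub>Hm (Ys ! j) (Ys ! i)\<^esub>" .
  next
    interpret abelian_group "Hm X X" using up(1) hom_group by blast
    have "(\<Oplus>\<^bsub>Hm X X\<^esub>i\<in>{..<?n}. (u (\<sigma> i) \<bullet> b i) \<bullet> a i \<bullet> p (\<sigma> i))
        = (\<Oplus>\<^bsub>Hm X X\<^esub>i\<in>{..<?n}. u (\<sigma> i) \<bullet> p (\<sigma> i))"
      by (rule finsum_arr_cong)
        (use u p ab comp_cancel_mid[OF p ab(1,2) u] up(1) in auto)
    also have "\<dots> = (\<Oplus>\<^bsub>Hm X X\<^esub>i\<in>\<sigma> ` {..<?n}. u i \<bullet> p i)"
      by (rule finsum_reindex[symmetric])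
        (use \<sigma> arr_comp[OF up(4,3)] in \<open>auto simp: bij_betw_def arr_def\<close>)
    finally show "(\<Oplus>\<^bsub>Hm X X\<^esub>i\<in>{..<?n}. (u (\<sigma> i) \<bullet> b i) \<bullet> a i \<bullet> p (\<sigma> i)) = Id C X"
      using up(7) \<sigma> by (simp add: bij_betw_def)
  qed
qed

text \<open>\<open>f\<close> and \<open>g\<close> are assembled from identity components, so they
  exchange the two systems of projections, and each composite collapses to the sum that represents
  an identity.\<close>

lemma direct_sum_unique:
  assumes X: "direct_sum C Xs X" and Y: "direct_sum C Xs Y"
  shows "(X, Y) \<in> iso_rel C"
proof -
  let ?n = "length Xs"
  obtain u p where up: "X \<in> Obj C" "\<And>i. i < ?n \<Longrightarrow> Xs ! i \<in> Obj C"
    "\<And>i. i < ?n \<Longrightarrow> arr (u i) (Xs ! i) X" "\<And>i. i < ?n \<Longrightarrow> arr (p i) X (Xs ! i)"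
    "\<And>i. i < ?n \<Longrightarrow> p i \<bullet> u i = Id C (Xs ! i)"
    "\<And>i j. \<lbrakk>i < ?n; j < ?n; i \<noteq> j\<rbrakk> \<Longrightarrow> p i \<bullet> u j = \<zero>\<^bsub>Hm (Xs ! j) (Xs ! i)\<^esub>"
    "(\<Oplus>\<^bsub>Hm X X\<^esub>i\<in>{..<?n}. u i \<bullet> p i) = Id C X"
    using direct_sumE[OF X] by blast
  obtain v q where vq: "Y \<in> Obj C" "\<And>i. i < ?n \<Longrightarrow> Xs ! i \<in> Obj C"
    "\<And>i. i < ?n \<Longrightarrow> arr (v i) (Xs ! i) Y" "\<And>i. i < ?n \<Longrightarrow> arr (q i) Y (Xs ! i)"
    "\<And>i. i < ?n \<Longrightarrow> q i \<bullet> v i = Id C (Xs ! i)"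
    "\<And>i j. \<lbrakk>i < ?n; j < ?n; i \<noteq> j\<rbrakk> \<Longrightarrow> q i \<bullet> v j = \<zero>\<^bsub>Hm (Xs ! j) (Xs ! i)\<^esub>"
    "(\<Oplus>\<^bsub>Hm Y Y\<^esub>i\<in>{..<?n}. v i \<bullet> q i) = Id C Y"
    using direct_sumE[OF Y] by blast
  define f where "f = (\<Oplus>\<^bsub>Hm X Y\<^esub>i\<in>{..<?n}. v i \<bullet> p i)"
  define g where "g = (\<Oplus>\<^bsub>Hm Y X\<^esub>i\<in>{..<?n}. u i \<bullet> q i)"
  have f: "arr f X Y" unfolding f_def using up(1) vq(1) arr_comp[OF up(4) vq(3)] by (intro arr_finsum) auto
  have g: "arr g Y X" unfolding g_def using up(1) vq(1) arr_comp[OF vq(4) up(3)] by (intro arr_finsum) auto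
  have qf: "q i \<bullet> f = p i" if "i < ?n" for i
    unfolding f_def by (rule inclusion_projection_sum[where W = "\<lambda>i. Xs ! i"]) (use up vq that in auto)
  have pg: "p i \<bullet> g = q i" if "i < ?n" for i
    unfolding g_def by (rule inclusion_projection_sum[where W = "\<lambda>i. Xs ! i"]) (use up vq that in auto)
  have "g \<bullet> f = (\<Oplus>\<^bsub>Hm X X\<^esub>i\<in>{..<?n}. (u i \<bullet> q i) \<bullet> f)"
    unfolding g_def using f up(1) arr_comp[OF vq(4) up(3)] by (intro comp_finsum_left) auto
  also have "\<dots> = (\<Oplus>\<^bsub>Hm X X\<^esub>i\<in>{..<?n}. u i \<bullet> p i)"
    by (rule finsum_arr_cong) (use up in \<open>auto simp: comp_assoc[OF f vq(4) up(3)] qf\<close>)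
  finally have gf: "g \<bullet> f = Id C X" using up by simp
  have "f \<bullet> g = (\<Oplus>\<^bsub>Hm Y Y\<^esub>i\<in>{..<?n}. (v i \<bullet> p i) \<bullet> g)"
    unfolding f_def using g vq(1) arr_comp[OF up(4) vq(3)] by (intro comp_finsum_left) auto
  also have "\<dots> = (\<Oplus>\<^bsub>Hm Y Y\<^esub>i\<in>{..<?n}. v i \<bullet> q i)"
    by (rule finsum_arr_cong) (use vq in \<open>auto simp: comp_assoc[OF g up(4) vq(3)] pg\<close>)
  finally have "f \<bullet> g = Id C Y" using vq by simp
  then show ?thesis using iso_relI f g gf by blast
qed

lemma direct_sum_pairI:
  assumes "arr u A X" "arr p X A" "arr v B X" "arr q X B"
    "p \<bullet> u = Id C A" "q \<bullet> v = Id C B" "p \<bullet> v = \<zero>\<^bsub>Hm B A\<^esub>" "q \<bullet> u = \<zero>\<^bsub>Hm A B\<^esub>"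
    "u \<bullet> p \<oplus>\<^bsub>Hm X X\<^esub> v \<bullet> q = Id C X"
  shows "direct_sum C [A, B] X"
proof -
  interpret abelian_group "Hm X X" using arrD(2)[OF assms(1)] hom_group by blast
  have mor: "u \<bullet> p \<in> Mor C X X" "v \<bullet> q \<in> Mor C X X"
    using arrD(3)[OF arr_comp[OF assms(2,1)]] arrD(3)[OF arr_comp[OF assms(4,3)]] by auto
  show ?thesis
    by (rule direct_sumI[of _ _ "\<lambda>i. if i = 0 then u else v" "\<lambda>i. if i = 0 then p else q"])
      (use assms mor arrD(2)[OF assms(1)] in \<open>auto simp: less_Suc_eq lessThan_Suc a_comm\<close>)
qed

lemma direct_sum_zero_right:
  assumes "X \<in> Obj C" "zero_object C Z"
  shows "direct_sum C [X, Z] X"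
proof -
  have Z: "Z \<in> Obj C" "Id C Z = \<zero>\<^bsub>Hm Z Z\<^esub>" using zero_objectD[OF assms(2)] by blast+
  have "Id C X \<bullet> Id C X \<oplus>\<^bsub>Hm X X\<^esub> \<zero>\<^bsub>Hm Z X\<^esub> \<bullet> \<zero>\<^bsub>Hm X Z\<^esub> = Id C X"
    using assms(1) Z(1) comp_zero_left[OF arr_zero[OF assms(1) Z(1)] assms(1)] add_zero_right[OF arr_id[OF assms(1)]]
    by simp
  then show ?thesis
    using assms(1) Z comp_zero_left[OF arr_zero[OF Z(1) assms(1)] Z(1)]
      comp_id_left[OF arr_zero[OF Z(1) assms(1)]] comp_id_right[OF arr_zero[OF assms(1) Z(1)]]
    by (intro direct_sum_pairI[of "Id C X" X X "Id C X" "\<zero>\<^bsub>Hm Z X\<^esub>" Z "\<zero>\<^bsub>Hm X Z\<^esub>"]) auto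
qed

lemma direct_summand_retract: "direct_summand C Y X \<Longrightarrow> retract Y X"
  unfolding direct_summand_def retract_def
  by (elim exE direct_sumE) (metis length_greater_0_conv list.discI nth_Cons_0)

lemma direct_sum_retract: "direct_sum C Xs X \<Longrightarrow> i < length Xs \<Longrightarrow> retract (Xs ! i) X"
  unfolding retract_def by (elim direct_sumE) blast

text \<open>The identity of an object of add M becomes a finite sum of endomorphisms X -> M -> X;
  tests for the vanishing of a morphism at \<open>X\<close> reduce through it to morphisms at
  \<open>M\<close>.\<close>

lemma Add_identity:
  assumes "X \<in> Add C M"
  obtains n u p where "\<And>k. k < n \<Longrightarrow> arr (u k) X M" "\<And>k. k < n \<Longrightarrow> arr (p k) M X"
    "(\<Oplus>\<^bsub>Hm X X\<^esub>k\<in>{..<(n::nat)}. p k \<bullet> u k) = Id C X"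
proof -
  obtain n S where S: "direct_sum C (replicate n M) S" "direct_summand C X S"
    using assms unfolding Add_def by blast
  let ?R = "replicate n M"
  obtain v q where vq': "S \<in> Obj C" "\<And>i. i < length ?R \<Longrightarrow> ?R ! i \<in> Obj C"
    "\<And>i. i < length ?R \<Longrightarrow> arr (v i) (?R ! i) S" "\<And>i. i < length ?R \<Longrightarrow> arr (q i) S (?R ! i)"
    "\<And>i. i < length ?R \<Longrightarrow> q i \<bullet> v i = Id C (?R ! i)"
    "\<And>i j. \<lbrakk>i < length ?R; j < length ?R; i \<noteq> j\<rbrakk> \<Longrightarrow> q i \<bullet> v j = \<zero>\<^bsub>Hm (?R ! j) (?R ! i)\<^esub>"
    "(\<Oplus>\<^bsub>Hm S S\<^esub>i\<in>{..<length ?R}. v i \<bullet> q i) = Id C S"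
    by (rule direct_sumE[OF S(1)]) blast
  have vq: "S \<in> Obj C" "\<And>i. i < n \<Longrightarrow> arr (v i) M S" "\<And>i. i < n \<Longrightarrow> arr (q i) S M"
    "(\<Oplus>\<^bsub>Hm S S\<^esub>i\<in>{..<n}. v i \<bullet> q i) = Id C S"
    using vq'(1,3,4,7) by simp_all
  obtain a b where ab: "arr a X S" "arr b S X" "b \<bullet> a = Id C X"
    using direct_summand_retract[OF S(2)] unfolding retract_def by blast
  have "b \<bullet> a = (\<Oplus>\<^bsub>Hm X X\<^esub>i\<in>{..<length (replicate n M)}. (b \<bullet> v i) \<bullet> (q i \<bullet> a))"
    by (rule direct_sum_comp) (use vq ab in auto)
  then show ?thesis
    by (intro that[of n "\<lambda>i. q i \<bullet> a" "\<lambda>i. b \<bullet> v i"]) (use vq ab in auto)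
qed

lemma Add_obj: "X \<in> Add C M \<Longrightarrow> X \<in> Obj C"
  by (simp add: Add_def)

lemma iso_mor_comp:
  assumes "iso_mor C A B f" "iso_mor C B E g" "A \<in> Obj C" "B \<in> Obj C" "E \<in> Obj C"
  shows "iso_mor C A E (g \<bullet> f)"
proof -
  obtain f' where f: "arr f A B" "arr f' B A" "f' \<bullet> f = Id C A" "f \<bullet> f' = Id C B"
    using assms by (auto simp: iso_mor_iff)
  obtain g' where g: "arr g B E" "arr g' E B" "g' \<bullet> g = Id C B" "g \<bullet> g' = Id C E"
    using assms by (auto simp: iso_mor_iff)
  show ?thesis
    by (rule iso_morI[of _ _ _ "f' \<bullet> g'"])
      (use f g comp_cancel_mid[OF f(1) g(1,2) f(2)] comp_cancel_mid[OF g(2) f(2,1) g(1)] in auto)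
qed

lemma add_complement:
  assumes "arr e A B" "arr i A B"
  shows "e \<oplus>\<^bsub>Hm A B\<^esub> (i \<oplus>\<^bsub>Hm A B\<^esub> \<ominus>\<^bsub>Hm A B\<^esub> e) = i"
  using add_commute[OF assms(2) arr_neg[OF assms(1)]] add_assoc[OF assms(1) arr_neg[OF assms(1)] assms(2)]
    add_neg[OF assms(1)] add_zero_left[OF assms(2)] by simp

section \<open>Objects with local endomorphism ring\<close>

lemma local_zero_not_iso:
  assumes "local_endomorphisms C X" "X \<in> Obj C"
  shows "\<not> iso_mor C X X \<zero>\<^bsub>Hm X X\<^esub>"
  using assms unfolding local_endomorphisms_def by (auto simp: iso_mor_iff)

lemma local_add:
  assumes "local_endomorphisms C X" "arr f X X" "arr g X X" "iso_mor C X X (f \<oplus>\<^bsub>Hm X X\<^esub> g)"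
  shows "iso_mor C X X f \<or> iso_mor C X X g"
  using assms unfolding local_endomorphisms_def arr_def by blast

text \<open>Non-units are closed under addition. The empty sum causes no exception, since zero is
  not invertible when \<open>Id C X\<close> is nonzero.\<close>

lemma local_finsum:
  assumes "local_endomorphisms C X" "X \<in> Obj C" "finite I" "\<And>i. i \<in> I \<Longrightarrow> arr (f i) X X"
    "iso_mor C X X (\<Oplus>\<^bsub>Hm X X\<^esub>i\<in>I. f i)"
  shows "\<exists>i\<in>I. iso_mor C X X (f i)"
  using assms(3-)
proof (induct I rule: finite_induct)
  case empty
  interpret abelian_group "Hm X X" using assms(2) hom_group by blast
  show ?case using empty local_zero_not_iso assms(1,2) by auto
next
  case (insert i I)
  interpret abelian_group "Hm X X" using assms(2) hom_group by blast
  have "(\<Oplus>\<^bsub>Hm X X\<^esub>i\<in>insert i I. f i) = f i \<oplus>\<^bsub>Hm X X\<^esub> (\<Oplus>\<^bsub>Hm X X\<^esub>i\<in>I. f i)"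
    by (rule finsum_insert) (use insert in \<open>auto simp: arr_def\<close>)
  moreover have "arr (\<Oplus>\<^bsub>Hm X X\<^esub>i\<in>I. f i) X X" by (rule arr_finsum) (use insert assms in auto)
  ultimately show ?case using local_add[OF assms(1)] insert by (metis insertCI)
qed

lemma iso_mor_Id: "X \<in> Obj C \<Longrightarrow> iso_mor C X X (Id C X)"
  by (rule iso_morI[of _ _ _ "Id C X"]) auto

lemma iso_factor_retract:
  assumes "arr b X W" "arr a W X" "iso_mor C X X (a \<bullet> b)"
  shows "retract X W"
proof -
  obtain c where c: "arr c X X" "c \<bullet> (a \<bullet> b) = Id C X"
    using assms arrD by (auto simp: iso_mor_iff)
  then have "(c \<bullet> a) \<bullet> b = Id C X" using comp_assoc assms by metis
  then show ?thesis using assms c unfolding retract_def by blast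
qed

lemma local_retract_of_sum:
  assumes "local_endomorphisms C X" "X \<in> Obj C" "finite I"
    "\<And>i. i \<in> I \<Longrightarrow> arr (b i) X (W i)" "\<And>i. i \<in> I \<Longrightarrow> arr (a i) (W i) X"
    "(\<Oplus>\<^bsub>Hm X X\<^esub>i\<in>I. a i \<bullet> b i) = Id C X"
  shows "\<exists>i\<in>I. retract X (W i)"
proof -
  have "\<exists>i\<in>I. iso_mor C X X (a i \<bullet> b i)"
    by (rule local_finsum) (use assms iso_mor_Id in auto)
  then show ?thesis using iso_factor_retract assms by blast
qed

text \<open>The equation \<open>b \<bullet> a = Id C X\<close> decomposes over the summands of
  \<open>S\<close>. By locality one term X -> Zs ! i -> X is invertible, and composing with its
  inverse gives a splitting.\<close>

lemma local_retract_direct_sum: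
  assumes "local_endomorphisms C X" "direct_sum C Zs S" "retract X S"
  shows "\<exists>i<length Zs. retract X (Zs ! i)"
proof -
  obtain v q where vq: "S \<in> Obj C" "\<And>i. i < length Zs \<Longrightarrow> Zs ! i \<in> Obj C"
    "\<And>i. i < length Zs \<Longrightarrow> arr (v i) (Zs ! i) S" "\<And>i. i < length Zs \<Longrightarrow> arr (q i) S (Zs ! i)"
    "\<And>i. i < length Zs \<Longrightarrow> q i \<bullet> v i = Id C (Zs ! i)"
    "\<And>i j. \<lbrakk>i < length Zs; j < length Zs; i \<noteq> j\<rbrakk> \<Longrightarrow> q i \<bullet> v j = \<zero>\<^bsub>Hm (Zs ! j) (Zs ! i)\<^esub>"
    "(\<Oplus>\<^bsub>Hm S S\<^esub>i\<in>{..<length Zs}. v i \<bullet> q i) = Id C S"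
    by (rule direct_sumE[OF assms(2)]) blast
  obtain a b where ab: "arr a X S" "arr b S X" "b \<bullet> a = Id C X"
    using assms(3) unfolding retract_def by blast
  have "b \<bullet> a = (\<Oplus>\<^bsub>Hm X X\<^esub>i\<in>{..<length Zs}. (b \<bullet> v i) \<bullet> (q i \<bullet> a))"
    by (rule direct_sum_comp) (use vq ab in auto)
  then have "\<exists>i\<in>{..<length Zs}. retract X (Zs ! i)"
    by (intro local_retract_of_sum[where b = "\<lambda>i. q i \<bullet> a" and a = "\<lambda>i. b \<bullet> v i"])
      (use assms vq ab arrD in auto)
  then show ?thesis by auto
qed

text \<open>A local ring has only the idempotents 0 and 1. Either \<open>u \<bullet> p\<close> or
  its complement is invertible; the complement kills \<open>u\<close>, which is nonzero, so
  \<open>u \<bullet> p\<close> is invertible, and an invertible idempotent is the identity.\<close>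

lemma retract_of_local_iso:
  assumes Z: "local_endomorphisms C Z" and X: "retract X Z" "Id C X \<noteq> \<zero>\<^bsub>Hm X X\<^esub>"
  shows "(X, Z) \<in> iso_rel C"
proof -
  obtain u p where up: "arr u X Z" "arr p Z X" "p \<bullet> u = Id C X" using X unfolding retract_def by blast
  have ob: "X \<in> Obj C" "Z \<in> Obj C" using up arrD by blast+
  let ?e = "u \<bullet> p" and ?d = "Id C Z \<oplus>\<^bsub>Hm Z Z\<^esub> \<ominus>\<^bsub>Hm Z Z\<^esub> (u \<bullet> p)"
  have e: "arr ?e Z Z" and d: "arr ?d Z Z" using up ob by blast+
  have "?e \<oplus>\<^bsub>Hm Z Z\<^esub> ?d = Id C Z"
    using add_complement[OF e arr_id[OF ob(2)]] .
  then have "iso_mor C Z Z ?e \<or> iso_mor C Z Z ?d"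
    using local_add[OF Z e d] iso_mor_Id[OF ob(2)] by simp
  moreover have eu: "?e \<bullet> u = u" using comp_assoc[OF up(1,2,1)] up by simp
  moreover have False if iso: "iso_mor C Z Z ?d"
  proof -
    obtain d' where d': "arr d' Z Z" "d' \<bullet> ?d = Id C Z" using iso ob by (auto simp: iso_mor_iff)
    have "?d \<bullet> u = (Id C Z \<bullet> u) \<oplus>\<^bsub>Hm X Z\<^esub> (\<ominus>\<^bsub>Hm Z Z\<^esub> ?e \<bullet> u)"
      by (rule comp_add_left) (use up ob e in auto)
    also have "\<dots> = \<zero>\<^bsub>Hm X Z\<^esub>"
      using comp_neg_left[OF up(1) e] eu up(1) by (simp add: add_neg)
    finally have "?d \<bullet> u = \<zero>\<^bsub>Hm X Z\<^esub>" .
    then have "u = \<zero>\<^bsub>Hm X Z\<^esub>"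
      using comp_assoc[OF up(1) d d'(1)] d' up(1) ob by simp
    then show False using up ob X(2) by auto
  qed
  moreover have "?e = Id C Z" if iso: "iso_mor C Z Z ?e"
  proof -
    obtain e' where e': "arr e' Z Z" "?e \<bullet> e' = Id C Z" using iso ob by (auto simp: iso_mor_iff)
    have "?e \<bullet> ?e = ?e" using comp_assoc[OF up(2,1) e] eu by simp
    then show ?thesis using comp_assoc[OF e'(1) e e] e' e by simp
  qed
  ultimately show ?thesis using iso_relI up by blast
qed

text \<open>Conjugation with the isomorphism is additive and both preserves and reflects
  invertibility of endomorphisms.\<close>

lemma local_iso:
  assumes X: "local_endomorphisms C X" and iso: "(X, Y) \<in> iso_rel C"
  shows "local_endomorphisms C Y"
proof -
  obtain a b where ab: "arr a X Y" "arr b Y X" "b \<bullet> a = Id C X" "a \<bullet> b = Id C Y"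
    using iso by (rule iso_relE)
  have ob: "X \<in> Obj C" "Y \<in> Obj C" using ab arrD by blast+
  have isos: "iso_mor C X Y a" "iso_mor C Y X b" using iso_morI ab by blast+
  have conj_back: "a \<bullet> ((b \<bullet> (f \<bullet> a)) \<bullet> b) = f" if f: "arr f Y Y" for f
  proof -
    have fa: "arr (f \<bullet> a) X Y" using f ab by auto
    have "(b \<bullet> (f \<bullet> a)) \<bullet> b = b \<bullet> f"
      using comp_assoc[OF ab(2) fa ab(2)] comp_assoc[OF ab(2,1) f] ab(4) f by simp
    then show ?thesis using comp_assoc[OF f ab(2,1)] ab(4) f by simp
  qed
  have cnj: "iso_mor C Y Y f \<longleftrightarrow> iso_mor C X X (b \<bullet> (f \<bullet> a))" if f: "arr f Y Y" for f
  proof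
    assume "iso_mor C Y Y f"
    then show "iso_mor C X X (b \<bullet> (f \<bullet> a))" using iso_mor_comp isos ob by blast
  next
    assume "iso_mor C X X (b \<bullet> (f \<bullet> a))"
    then have "iso_mor C Y Y (a \<bullet> ((b \<bullet> (f \<bullet> a)) \<bullet> b))" using iso_mor_comp isos ob by blast
    then show "iso_mor C Y Y f" using conj_back[OF f] by simp
  qed
  have "Id C Y \<noteq> \<zero>\<^bsub>Hm Y Y\<^esub>"
  proof
    assume "Id C Y = \<zero>\<^bsub>Hm Y Y\<^esub>"
    then have "Id C X = \<zero>\<^bsub>Hm X X\<^esub>"
      using comp_id_left[OF ab(1)] comp_zero_left[OF ab(1) ob(2)] comp_zero_right[OF ab(2) ob(1)] ab(3) by simp
    then show False using X by (simp add: local_endomorphisms_def)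
  qed
  moreover have "iso_mor C Y Y f \<or> iso_mor C Y Y g"
    if fg: "arr f Y Y" "arr g Y Y" "iso_mor C Y Y (f \<oplus>\<^bsub>Hm Y Y\<^esub> g)" for f g
  proof -
    have "b \<bullet> ((f \<oplus>\<^bsub>Hm Y Y\<^esub> g) \<bullet> a) = (b \<bullet> (f \<bullet> a)) \<oplus>\<^bsub>Hm X X\<^esub> (b \<bullet> (g \<bullet> a))"
      using comp_add_left[OF ab(1) fg(1,2)] comp_add_right[OF arr_comp[OF ab(1) fg(1)] arr_comp[OF ab(1) fg(2)] ab(2)] by simp
    then show ?thesis
      using cnj[OF arr_add[OF fg(1,2)]] fg(3) cnj[OF fg(1)] cnj[OF fg(2)]
        local_add[OF X arr_comp[OF arr_comp[OF ab(1) fg(1)] ab(2)] arr_comp[OF arr_comp[OF ab(1) fg(2)] ab(2)]] by simp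
  qed
  ultimately show ?thesis
    using ob unfolding local_endomorphisms_def arr_def by blast
qed

text \<open>If both summands were nonzero, neither the idempotent of the first nor its complement
  could be invertible, since they annihilate the inclusions \<open>u 1\<close> and
  \<open>u 0\<close>; but their sum is the identity.\<close>

lemma local_indecomposable:
  assumes X: "local_endomorphisms C X" "X \<in> Obj C"
  shows "indecomposable C X"
  unfolding indecomposable_def
proof (intro conjI allI impI)
  show "X \<in> Obj C" by fact
  show "\<not> zero_object C X" using X zero_objectD(2) by (auto simp: local_endomorphisms_def)
  fix A B assume S: "direct_sum C [A, B] X"
  obtain u p :: "nat \<Rightarrow> 'm" where up: "A \<in> Obj C" "B \<in> Obj C" "arr (u 0) A X" "arr (p 0) X A" "arr (u 1) B X" "arr (p 1) X B"
     "p 0 \<bullet> u 0 = Id C A" "p 1 \<bullet> u 1 = Id C B" "p 0 \<bullet> u 1 = \<zero>\<^bsub>Hm B A\<^esub>"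
  proof -
    obtain u p where *: "X \<in> Obj C" "\<And>i. i < length [A, B] \<Longrightarrow> [A, B] ! i \<in> Obj C"
    "\<And>i. i < length [A, B] \<Longrightarrow> arr (u i) ([A, B] ! i) X" "\<And>i. i < length [A, B] \<Longrightarrow> arr (p i) X ([A, B] ! i)"
    "\<And>i. i < length [A, B] \<Longrightarrow> p i \<bullet> u i = Id C ([A, B] ! i)"
    "\<And>i j. \<lbrakk>i < length [A, B]; j < length [A, B]; i \<noteq> j\<rbrakk> \<Longrightarrow> p i \<bullet> u j = \<zero>\<^bsub>Hm ([A, B] ! j) ([A, B] ! i)\<^esub>"
    "(\<Oplus>\<^bsub>Hm X X\<^esub>i\<in>{..<length [A, B]}. u i \<bullet> p i) = Id C X"
      by (rule direct_sumE[OF S]) blast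
    show ?thesis by (rule that[of u p])
        (use *(2)[of 0] *(2)[of 1] *(3)[of 0] *(3)[of 1] *(4)[of 0] *(4)[of 1]
          *(5)[of 0] *(5)[of 1] *(6)[of 0 1] in auto)
  qed
  show "zero_object C A \<or> zero_object C B"
  proof (rule ccontr)
    assume "\<not> (zero_object C A \<or> zero_object C B)"
    then have nz: "Id C A \<noteq> \<zero>\<^bsub>Hm A A\<^esub>" "Id C B \<noteq> \<zero>\<^bsub>Hm B B\<^esub>" using zero_objectI up by blast+
    have "retract A X" "retract B X" using up unfolding retract_def by blast+
    then have "(A, X) \<in> iso_rel C" "(B, X) \<in> iso_rel C" using retract_of_local_iso X nz by blast+
    then have locA: "local_endomorphisms C A" and BA: "(B, A) \<in> iso_rel C"
      using local_iso[OF X(1)] iso_rel_sym iso_rel_trans by blast+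
    let ?e = "u 0 \<bullet> p 0" and ?d = "Id C X \<oplus>\<^bsub>Hm X X\<^esub> \<ominus>\<^bsub>Hm X X\<^esub> (u 0 \<bullet> p 0)"
    have e: "arr ?e X X" and d: "arr ?d X X" using up X by blast+
    have "?e \<oplus>\<^bsub>Hm X X\<^esub> ?d = Id C X"
      using add_complement[OF e arr_id[OF X(2)]] .
    then have "iso_mor C X X ?e \<or> iso_mor C X X ?d"
      using local_add[OF X(1) e d] iso_mor_Id[OF X(2)] by simp
    moreover have "\<not> iso_mor C X X ?e"
    proof
      assume "iso_mor C X X ?e"
      then obtain e' where e': "arr e' X X" "e' \<bullet> ?e = Id C X" using X by (auto simp: iso_mor_iff)
      have "?e \<bullet> u 1 = \<zero>\<^bsub>Hm B X\<^esub>" using comp_assoc[OF up(5,4,3)] up by simp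
      then have "u 1 = \<zero>\<^bsub>Hm B X\<^esub>" using comp_assoc[OF up(5) e e'(1)] e' up X by simp
      then show False using up nz by auto
    qed
    moreover have "\<not> iso_mor C X X ?d"
    proof
      assume "iso_mor C X X ?d"
      then obtain d' where d': "arr d' X X" "d' \<bullet> ?d = Id C X" using X by (auto simp: iso_mor_iff)
      have eu: "?e \<bullet> u 0 = u 0" using comp_assoc[OF up(3,4,3)] up by simp
      have "?d \<bullet> u 0 = (Id C X \<bullet> u 0) \<oplus>\<^bsub>Hm A X\<^esub> (\<ominus>\<^bsub>Hm X X\<^esub> ?e \<bullet> u 0)"
        by (rule comp_add_left) (use up X e in auto)
      also have "\<dots> = \<zero>\<^bsub>Hm A X\<^esub>"
        using comp_neg_left[OF up(3) e] eu up(3) by (simp add: add_neg)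
      finally have "u 0 = \<zero>\<^bsub>Hm A X\<^esub>" using comp_assoc[OF up(3) d d'(1)] d' up X by simp
      then show False using up nz by auto
    qed
    ultimately show False by blast
  qed
qed

end

section \<open>Complements of summands and the number of indecomposable summands\<close>

context klinear_additive_category
begin

lemma zero_object_exists: "\<exists>Z. zero_object C Z"
  using direct_sum_exists[of "[]"] by (simp add: direct_sum_Nil)

lemma direct_sum_split_off:
  assumes X: "direct_sum C Xs X" and k: "k < length Xs"
  shows "\<exists>Z. direct_sum C [Xs ! k, Z] X"
proof -
  obtain N where N: "zero_object C N" using zero_object_exists by blast
  \<comment> \<open>Replacing the \<open>k\<close>-th summand by zero, instead of deleting it, keeps the indices aligned.\<close>
  let ?Ys = "Xs[k := N]" and ?n = "length Xs"
  have "set ?Ys \<subseteq> Obj C"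
    using direct_sum_obj[OF X] zero_objectD(1)[OF N] set_update_subset_insert[of Xs k N] by blast
  then obtain Z where Z: "direct_sum C ?Ys Z" using direct_sum_exists by blast
  obtain u p where up: "X \<in> Obj C" "\<And>i. i < ?n \<Longrightarrow> Xs ! i \<in> Obj C"
    "\<And>i. i < ?n \<Longrightarrow> arr (u i) (Xs ! i) X" "\<And>i. i < ?n \<Longrightarrow> arr (p i) X (Xs ! i)"
    "\<And>i. i < ?n \<Longrightarrow> p i \<bullet> u i = Id C (Xs ! i)"
    "\<And>i j. \<lbrakk>i < ?n; j < ?n; i \<noteq> j\<rbrakk> \<Longrightarrow> p i \<bullet> u j = \<zero>\<^bsub>Hm (Xs ! j) (Xs ! i)\<^esub>"
    "(\<Oplus>\<^bsub>Hm X X\<^esub>i\<in>{..<?n}. u i \<bullet> p i) = Id C X"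
    using direct_sumE[OF X] by blast
  obtain v q where vq0: "Z \<in> Obj C" "\<And>i. i < ?n \<Longrightarrow> ?Ys ! i \<in> Obj C"
    "\<And>i. i < ?n \<Longrightarrow> arr (v i) (?Ys ! i) Z" "\<And>i. i < ?n \<Longrightarrow> arr (q i) Z (?Ys ! i)"
    "\<And>i. i < ?n \<Longrightarrow> q i \<bullet> v i = Id C (?Ys ! i)"
    "\<And>i j. \<lbrakk>i < ?n; j < ?n; i \<noteq> j\<rbrakk> \<Longrightarrow> q i \<bullet> v j = \<zero>\<^bsub>Hm (?Ys ! j) (?Ys ! i)\<^esub>"
    "(\<Oplus>\<^bsub>Hm Z Z\<^esub>i\<in>{..<?n}. v i \<bullet> q i) = Id C Z"
    by (rule direct_sumE[OF Z, unfolded length_list_update]) blast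
  note vq = vq0(1,3-)
  let ?J = "{..<?n} - {k}"
  have v: "arr (v i) (Xs ! i) Z" and q: "arr (q i) Z (Xs ! i)" and qv: "q i \<bullet> v i = Id C (Xs ! i)"
    if "i < ?n" "i \<noteq> k" for i
    using vq(2-4)[OF that(1)] that by auto
  have qv0: "q i \<bullet> v j = \<zero>\<^bsub>Hm (Xs ! j) (Xs ! i)\<^esub>" if "i < ?n" "i \<noteq> k" "j < ?n" "j \<noteq> k" "i \<noteq> j" for i j
    using vq(5)[of i j] that by auto
  have u: "arr (u i) (Xs ! i) X" and p: "arr (p i) X (Xs ! i)" if "i < ?n" "i \<noteq> k" for i
    using up that by auto
  define w where "w = (\<Oplus>\<^bsub>Hm Z X\<^esub>i\<in>?J. u i \<bullet> q i)"
  define r where "r = (\<Oplus>\<^bsub>Hm X Z\<^esub>i\<in>?J. v i \<bullet> p i)"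
  have w: "arr w Z X" unfolding w_def using up(1) vq(1) arr_comp[OF q u] by (intro arr_finsum) auto
  have r: "arr r X Z" unfolding r_def using up(1) vq(1) arr_comp[OF p v] by (intro arr_finsum) auto
  have qr: "q i \<bullet> r = p i" if i: "i < ?n" "i \<noteq> k" for i
  proof -
    have "q i \<bullet> r = (\<Oplus>\<^bsub>Hm X (Xs ! i)\<^esub>j\<in>?J. q i \<bullet> (v j \<bullet> p j))"
      unfolding r_def using q[OF i] up(1) arr_comp[OF p v] by (intro comp_finsum_right) auto
    also have "\<dots> = q i \<bullet> (v i \<bullet> p i)"
    proof (rule finsum_arr_single)
      fix j assume j: "j \<in> ?J" "j \<noteq> i"
      then have "q i \<bullet> (v j \<bullet> p j) = (q i \<bullet> v j) \<bullet> p j"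
        using comp_assoc[OF p v q[OF i]] by auto
      then show "q i \<bullet> (v j \<bullet> p j) = \<zero>\<^bsub>Hm X (Xs ! i)\<^esub>" using qv0[OF i, of j] j p[of j] up(2)[OF i(1)] by auto
    qed (use i arr_comp[OF arr_comp[OF p[OF i] v[OF i]] q[OF i]] in auto)
    also have "\<dots> = p i" using comp_assoc[OF p[OF i] v[OF i] q[OF i]] qv[OF i] p[OF i] by simp
    finally show ?thesis .
  qed
  have pw: "p i \<bullet> w = q i" if i: "i < ?n" "i \<noteq> k" for i
  proof -
    have "p i \<bullet> w = (\<Oplus>\<^bsub>Hm Z (Xs ! i)\<^esub>j\<in>?J. p i \<bullet> (u j \<bullet> q j))"
      unfolding w_def using p[OF i] vq(1) arr_comp[OF q u] by (intro comp_finsum_right) auto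
    also have "\<dots> = p i \<bullet> (u i \<bullet> q i)"
    proof (rule finsum_arr_single)
      fix j assume j: "j \<in> ?J" "j \<noteq> i"
      then have "p i \<bullet> (u j \<bullet> q j) = (p i \<bullet> u j) \<bullet> q j"
        using comp_assoc[OF q u p[OF i]] by auto
      then show "p i \<bullet> (u j \<bullet> q j) = \<zero>\<^bsub>Hm Z (Xs ! i)\<^esub>" using up(6)[OF i(1), of j] j q[of j] up(2)[OF i(1)] by auto
    qed (use i arr_comp[OF arr_comp[OF q[OF i] u[OF i]] p[OF i]] in auto)
    also have "\<dots> = q i" using comp_assoc[OF q[OF i] u[OF i] p[OF i]] up(5)[OF i(1)] q[OF i] by simp
    finally show ?thesis .
  qed
  have wr: "w \<bullet> r = (\<Oplus>\<^bsub>Hm X X\<^esub>i\<in>?J. u i \<bullet> p i)"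
  proof -
    have "w \<bullet> r = (\<Oplus>\<^bsub>Hm X X\<^esub>i\<in>?J. (u i \<bullet> q i) \<bullet> r)"
      unfolding w_def using r up(1) arr_comp[OF q u] by (intro comp_finsum_left) auto
    also have "\<dots> = (\<Oplus>\<^bsub>Hm X X\<^esub>i\<in>?J. u i \<bullet> p i)"
      by (rule finsum_arr_cong) (use up u p in \<open>auto simp: comp_assoc[OF r q u] qr\<close>)
    finally show ?thesis .
  qed
  have rw: "r \<bullet> w = Id C Z"
  proof -
    have "r \<bullet> w = (\<Oplus>\<^bsub>Hm Z Z\<^esub>i\<in>?J. (v i \<bullet> p i) \<bullet> w)"
      unfolding r_def using w vq(1) arr_comp[OF p v] by (intro comp_finsum_left) auto
    also have eq: "\<dots> = (\<Oplus>\<^bsub>Hm Z Z\<^esub>i\<in>?J. v i \<bullet> q i)"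
      by (rule finsum_arr_cong) (use vq v q in \<open>auto simp: comp_assoc[OF w p v] pw\<close>)
    also have "\<dots> = (v k \<bullet> q k) \<oplus>\<^bsub>Hm Z Z\<^esub> (\<Oplus>\<^bsub>Hm Z Z\<^esub>i\<in>?J. v i \<bullet> q i)"
    proof -
      have qk: "arr (q k) Z N" and vk: "arr (v k) N Z" using vq(2,3)[OF k] k by auto
      have "arr (\<Oplus>\<^bsub>Hm Z Z\<^esub>i\<in>?J. v i \<bullet> q i) Z Z" by (rule arr_finsum) (use vq v q in auto)
      moreover have "v k \<bullet> q k = \<zero>\<^bsub>Hm Z Z\<^esub>" using zero_objectD(3)[OF N qk] vk vq(1) by simp
      ultimately show ?thesis by (simp add: add_zero_left)
    qed
    also have "\<dots> = (\<Oplus>\<^bsub>Hm Z Z\<^esub>i\<in>{..<?n}. v i \<bullet> q i)"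
      by (rule finsum_arr_remove[symmetric]) (use k vq in auto)
    finally show ?thesis using vq by simp
  qed
  have pkw: "p k \<bullet> w = \<zero>\<^bsub>Hm Z (Xs ! k)\<^esub>"
  proof -
    have "p k \<bullet> w = (\<Oplus>\<^bsub>Hm Z (Xs ! k)\<^esub>j\<in>?J. p k \<bullet> (u j \<bullet> q j))"
      unfolding w_def using up(4)[OF k] vq(1) arr_comp[OF q u] by (intro comp_finsum_right) auto
    also have "\<dots> = \<zero>\<^bsub>Hm Z (Xs ! k)\<^esub>"
    proof (rule finsum_arr_zero)
      fix j assume j: "j \<in> ?J"
      then have "p k \<bullet> (u j \<bullet> q j) = (p k \<bullet> u j) \<bullet> q j"
        using comp_assoc[OF q u up(4)[OF k]] by auto
      then show "p k \<bullet> (u j \<bullet> q j) = \<zero>\<^bsub>Hm Z (Xs ! k)\<^esub>" using up(6)[OF k, of j] j q[of j] up(2)[OF k] by auto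
    qed (use up k vq in auto)
    finally show ?thesis .
  qed
  have ruk: "r \<bullet> u k = \<zero>\<^bsub>Hm (Xs ! k) Z\<^esub>"
  proof -
    have "r \<bullet> u k = (\<Oplus>\<^bsub>Hm (Xs ! k) Z\<^esub>j\<in>?J. (v j \<bullet> p j) \<bullet> u k)"
      unfolding r_def using up(3)[OF k] vq(1) arr_comp[OF p v] by (intro comp_finsum_left) auto
    also have "\<dots> = \<zero>\<^bsub>Hm (Xs ! k) Z\<^esub>"
    proof (rule finsum_arr_zero)
      fix j assume j: "j \<in> ?J"
      then have "(v j \<bullet> p j) \<bullet> u k = v j \<bullet> (p j \<bullet> u k)"
        using comp_assoc[OF up(3)[OF k] p v] by auto
      then show "(v j \<bullet> p j) \<bullet> u k = \<zero>\<^bsub>Hm (Xs ! k) Z\<^esub>" using up(6)[of j k] k j v[of j] up(2)[OF k] by auto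
    qed (use up k vq in auto)
    finally show ?thesis .
  qed
  have sum: "(u k \<bullet> p k) \<oplus>\<^bsub>Hm X X\<^esub> (w \<bullet> r) = Id C X"
    unfolding wr using finsum_arr_remove[of "{..<?n}" k "\<lambda>i. u i \<bullet> p i" X X] up(7) arr_comp[OF up(4,3)] k by auto
  have "direct_sum C [Xs ! k, Z] X"
    by (rule direct_sum_pairI[OF up(3)[OF k] up(4)[OF k] w r up(5)[OF k] rw pkw ruk sum])
  then show ?thesis by blast
qed

end

locale krull_schmidt_category = klinear_additive_category +
  assumes krull_schmidt: "krull_schmidt C"
begin

lemma local_decomposition:
  assumes "X \<in> Obj C"
  obtains Xs where "direct_sum C Xs X" "\<And>Y. Y \<in> set Xs \<Longrightarrow> local_endomorphisms C Y"
  using krull_schmidt assms unfolding krull_schmidt_def by blast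

text \<open>A summand with local endomorphism ring is nonzero, so indecomposability makes its
  complement zero and identifies \<open>X\<close> with it.\<close>

lemma indecomposable_local:
  assumes "indecomposable C X"
  shows "local_endomorphisms C X"
proof -
  have X: "X \<in> Obj C" "\<not> zero_object C X" using assms by (auto simp: indecomposable_def)
  obtain Xs where Xs: "direct_sum C Xs X" "\<And>Y. Y \<in> set Xs \<Longrightarrow> local_endomorphisms C Y"
    using local_decomposition[OF X(1)] by blast
  then have "Xs \<noteq> []" using X direct_sum_Nil by auto
  then have 0: "0 < length Xs" by simp
  then obtain Z where Z: "direct_sum C [Xs ! 0, Z] X" using direct_sum_split_off[OF Xs(1)] by blast
  have loc: "local_endomorphisms C (Xs ! 0)" using Xs(2) 0 by (meson nth_mem)
  then have "\<not> zero_object C (Xs ! 0)" using zero_objectD(2) by (auto simp: local_endomorphisms_def)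
  then have "zero_object C Z" using assms Z unfolding indecomposable_def by blast
  moreover have X0: "Xs ! 0 \<in> Obj C" using direct_sum_obj[OF Xs(1)] 0 by (meson nth_mem subsetD)
  ultimately have "direct_sum C [Xs ! 0, Z] (Xs ! 0)"
    by (intro direct_sum_zero_right)
  then have "(Xs ! 0, X) \<in> iso_rel C" using direct_sum_unique Z by blast
  then show ?thesis using local_iso loc by blast
qed

text \<open>An indecomposable summand has a local endomorphism ring, hence is a retract of one
  listed summand and isomorphic to it. Repetitions in \<open>Xs\<close> disappear on passing to
  classes.\<close>

lemma num_summands_eq:
  assumes Xs: "direct_sum C Xs X" "\<And>Y. Y \<in> set Xs \<Longrightarrow> local_endomorphisms C Y"
  shows "num_summands C X = card ((\<lambda>Y. iso_rel C `` {Y}) ` set Xs)"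
proof -
  have "{Y \<in> Obj C. indecomposable C Y \<and> direct_summand C Y X} // iso_rel C = (\<lambda>Y. iso_rel C `` {Y}) ` set Xs"
  proof (rule Set.set_eqI, rule iffI)
    fix c assume "c \<in> {Y \<in> Obj C. indecomposable C Y \<and> direct_summand C Y X} // iso_rel C"
    then obtain Y where Y: "Y \<in> Obj C" "indecomposable C Y" "direct_summand C Y X" "c = iso_rel C `` {Y}"
      by (auto simp: quotient_def)
    have loc: "local_endomorphisms C Y" using indecomposable_local Y by blast
    then obtain i where i: "i < length Xs" "retract Y (Xs ! i)"
      using local_retract_direct_sum[OF _ Xs(1)] direct_summand_retract Y by blast
    then have "(Y, Xs ! i) \<in> iso_rel C"
      using retract_of_local_iso[of "Xs ! i" Y] Xs(2) loc by (auto simp: local_endomorphisms_def)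
    then have "c = iso_rel C `` {Xs ! i}" using Y(4) equiv_class_eq[OF equiv_iso_rel] by blast
    then show "c \<in> (\<lambda>Y. iso_rel C `` {Y}) ` set Xs" using i by auto
  next
    fix c assume "c \<in> (\<lambda>Y. iso_rel C `` {Y}) ` set Xs"
    then obtain i where i: "i < length Xs" "c = iso_rel C `` {Xs ! i}" by (auto simp: in_set_conv_nth)
    have ob: "Xs ! i \<in> Obj C" using direct_sum_obj[OF Xs(1)] i by (meson nth_mem subsetD)
    have "indecomposable C (Xs ! i)" using local_indecomposable Xs(2) i ob by auto
    moreover have "direct_summand C (Xs ! i) X"
      using direct_sum_split_off[OF Xs(1) i(1)] by (auto simp: direct_summand_def)
    ultimately show "c \<in> {Y \<in> Obj C. indecomposable C Y \<and> direct_summand C Y X} // iso_rel C"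
      using i ob by (auto simp: quotient_def)
  qed
  then show ?thesis by (simp add: num_summands_def)
qed

end

context klinear_category
begin

text \<open>Dual to \<open>inclusion_projection_sum\<close>. The summands form a function
  \<open>W\<close>, so that the constant family of copies of \<open>T\<close> can be used without
  mentioning a replicated list.\<close>

lemma sum_inclusion_projection:
  assumes "\<And>i. i < n \<Longrightarrow> arr (q i) S (W i)" "\<And>i. i < n \<Longrightarrow> arr (h i) (W i) A"
    and "\<And>i j. \<lbrakk>i < n; j < n\<rbrakk> \<Longrightarrow> q i \<bullet> v j = (if i = j then Id C (W i) else \<zero>\<^bsub>Hm (W j) (W i)\<^esub>)"
    and "k < (n::nat)" "arr (v k) (W k) S"
  shows "(\<Oplus>\<^bsub>Hm S A\<^esub>j\<in>{..<n}. h j \<bullet> q j) \<bullet> v k = h k"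
proof -
  have ob: "A \<in> Obj C" "\<And>i. i < n \<Longrightarrow> W i \<in> Obj C"
    using arrD(2)[OF assms(2)[OF assms(4)]] arrD(1)[OF assms(2)] by blast+
  have eq: "(h j \<bullet> q j) \<bullet> v k = (if j = k then h k else \<zero>\<^bsub>Hm (W k) A\<^esub>)" if j: "j < n" for j
    using comp_assoc[OF assms(5) assms(1)[OF j] assms(2)[OF j]] assms(3)[OF j assms(4)]
      comp_id_right[OF assms(2)[OF j]] comp_zero_right[OF assms(2)[OF j] ob(2)[OF assms(4)]] by auto
  have "(\<Oplus>\<^bsub>Hm S A\<^esub>j\<in>{..<n}. h j \<bullet> q j) \<bullet> v k = (\<Oplus>\<^bsub>Hm (W k) A\<^esub>j\<in>{..<n}. (h j \<bullet> q j) \<bullet> v k)"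
    using assms(5) ob(1) arr_comp[OF assms(1,2)] by (intro comp_finsum_left) auto
  also have "\<dots> = (h k \<bullet> q k) \<bullet> v k"
    using assms(4) eq[OF assms(4)] assms(2)[OF assms(4)] eq
    by (intro finsum_arr_single) auto
  finally show ?thesis using eq[OF assms(4)] by simp
qed

lemma split_epi_cancel:
  assumes "arr e A B" "arr k B A" "e \<bullet> k = Id C B" "arr f B E" "arr g B E" "f \<bullet> e = g \<bullet> e"
  shows "f = g"
proof -
  have "f = (f \<bullet> e) \<bullet> k" using comp_assoc[OF assms(2,1,4)] assms(3,4) by simp
  also have "\<dots> = (g \<bullet> e) \<bullet> k" using assms(6) by simp
  also have "\<dots> = g" using comp_assoc[OF assms(2,1,5)] assms(3,5) by simp
  finally show ?thesis .
qed

lemma split_mono_cancel: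
  assumes "arr e A B" "arr k B A" "k \<bullet> e = Id C A" "arr f E A" "arr g E A" "e \<bullet> f = e \<bullet> g"
  shows "f = g"
proof -
  have "f = k \<bullet> (e \<bullet> f)" using comp_assoc[OF assms(4,1,2)] assms(3,4) by simp
  also have "\<dots> = k \<bullet> (e \<bullet> g)" using assms(6) by simp
  also have "\<dots> = g" using comp_assoc[OF assms(5,1,2)] assms(3,5) by simp
  finally show ?thesis .
qed

lemma neg_inj:
  assumes "arr f A B" "arr g A B" "\<ominus>\<^bsub>Hm A B\<^esub> f = \<ominus>\<^bsub>Hm A B\<^esub> g"
  shows "f = g"
proof -
  have "f = \<ominus>\<^bsub>Hm A B\<^esub> (\<ominus>\<^bsub>Hm A B\<^esub> f)" using neg_neg[OF assms(1)] by simp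
  also have "\<dots> = g" using assms(3) neg_neg[OF assms(2)] by simp
  finally show ?thesis .
qed

lemma direct_summand_refl:
  assumes "X \<in> Obj C" "zero_object C Z" shows "direct_summand C X X"
  using direct_sum_zero_right[OF assms] unfolding direct_summand_def by blast

section \<open>Linear functors\<close>

lemma functor_arr: "klinear_functor K C F F' \<Longrightarrow> arr f A B \<Longrightarrow> arr (F' f) (F A) (F B)"
  unfolding klinear_functor_def arr_def module_hom_def by blast

lemma functor_obj: "klinear_functor K C F F' \<Longrightarrow> A \<in> Obj C \<Longrightarrow> F A \<in> Obj C"
  unfolding klinear_functor_def by blast

lemma functor_id: "klinear_functor K C F F' \<Longrightarrow> A \<in> Obj C \<Longrightarrow> F' (Id C A) = Id C (F A)"
  unfolding klinear_functor_def by blast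

lemma functor_comp: "klinear_functor K C F F' \<Longrightarrow> arr f A B \<Longrightarrow> arr g B E \<Longrightarrow> F' (g \<bullet> f) = F' g \<bullet> F' f"
  unfolding klinear_functor_def arr_def by blast

lemma functor_add: "klinear_functor K C F F' \<Longrightarrow> arr f A B \<Longrightarrow> arr g A B \<Longrightarrow>
    F' (f \<oplus>\<^bsub>Hm A B\<^esub> g) = F' f \<oplus>\<^bsub>Hm (F A) (F B)\<^esub> F' g"
  unfolding klinear_functor_def arr_def module_hom_def by blast

lemma functor_zero:
  assumes "klinear_functor K C F F'" "A \<in> Obj C" "B \<in> Obj C"
  shows "F' \<zero>\<^bsub>Hm A B\<^esub> = \<zero>\<^bsub>Hm (F A) (F B)\<^esub>"
proof -
  let ?z = "\<zero>\<^bsub>Hm A B\<^esub>"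
  have z: "arr ?z A B" using assms by blast
  have "F' ?z \<oplus>\<^bsub>Hm (F A) (F B)\<^esub> F' ?z = F' ?z"
    using functor_add[OF assms(1) z z] add_zero_right[OF z] by simp
  then show ?thesis using add_cancel_zero functor_arr[OF assms(1) z] by blast
qed

lemma functor_finsum:
  assumes F: "klinear_functor K C F F'" and ob: "A \<in> Obj C" "B \<in> Obj C"
    and f: "\<And>i. i \<in> I \<Longrightarrow> arr (f i) A B"
  shows "F' (\<Oplus>\<^bsub>Hm A B\<^esub>i\<in>I. f i) = (\<Oplus>\<^bsub>Hm (F A) (F B)\<^esub>i\<in>I. F' (f i))"
proof (rule additive_finsum)
  show "abelian_group (Hm A B)" "abelian_group (Hm (F A) (F B))"
    using hom_group ob functor_obj[OF F] by auto
  show "F' \<in> Mor C A B \<rightarrow> Mor C (F A) (F B)"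
    using functor_arr[OF F, of _ A B] ob by (auto simp: arr_def)
  show "F' (x \<oplus>\<^bsub>Hm A B\<^esub> y) = F' x \<oplus>\<^bsub>Hm (F A) (F B)\<^esub> F' y" if "x \<in> Mor C A B" "y \<in> Mor C A B" for x y
    using functor_add[OF F, of x A B y] that ob by (simp add: arr_def)
  show "F' \<zero>\<^bsub>Hm A B\<^esub> = \<zero>\<^bsub>Hm (F A) (F B)\<^esub>" using functor_zero[OF F ob] .
  show "f \<in> I \<rightarrow> Mor C A B" using f arrD by blast
qed

lemma functor_direct_sum:
  assumes F: "klinear_functor K C F F'" and S: "direct_sum C Xs S"
  shows "direct_sum C (map F Xs) (F S)"
proof -
  let ?n = "length Xs"
  obtain u p where up: "S \<in> Obj C" "\<And>i. i < ?n \<Longrightarrow> Xs ! i \<in> Obj C"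
    "\<And>i. i < ?n \<Longrightarrow> arr (u i) (Xs ! i) S" "\<And>i. i < ?n \<Longrightarrow> arr (p i) S (Xs ! i)"
    "\<And>i. i < ?n \<Longrightarrow> p i \<bullet> u i = Id C (Xs ! i)"
    "\<And>i j. \<lbrakk>i < ?n; j < ?n; i \<noteq> j\<rbrakk> \<Longrightarrow> p i \<bullet> u j = \<zero>\<^bsub>Hm (Xs ! j) (Xs ! i)\<^esub>"
    "(\<Oplus>\<^bsub>Hm S S\<^esub>i\<in>{..<?n}. u i \<bullet> p i) = Id C S"
    using direct_sumE[OF S] by blast
  have sum: "(\<Oplus>\<^bsub>Hm (F S) (F S)\<^esub>i\<in>{..<?n}. F' (u i) \<bullet> F' (p i)) = Id C (F S)"
  proof -
    have "(\<Oplus>\<^bsub>Hm (F S) (F S)\<^esub>i\<in>{..<?n}. F' (u i) \<bullet> F' (p i)) = (\<Oplus>\<^bsub>Hm (F S) (F S)\<^esub>i\<in>{..<?n}. F' (u i \<bullet> p i))"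
      using functor_comp[OF F up(4,3)] functor_obj[OF F up(1)] functor_arr[OF F arr_comp[OF up(4,3)]]
      by (intro finsum_arr_cong) auto
    also have "\<dots> = F' (\<Oplus>\<^bsub>Hm S S\<^esub>i\<in>{..<?n}. u i \<bullet> p i)"
      using functor_finsum[OF F up(1) up(1), of "{..<?n}" "\<lambda>i. u i \<bullet> p i"] arr_comp[OF up(4,3)] by auto
    finally show ?thesis using up(1,7) functor_id[OF F] by simp
  qed
  show ?thesis
  proof (rule direct_sumI[of _ _ "\<lambda>i. F' (u i)" "\<lambda>i. F' (p i)"])
    show "F S \<in> Obj C" using functor_obj[OF F up(1)] .
    fix i assume "i < length (map F Xs)"
    then have i: "i < ?n" by simp
    show "arr (F' (u i)) (map F Xs ! i) (F S)" "arr (F' (p i)) (F S) (map F Xs ! i)"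
      using functor_arr[OF F up(3)[OF i]] functor_arr[OF F up(4)[OF i]] i by auto
    show "F' (p i) \<bullet> F' (u i) = Id C (map F Xs ! i)"
      using functor_comp[OF F up(3)[OF i] up(4)[OF i]] up(5)[OF i] functor_id[OF F up(2)[OF i]] i by simp
    fix j assume "j < length (map F Xs)" "i \<noteq> j"
    then have j: "j < ?n" "i \<noteq> j" by auto
    show "F' (p i) \<bullet> F' (u j) = \<zero>\<^bsub>Hm (map F Xs ! j) (map F Xs ! i)\<^esub>"
      using functor_comp[OF F up(3)[OF j(1)] up(4)[OF i]] up(6)[OF i j] functor_zero[OF F up(2)[OF j(1)] up(2)[OF i]] i j by simp
  qed (use sum in simp)
qed

lemma functor_Add:
  assumes F: "klinear_functor K C F F'" and X: "X \<in> Add C M"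
  shows "F X \<in> Add C (F M)"
proof -
  obtain n S where S: "direct_sum C (replicate n M) S" "direct_summand C X S"
    using X unfolding Add_def by blast
  obtain Z where "direct_sum C [X, Z] S" using S(2) unfolding direct_summand_def by blast
  then have "direct_summand C (F X) (F S)" using functor_direct_sum[OF F] unfolding direct_summand_def by fastforce
  moreover have "direct_sum C (replicate n (F M)) (F S)" using functor_direct_sum[OF F S(1)] by simp
  ultimately show ?thesis using functor_obj[OF F Add_obj[OF X]] unfolding Add_def by blast
qed

lemma functor_retract:
  assumes F: "klinear_functor K C F F'" and X: "retract X Y"
  shows "retract (F X) (F Y)"
proof -
  obtain u p where up: "arr u X Y" "arr p Y X" "p \<bullet> u = Id C X" using X unfolding retract_def by blast
  then have "F' p \<bullet> F' u = Id C (F X)"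
    using functor_comp[OF F up(1,2)] functor_id[OF F arrD(1)[OF up(1)]] by simp
  then show ?thesis using functor_arr[OF F up(1)] functor_arr[OF F up(2)] unfolding retract_def by blast
qed

lemma functor_iso_rel:
  assumes F: "klinear_functor K C F F'" and X: "(X, Y) \<in> iso_rel C"
  shows "(F X, F Y) \<in> iso_rel C"
proof -
  obtain u p where up: "arr u X Y" "arr p Y X" "p \<bullet> u = Id C X" "u \<bullet> p = Id C Y" using X by (rule iso_relE)
  then have "F' p \<bullet> F' u = Id C (F X)" "F' u \<bullet> F' p = Id C (F Y)"
    using functor_comp[OF F up(1,2)] functor_comp[OF F up(2,1)] functor_id[OF F arrD(1)[OF up(1)]]
      functor_id[OF F arrD(1)[OF up(2)]] by simp_all
  then show ?thesis using functor_arr[OF F up(1)] functor_arr[OF F up(2)] iso_relI by blast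
qed

section \<open>Autoequivalences are faithful, full and essentially surjective\<close>

lemma natural_isoE:
  assumes "natural_iso C F F' G G' \<eta>" "A \<in> Obj C" "F A \<in> Obj C" "G A \<in> Obj C"
  obtains \<eta>' where "arr (\<eta> A) (F A) (G A)" "arr \<eta>' (G A) (F A)" "\<eta>' \<bullet> \<eta> A = Id C (F A)" "\<eta> A \<bullet> \<eta>' = Id C (G A)"
proof -
  have "iso_mor C (F A) (G A) (\<eta> A)" using assms unfolding natural_iso_def by blast
  then show ?thesis using that assms(3,4) iso_mor_iff by blast
qed

lemma natural_iso_comm:
  assumes "natural_iso C F F' G G' \<eta>" "arr f A B"
  shows "\<eta> B \<bullet> F' f = G' f \<bullet> \<eta> A"
  using assms unfolding natural_iso_def arr_def by blast

lemma faithful_of_natural_iso: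
  assumes \<eta>: "natural_iso C id id (G \<circ> F) (G' \<circ> F') \<eta>" and f: "arr f A B" "arr g A B" "F' f = F' g"
    and GF: "\<And>A. A \<in> Obj C \<Longrightarrow> G (F A) \<in> Obj C"
  shows "f = g"
proof -
  have B: "B \<in> Obj C" using arrD f by blast
  obtain e where e: "arr (\<eta> B) B (G (F B))" "arr e (G (F B)) B" "e \<bullet> \<eta> B = Id C B"
    using natural_isoE[OF \<eta> B] B GF by auto
  have "\<eta> B \<bullet> f = \<eta> B \<bullet> g"
    using natural_iso_comm[OF \<eta> f(1)] natural_iso_comm[OF \<eta> f(2)] f(3) by simp
  then show ?thesis
    using split_mono_cancel[OF e f(1,2)] by blast
qed

lemma autoequivalence_faithful:
  assumes "klinear_autoequivalence K C F F'" "arr f A B" "arr g A B" "F' f = F' g"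
  shows "f = g"
proof -
  obtain G G' \<eta> where ff: "klinear_functor K C F F'" "klinear_functor K C G G'" and
    \<eta>: "natural_iso C id id (G \<circ> F) (G' \<circ> F') \<eta>"
    using assms(1) unfolding klinear_autoequivalence_def by blast
  show ?thesis
    by (rule faithful_of_natural_iso[OF \<eta> assms(2-4)]) (use functor_obj[OF ff(1)] functor_obj[OF ff(2)] in blast)
qed

text \<open>The preimage is the conjugate of \<open>G' h\<close> by \<open>\<eta>\<close>; its image
  agrees with \<open>h\<close> after applying \<open>G'\<close>. No compatibility between
  \<open>\<eta>\<close> and \<open>\<epsilon>\<close> is assumed, so \<open>G'\<close> is removed by
  naturality of \<open>\<epsilon>\<close> at both morphisms and cancellation of the invertible
  \<open>\<epsilon> (F A)\<close>.\<close>

lemma autoequivalence_full: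
  assumes F: "klinear_autoequivalence K C F F'" and h: "arr h (F A) (F B)" and ob: "A \<in> Obj C" "B \<in> Obj C"
  shows "\<exists>f. arr f A B \<and> F' f = h"
proof -
  obtain G G' \<eta> \<epsilon> where ff: "klinear_functor K C F F'" "klinear_functor K C G G'" and
    \<eta>: "natural_iso C id id (G \<circ> F) (G' \<circ> F') \<eta>" and \<epsilon>: "natural_iso C (F \<circ> G) (F' \<circ> G') id id \<epsilon>"
    using F unfolding klinear_autoequivalence_def by blast
  have obs: "F A \<in> Obj C" "F B \<in> Obj C" "G (F A) \<in> Obj C" "G (F B) \<in> Obj C"
    using ob functor_obj ff by blast+
  obtain e where e: "arr (\<eta> B) B (G (F B))" "arr e (G (F B)) B" "e \<bullet> \<eta> B = Id C B" "\<eta> B \<bullet> e = Id C (G (F B))"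
    using natural_isoE[OF \<eta> ob(2)] ob obs by auto
  obtain d where d: "arr (\<eta> A) A (G (F A))" "arr d (G (F A)) A" "d \<bullet> \<eta> A = Id C A" "\<eta> A \<bullet> d = Id C (G (F A))"
    using natural_isoE[OF \<eta> ob(1)] ob obs by auto
  have Gh: "arr (G' h) (G (F A)) (G (F B))" using functor_arr[OF ff(2) h] .
  define f where "f = e \<bullet> (G' h \<bullet> \<eta> A)"
  have f: "arr f A B" unfolding f_def using e d Gh by blast
  have "\<eta> B \<bullet> f = G' h \<bullet> \<eta> A"
    unfolding f_def using comp_assoc[OF arr_comp[OF d(1) Gh] e(2,1)] e(4) arr_comp[OF d(1) Gh] by simp
  then have "G' (F' f) \<bullet> \<eta> A = G' h \<bullet> \<eta> A"
    using natural_iso_comm[OF \<eta> f] by simp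
  moreover have GFf: "arr (G' (F' f)) (G (F A)) (G (F B))" using functor_arr f ff by blast
  ultimately have GG: "G' (F' f) = G' h"
    using split_epi_cancel[OF d(1,2,4) GFf Gh] by blast
  have Ff: "arr (F' f) (F A) (F B)" using functor_arr[OF ff(1) f] .
  obtain k where k: "arr (\<epsilon> (F A)) (F (G (F A))) (F A)" "arr k (F A) (F (G (F A)))" "\<epsilon> (F A) \<bullet> k = Id C (F A)"
    using natural_isoE[OF \<epsilon> obs(1)] obs functor_obj[OF ff(1)] by auto
  have "F' f \<bullet> \<epsilon> (F A) = h \<bullet> \<epsilon> (F A)"
    using natural_iso_comm[OF \<epsilon> Ff] natural_iso_comm[OF \<epsilon> h] GG by simp
  then have "F' f = h"
    using split_epi_cancel[OF k Ff h] by blast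
  then show ?thesis using f by blast
qed

lemma autoequivalence_ess_surj:
  assumes F: "klinear_autoequivalence K C F F'" and B: "B \<in> Obj C"
  shows "\<exists>A\<in>Obj C. (F A, B) \<in> iso_rel C"
proof -
  obtain G G' \<epsilon> where ff: "klinear_functor K C F F'" "klinear_functor K C G G'" and
    \<epsilon>: "natural_iso C (F \<circ> G) (F' \<circ> G') id id \<epsilon>"
    using F unfolding klinear_autoequivalence_def by blast
  have GB: "G B \<in> Obj C" "F (G B) \<in> Obj C" using functor_obj ff B by blast+
  obtain e where "arr (\<epsilon> B) (F (G B)) B" "arr e B (F (G B))" "e \<bullet> \<epsilon> B = Id C (F (G B))" "\<epsilon> B \<bullet> e = Id C B"
    using natural_isoE[OF \<epsilon> B] GB B by auto
  then show ?thesis using iso_relI GB by blast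
qed

section \<open>The additive closure of an object\<close>

lemma Add_direct_sum: "direct_sum C (replicate n M) S \<Longrightarrow> zero_object C Z \<Longrightarrow> S \<in> Add C M"
  using direct_summand_refl direct_sum_obj unfolding Add_def by blast

lemma Add_self: "M \<in> Obj C \<Longrightarrow> zero_object C Z \<Longrightarrow> M \<in> Add C M"
  using Add_direct_sum[of 1 M M] direct_sum_singleton by simp

text \<open>A zero object is the direct sum of no copies of \<open>M\<close>, which is why the
  number of copies may be 0.\<close>

lemma Add_zero: "zero_object C Z \<Longrightarrow> Z \<in> Add C M"
  using Add_direct_sum[of 0 M Z] direct_sum_Nil by simp

lemma Add_iso:
  assumes "(M, N) \<in> iso_rel C" shows "Add C M \<subseteq> Add C N"
proof
  fix X assume "X \<in> Add C M"
  then obtain n S where X: "X \<in> Obj C" and S: "direct_sum C (replicate n M) S" "direct_summand C X S"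
    unfolding Add_def by blast
  have "direct_sum C (replicate n N) S"
    by (rule direct_sum_iso_summands[OF S(1), of id]) (use assms in auto)
  then show "X \<in> Add C N" using X S unfolding Add_def by blast
qed

text \<open>\<open>f\<close> is the sum of the morphisms
  \<open>f \<bullet> (p k \<bullet> u k)\<close>, and each \<open>f \<bullet> p k\<close> starts at
  \<open>M\<close>.\<close>

lemma zero_on_Add_source:
  assumes "X \<in> Add C M" "arr f X Y" "\<And>g. arr g M Y \<Longrightarrow> g = \<zero>\<^bsub>Hm M Y\<^esub>"
  shows "f = \<zero>\<^bsub>Hm X Y\<^esub>"
proof -
  obtain n u p where up: "\<And>k. k < n \<Longrightarrow> arr (u k) X M" "\<And>k. k < n \<Longrightarrow> arr (p k) M X"
    "(\<Oplus>\<^bsub>Hm X X\<^esub>k\<in>{..<(n::nat)}. p k \<bullet> u k) = Id C X"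
    using Add_identity[OF assms(1)] by blast
  have ob: "X \<in> Obj C" "Y \<in> Obj C" using arrD[OF assms(2)] by blast+
  have "f = f \<bullet> (\<Oplus>\<^bsub>Hm X X\<^esub>k\<in>{..<n}. p k \<bullet> u k)" using up(3) assms(2) by simp
  also have "\<dots> = (\<Oplus>\<^bsub>Hm X Y\<^esub>k\<in>{..<n}. f \<bullet> (p k \<bullet> u k))"
    using assms(2) ob arr_comp[OF up(1,2)] by (intro comp_finsum_right) auto
  also have "\<dots> = \<zero>\<^bsub>Hm X Y\<^esub>"
  proof (rule finsum_arr_zero)
    fix k assume "k \<in> {..<n}"
    then have k: "k < n" by simp
    have "f \<bullet> p k = \<zero>\<^bsub>Hm M Y\<^esub>" using assms(3) arr_comp[OF up(2)[OF k] assms(2)] by blast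
    then show "f \<bullet> (p k \<bullet> u k) = \<zero>\<^bsub>Hm X Y\<^esub>"
      using comp_assoc[OF up(1)[OF k] up(2)[OF k] assms(2)] comp_zero_left[OF up(1)[OF k] ob(2)] by simp
  qed (use ob in auto)
  finally show ?thesis .
qed

lemma zero_on_Add_target:
  assumes "X \<in> Add C M" "arr f Y X" "\<And>k. arr k X M \<Longrightarrow> k \<bullet> f = \<zero>\<^bsub>Hm Y M\<^esub>"
  shows "f = \<zero>\<^bsub>Hm Y X\<^esub>"
proof -
  obtain n u p where up: "\<And>k. k < n \<Longrightarrow> arr (u k) X M" "\<And>k. k < n \<Longrightarrow> arr (p k) M X"
    "(\<Oplus>\<^bsub>Hm X X\<^esub>k\<in>{..<(n::nat)}. p k \<bullet> u k) = Id C X"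
    using Add_identity[OF assms(1)] by blast
  have ob: "X \<in> Obj C" "Y \<in> Obj C" using arrD[OF assms(2)] by blast+
  have "f = (\<Oplus>\<^bsub>Hm X X\<^esub>k\<in>{..<n}. p k \<bullet> u k) \<bullet> f" using up(3) assms(2) by simp
  also have "\<dots> = (\<Oplus>\<^bsub>Hm Y X\<^esub>k\<in>{..<n}. (p k \<bullet> u k) \<bullet> f)"
    using assms(2) ob arr_comp[OF up(1,2)] by (intro comp_finsum_left) auto
  also have "\<dots> = \<zero>\<^bsub>Hm Y X\<^esub>"
  proof (rule finsum_arr_zero)
    fix k assume "k \<in> {..<n}"
    then have k: "k < n" by simp
    show "(p k \<bullet> u k) \<bullet> f = \<zero>\<^bsub>Hm Y X\<^esub>"
      using comp_assoc[OF assms(2) up(1)[OF k] up(2)[OF k]] assms(3)[OF up(1)[OF k]] comp_zero_right[OF up(2)[OF k] ob(2)] by simp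
  qed (use ob in auto)
  finally show ?thesis .
qed

end

section \<open>Exactness of triangles\<close>

context klinear_triangulated_category
begin

lemma shift_functor: "klinear_functor K D (Shift D) (ShiftM D)"
  using shift unfolding klinear_autoequivalence_def by blast

lemmas shift_arr = functor_arr[OF shift_functor]
lemmas shift_obj = functor_obj[OF shift_functor]
lemmas shift_id = functor_id[OF shift_functor]
lemmas shift_comp = functor_comp[OF shift_functor]
lemmas shift_zero = functor_zero[OF shift_functor]
lemmas shift_full = autoequivalence_full[OF shift]
lemmas shift_faithful = autoequivalence_faithful[OF shift]

lemma triangle_arr:
  assumes "(X, Y, Z, f, g, h) \<in> Triangles D"
  shows "arr f X Y" "arr g Y Z" "arr h Z (Shift D X)"
  using triangle_candidate[OF assms] shift_obj[of X] unfolding candidate_triangle_def arr_def by blast+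

lemma candidateI: "\<lbrakk>arr f X Y; arr g Y Z; arr h Z (Shift D X)\<rbrakk> \<Longrightarrow> candidate_triangle D X Y Z f g h"
  by (auto simp: candidate_triangle_def arr_def)

lemma rotate:
  assumes "(X, Y, Z, f, g, h) \<in> Triangles D"
  shows "(Y, Z, Shift D X, g, h, \<ominus>\<^bsub>Hm (Shift D X) (Shift D Y)\<^esub> (ShiftM D f)) \<in> Triangles D"
  using TR2[OF triangle_candidate[OF assms]] assms by blast

lemma triangle_morphism:
  assumes "(X, Y, Z, f, g, h) \<in> Triangles D" "(X', Y', Z', f', g', h') \<in> Triangles D"
    "arr a X X'" "arr b Y Y'" "b \<bullet> f = f' \<bullet> a"
  shows "\<exists>c. arr c Z Z' \<and> c \<bullet> g = g' \<bullet> b \<and> ShiftM D a \<bullet> h = h' \<bullet> c"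
proof -
  have "a \<in> Mor D X X'" "b \<in> Mor D Y Y'" using assms arrD by blast+
  then obtain c where c: "c \<in> Mor D Z Z'" "c \<bullet> g = g' \<bullet> b" "ShiftM D a \<bullet> h = h' \<bullet> c"
    using TR3[OF assms(1,2) _ _ assms(5)] by blast
  have "arr c Z Z'" using c(1) triangle_arr(2)[OF assms(1)] triangle_arr(2)[OF assms(2)] by (simp add: arr_def)
  then show ?thesis using c by (intro exI[of _ c] conjI)
qed

text \<open>Mapping the triangle X = X -> 0 to the given one by the identity and \<open>f\<close>
  shows that \<open>g \<bullet> f\<close> factors through a zero object.\<close>

lemma triangle_comp_zero:
  assumes T: "(X, Y, Z, f, g, h) \<in> Triangles D"
  shows "g \<bullet> f = \<zero>\<^bsub>Hm X Z\<^esub>"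
proof -
  note a = triangle_arr[OF T]
  have X: "X \<in> Obj D" using arrD a by blast
  obtain N where N: "zero_object D N" using zero_object_exists by blast
  from triangle_morphism[OF TR1_id[OF X N] T arr_id[OF X] a(1) refl]
  obtain c where c: "arr c N Z" "c \<bullet> \<zero>\<^bsub>Hm X N\<^esub> = g \<bullet> f" by (elim exE conjE) (rule that)
  then show ?thesis using comp_zero_right[OF c(1) X] by simp
qed

text \<open>TR3 completes only the third component, while the map to \<open>X\<close> is sought in
  the first. Both triangles are therefore rotated; TR3 then yields W[1] -> X[1], which descends
  because the shift is full and faithful.\<close>

lemma triangle_weak_kernel:
  assumes T: "(X, Y, Z, f, g, h) \<in> Triangles D" and \<phi>: "arr \<phi> W Y" "g \<bullet> \<phi> = \<zero>\<^bsub>Hm W Z\<^esub>"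
  obtains c where "arr c W X" "\<phi> = f \<bullet> c"
proof -
  note a = triangle_arr[OF T]
  have ob: "W \<in> Obj D" "X \<in> Obj D" "Y \<in> Obj D" "Z \<in> Obj D" using arrD a \<phi> by blast+
  obtain N where N: "zero_object D N" using zero_object_exists by blast
  have Nob: "N \<in> Obj D" using zero_objectD N by blast
  have z: "arr \<zero>\<^bsub>Hm N Z\<^esub> N Z" using Nob ob by blast
  have eq: "\<zero>\<^bsub>Hm N Z\<^esub> \<bullet> \<zero>\<^bsub>Hm W N\<^esub> = g \<bullet> \<phi>" using \<phi>(2) comp_zero_right[OF z ob(1)] by simp
  from triangle_morphism[OF rotate[OF TR1_id[OF ob(1) N]] rotate[OF T] \<phi>(1) z eq]
  obtain c where c: "arr c (Shift D W) (Shift D X)"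
    "ShiftM D \<phi> \<bullet> \<ominus>\<^bsub>Hm (Shift D W) (Shift D W)\<^esub> ShiftM D (Id D W) = (\<ominus>\<^bsub>Hm (Shift D X) (Shift D Y)\<^esub> ShiftM D f) \<bullet> c"
    by (elim exE conjE) (rule that)
  obtain d where d: "arr d W X" "ShiftM D d = c" using shift_full[OF c(1) ob(1,2)] by blast
  have S\<phi>: "arr (ShiftM D \<phi>) (Shift D W) (Shift D Y)" using shift_arr[OF \<phi>(1)] .
  have Sf: "arr (ShiftM D f) (Shift D X) (Shift D Y)" using shift_arr[OF a(1)] .
  have SI: "arr (Id D (Shift D W)) (Shift D W) (Shift D W)" using shift_obj[OF ob(1)] by blast
  have "\<ominus>\<^bsub>Hm (Shift D W) (Shift D Y)\<^esub> ShiftM D \<phi> = \<ominus>\<^bsub>Hm (Shift D W) (Shift D Y)\<^esub> (ShiftM D f \<bullet> c)"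
    using c(2) comp_neg_right[OF SI S\<phi>] comp_neg_left[OF c(1) Sf] shift_id[OF ob(1)] S\<phi> by simp
  then have "ShiftM D \<phi> = ShiftM D f \<bullet> c"
    using neg_inj[OF S\<phi> arr_comp[OF c(1) Sf]] by blast
  also have "\<dots> = ShiftM D (f \<bullet> d)" using shift_comp[OF d(1) a(1)] d(2) by simp
  finally have "\<phi> = f \<bullet> d" using shift_faithful[OF \<phi>(1) arr_comp[OF d(1) a(1)]] by blast
  then show ?thesis using that d by blast
qed

text \<open>The comparison triangle is 0 -> W = W, an identity triangle rotated backwards; here the
  wanted map is already the third component, so it need not be transported along the shift.\<close>

lemma triangle_weak_cokernel:
  assumes T: "(X, Y, Z, f, g, h) \<in> Triangles D" and \<psi>: "arr \<psi> Y W" "\<psi> \<bullet> f = \<zero>\<^bsub>Hm X W\<^esub>"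
  obtains c where "arr c Z W" "\<psi> = c \<bullet> g"
proof -
  note a = triangle_arr[OF T]
  have ob: "W \<in> Obj D" "X \<in> Obj D" "Y \<in> Obj D" "Z \<in> Obj D" using arrD a \<psi> by blast+
  obtain N where N: "zero_object D N" using zero_object_exists by blast
  have Nob: "N \<in> Obj D" "Shift D N \<in> Obj D" "Shift D W \<in> Obj D" using zero_objectD N shift_obj ob by blast+
  have SN: "zero_object D (Shift D N)"
    using zero_objectI[OF Nob(2)] zero_objectD(2)[OF N] shift_id[OF Nob(1)] shift_zero[OF Nob(1) Nob(1)] by simp
  have zN: "arr \<zero>\<^bsub>Hm N W\<^esub> N W" "arr \<zero>\<^bsub>Hm X N\<^esub> X N" "arr \<zero>\<^bsub>Hm W (Shift D N)\<^esub> W (Shift D N)"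
    using Nob ob by blast+
  have cand: "candidate_triangle D N W W \<zero>\<^bsub>Hm N W\<^esub> (Id D W) \<zero>\<^bsub>Hm W (Shift D N)\<^esub>"
    using candidateI zN ob by blast
  have neg0: "\<ominus>\<^bsub>Hm (Shift D N) (Shift D W)\<^esub> ShiftM D \<zero>\<^bsub>Hm N W\<^esub> = \<zero>\<^bsub>Hm (Shift D N) (Shift D W)\<^esub>"
    using zero_objectD(4)[OF SN arr_neg[OF shift_arr[OF zN(1)]]] .
  have T0: "(N, W, W, \<zero>\<^bsub>Hm N W\<^esub>, Id D W, \<zero>\<^bsub>Hm W (Shift D N)\<^esub>) \<in> Triangles D"
    using TR2[OF cand] TR1_id[OF ob(1) SN] neg0 by simp
  have eq: "\<psi> \<bullet> f = \<zero>\<^bsub>Hm N W\<^esub> \<bullet> \<zero>\<^bsub>Hm X N\<^esub>" using \<psi>(2) comp_zero_right[OF zN(1) ob(2)] by simp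
  from triangle_morphism[OF T T0 zN(2) \<psi>(1) eq]
  obtain c where c: "arr c Z W" "c \<bullet> g = Id D W \<bullet> \<psi>" by (elim exE conjE) (rule that)
  then show ?thesis using that \<psi>(1) by simp
qed

text \<open>Since the shift is only essentially surjective, the cone of \<open>p\<close> is first
  replaced by an isomorphic object of the form P[1].\<close>

lemma cocone_exists:
  assumes p: "arr p Q X"
  obtains P f h where "(P, Q, X, f, p, h) \<in> Triangles D"
proof -
  have ob: "Q \<in> Obj D" "X \<in> Obj D" "p \<in> Mor D Q X" using arrD[OF p] by blast+
  obtain E h0 r where T: "(Q, X, E, p, h0, r) \<in> Triangles D" using TR1_cone[OF ob] by blast
  note a = triangle_arr[OF T]
  obtain P where P: "P \<in> Obj D" "(Shift D P, E) \<in> iso_rel D"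
    using autoequivalence_ess_surj[OF shift arrD(2)[OF a(2)]] by blast
  obtain e e' where e: "arr e (Shift D P) E" "arr e' E (Shift D P)" "e' \<bullet> e = Id D (Shift D P)" "e \<bullet> e' = Id D E"
    using P(2) by (rule iso_relE)
  have re: "arr (r \<bullet> e) (Shift D P) (Shift D Q)" using e a by blast
  \<comment> \<open>The sign compensates the one introduced by rotation: the rotated triangle must
    end in \<open>r \<bullet> e\<close>.\<close>
  obtain f where f: "arr f P Q" "ShiftM D f = \<ominus>\<^bsub>Hm (Shift D P) (Shift D Q)\<^esub> (r \<bullet> e)"
    using shift_full[OF arr_neg[OF re] P(1) ob(1)] by blast
  have h: "arr (e' \<bullet> h0) X (Shift D P)" using e a by blast
  have cand: "candidate_triangle D P Q X f p (e' \<bullet> h0)" using candidateI f h p by blast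
  have neg: "\<ominus>\<^bsub>Hm (Shift D P) (Shift D Q)\<^esub> ShiftM D f = r \<bullet> e" using f(2) neg_neg[OF re] by simp
  have SQ: "Shift D Q \<in> Obj D" using shift_obj ob by blast
  have "(Q, X, Shift D P, p, e' \<bullet> h0, r \<bullet> e) \<in> Triangles D"
  proof (rule TR1_iso[OF T])
    show "candidate_triangle D Q X (Shift D P) p (e' \<bullet> h0) (r \<bullet> e)" using candidateI p h re by blast
    show "iso_mor D Q Q (Id D Q)" "iso_mor D X X (Id D X)" using iso_mor_Id ob by blast+
    show "iso_mor D E (Shift D P) e'" using iso_morI e by blast
    show "Id D X \<bullet> p = p \<bullet> Id D Q" using p by simp
    show "e' \<bullet> h0 = (e' \<bullet> h0) \<bullet> Id D X" using h by simp
    show "ShiftM D (Id D Q) \<bullet> r = (r \<bullet> e) \<bullet> e'"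
      using comp_assoc[OF e(2,1) a(3)] e(4) a(3) shift_id[OF ob(1)] by simp
  qed
  then have "(P, Q, X, f, p, e' \<bullet> h0) \<in> Triangles D" using TR2[OF cand] neg by simp
  then show ?thesis using that by blast
qed

end

section \<open>Finite generation of hom-spaces\<close>

context klinear_category
begin

text \<open>The list enumerates a basis. The clause on the zero space is recorded because the list
  governs how many copies of \<open>T\<close> are taken in a presentation, and there none may be
  taken.\<close>

lemma finite_generators:
  assumes fin: "hom_finite K C" and ob: "A \<in> Obj C" "B \<in> Obj C"
  obtains bs where "\<And>b. b \<in> set bs \<Longrightarrow> arr b A B" "Mor C A B = {\<zero>\<^bsub>Hm A B\<^esub>} \<Longrightarrow> bs = []"
    "\<And>f. arr f A B \<Longrightarrow> \<exists>c. (\<forall>i<length bs. c i \<in> carrier K) \<and>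
       f = (\<Oplus>\<^bsub>Hm A B\<^esub>i\<in>{..<length bs}. c i \<odot>\<^bsub>Hm A B\<^esub> (bs ! i))"
proof -
  interpret V: vectorspace K "Hm A B" using hom_vectorspace ob by blast
  have "V.fin_dim" using fin ob by (simp add: hom_finite_def)
  then obtain \<beta> where \<beta>: "finite \<beta>" "V.basis \<beta>" using V.finite_basis_exists by blast
  then have \<beta>': "\<beta> \<subseteq> Mor C A B" "V.lin_indpt \<beta>" "V.gen_set \<beta>" by (auto simp: V.basis_def)
  obtain bs where bs: "set bs = \<beta>" "distinct bs" using \<beta>(1) finite_distinct_list by blast
  have "bs = []" if "Mor C A B = {\<zero>\<^bsub>Hm A B\<^esub>}"
  proof -
    have "\<beta> \<subseteq> {\<zero>\<^bsub>Hm A B\<^esub>}" using \<beta>'(1) that by simp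
    then have "\<beta> = {}" using V.vs_zero_lin_dep[OF \<beta>'(1,2)] subset_singletonD by fastforce
    then show ?thesis using bs(1) by simp
  qed
  moreover have "\<exists>c. (\<forall>i<length bs. c i \<in> carrier K) \<and>
       f = (\<Oplus>\<^bsub>Hm A B\<^esub>i\<in>{..<length bs}. c i \<odot>\<^bsub>Hm A B\<^esub> (bs ! i))" if f: "arr f A B" for f
  proof -
    have "f \<in> V.span \<beta>" using \<beta>'(3) arrD(3)[OF f] by simp
    then obtain a where a: "a \<in> \<beta> \<rightarrow> carrier K" "f = V.lincomb a \<beta>"
      using V.finite_span[OF \<beta>(1) \<beta>'(1)] by auto
    have bij: "(!) bs ` {..<length bs} = \<beta>" "inj_on ((!) bs) {..<length bs}"
      using bs by (auto simp: in_set_conv_nth inj_on_def nth_eq_iff_index_eq)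
    have m: "(\<lambda>v. a v \<odot>\<^bsub>Hm A B\<^esub> v) \<in> (!) bs ` {..<length bs} \<rightarrow> Mor C A B"
      using a(1) \<beta>'(1) unfolding bij(1) by auto
    have "f = (\<Oplus>\<^bsub>Hm A B\<^esub>v\<in>(!) bs ` {..<length bs}. a v \<odot>\<^bsub>Hm A B\<^esub> v)"
      using a(2) unfolding bij(1) V.lincomb_def .
    also have "\<dots> = (\<Oplus>\<^bsub>Hm A B\<^esub>i\<in>{..<length bs}. a (bs ! i) \<odot>\<^bsub>Hm A B\<^esub> (bs ! i))"
      by (rule V.finsum_reindex[OF m bij(2)])
    finally show ?thesis
      using a(1) bs(1) by (intro exI[of _ "\<lambda>i. a (bs ! i)"]) auto
  qed
  moreover have "arr b A B" if "b \<in> set bs" for b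
    using that bs(1) \<beta>'(1) ob by (auto simp: arr_def)
  ultimately show ?thesis using that by blast
qed

lemma arr_zero_mor: "Mor C A B = {\<zero>\<^bsub>Hm A B\<^esub>} \<Longrightarrow> arr f A B \<Longrightarrow> f = \<zero>\<^bsub>Hm A B\<^esub>"
  by (auto simp: arr_def)

end

section \<open>Presentations by a cluster tilting object\<close>

context klinear_triangulated_category
begin

lemma cluster_tiltingD:
  assumes "cluster_tilting D T"
  shows "T \<in> Obj D" "X \<in> Add D T \<Longrightarrow> arr f T (Shift D X) \<Longrightarrow> f = \<zero>\<^bsub>Hm T (Shift D X)\<^esub>"
    "X \<in> Obj D \<Longrightarrow> (\<And>f. arr f T (Shift D X) \<Longrightarrow> f = \<zero>\<^bsub>Hm T (Shift D X)\<^esub>) \<Longrightarrow> X \<in> Add D T"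
proof -
  have eq: "Add D T = {X \<in> Obj D. Mor D T (Shift D X) = {\<zero>\<^bsub>Hm T (Shift D X)\<^esub>}}"
    using assms by (simp add: cluster_tilting_def)
  show T: "T \<in> Obj D" using assms by (simp add: cluster_tilting_def)
  show "f = \<zero>\<^bsub>Hm T (Shift D X)\<^esub>" if "X \<in> Add D T" "arr f T (Shift D X)"
    using that eq arr_zero_mor by blast
  show "X \<in> Add D T" if X: "X \<in> Obj D" "\<And>f. arr f T (Shift D X) \<Longrightarrow> f = \<zero>\<^bsub>Hm T (Shift D X)\<^esub>"
  proof -
    have "Mor D T (Shift D X) = {\<zero>\<^bsub>Hm T (Shift D X)\<^esub>}"
      using X(2) arr_zero[OF T shift_obj[OF X(1)]] T shift_obj[OF X(1)] unfolding arr_def by blast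
    then show ?thesis using X(1) eq by blast
  qed
qed

text \<open>
  The last clause of \<open>presentation\<close> is the part of minimality that is needed: it makes the index
  of an object of \<open>add T[1]\<close> equal to \<open>-[P]\<close>.
\<close>

definition presentation :: "'o \<Rightarrow> 'o \<Rightarrow> 'o \<Rightarrow> 'o \<Rightarrow> 'm \<Rightarrow> 'm \<Rightarrow> 'm \<Rightarrow> bool" where
  "presentation T P Q X f p h \<longleftrightarrow> (P, Q, X, f, p, h) \<in> Triangles D \<and> P \<in> Add D T \<and> Q \<in> Add D T \<and>
    (\<forall>\<theta>. arr \<theta> T X \<longrightarrow> (\<exists>\<rho>. arr \<rho> T Q \<and> \<theta> = p \<bullet> \<rho>)) \<and>
    (Mor D T X = {\<zero>\<^bsub>Hm T X\<^esub>} \<longrightarrow> zero_object D Q)"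

text \<open>\<open>Q\<close> has one copy of \<open>T\<close> for each generator of Hom(T, X) and
  \<open>p\<close> is the evaluation map, so all maps T -> X lift to \<open>Q\<close>;
  \<open>P\<close> is the cocone of \<open>p\<close>.\<close>

lemma presentation_exists:
  assumes fin: "hom_finite K D" and T: "cluster_tilting D T" and X: "X \<in> Obj D"
  shows "\<exists>P Q f p h. presentation T P Q X f p h"
proof -
  have Tob: "T \<in> Obj D" using cluster_tiltingD(1)[OF T] .
  obtain N where N: "zero_object D N" using zero_object_exists by blast
  obtain bs where bs: "\<And>b. b \<in> set bs \<Longrightarrow> arr b T X" "Mor D T X = {\<zero>\<^bsub>Hm T X\<^esub>} \<Longrightarrow> bs = []"
    "\<And>f. arr f T X \<Longrightarrow> \<exists>c. (\<forall>i<length bs. c i \<in> carrier K) \<and>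
       f = (\<Oplus>\<^bsub>Hm T X\<^esub>i\<in>{..<length bs}. c i \<odot>\<^bsub>Hm T X\<^esub> (bs ! i))"
    using finite_generators[OF fin Tob X] by blast
  let ?n = "length bs"
  let ?R = "replicate ?n T"
  have "set ?R \<subseteq> Obj D" using Tob by auto
  then obtain Q where Q: "direct_sum D ?R Q" using direct_sum_exists by blast
  obtain u q where uq': "Q \<in> Obj D" "\<And>i. i < length ?R \<Longrightarrow> ?R ! i \<in> Obj D"
    "\<And>i. i < length ?R \<Longrightarrow> arr (u i) (?R ! i) Q" "\<And>i. i < length ?R \<Longrightarrow> arr (q i) Q (?R ! i)"
    "\<And>i. i < length ?R \<Longrightarrow> q i \<bullet> u i = Id D (?R ! i)"
    "\<And>i j. \<lbrakk>i < length ?R; j < length ?R; i \<noteq> j\<rbrakk> \<Longrightarrow> q i \<bullet> u j = \<zero>\<^bsub>Hm (?R ! j) (?R ! i)\<^esub>"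
    "(\<Oplus>\<^bsub>Hm Q Q\<^esub>i\<in>{..<length ?R}. u i \<bullet> q i) = Id D Q"
    by (rule direct_sumE[OF Q]) blast
  have uq: "\<And>i. i < ?n \<Longrightarrow> arr (u i) T Q" "\<And>i. i < ?n \<Longrightarrow> arr (q i) Q T"
    "\<And>i j. \<lbrakk>i < ?n; j < ?n\<rbrakk> \<Longrightarrow> q i \<bullet> u j = (if i = j then Id D T else \<zero>\<^bsub>Hm T T\<^esub>)"
    using uq'(3-6) by simp_all
  have b: "arr (bs ! i) T X" if "i < ?n" for i using bs(1) that by simp
  define p where "p = (\<Oplus>\<^bsub>Hm Q X\<^esub>i\<in>{..<?n}. bs ! i \<bullet> q i)"
  have p: "arr p Q X" unfolding p_def using uq'(1) X arr_comp[OF uq(2) b] by (intro arr_finsum) auto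
  have pu: "p \<bullet> u i = bs ! i" if "i < ?n" for i
    unfolding p_def using uq b that by (intro sum_inclusion_projection[where W = "\<lambda>_. T"]) auto
  have lift: "\<exists>\<rho>. arr \<rho> T Q \<and> \<theta> = p \<bullet> \<rho>" if \<theta>: "arr \<theta> T X" for \<theta>
  proof -
    obtain c where c: "\<And>i. i < ?n \<Longrightarrow> c i \<in> carrier K" "\<theta> = (\<Oplus>\<^bsub>Hm T X\<^esub>i\<in>{..<?n}. c i \<odot>\<^bsub>Hm T X\<^esub> (bs ! i))"
      using bs(3)[OF \<theta>] by blast
    let ?\<rho> = "\<Oplus>\<^bsub>Hm T Q\<^esub>i\<in>{..<?n}. c i \<odot>\<^bsub>Hm T Q\<^esub> (u i)"
    have \<rho>: "arr ?\<rho> T Q" using uq'(1) Tob arr_smult[OF c(1) uq(1)] by (intro arr_finsum) auto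
    have "p \<bullet> ?\<rho> = (\<Oplus>\<^bsub>Hm T X\<^esub>i\<in>{..<?n}. p \<bullet> (c i \<odot>\<^bsub>Hm T Q\<^esub> u i))"
      using p Tob arr_smult[OF c(1) uq(1)] by (intro comp_finsum_right) auto
    also have "\<dots> = \<theta>"
      unfolding c(2) using comp_smult_right[OF uq(1) p c(1)] pu Tob X arr_smult[OF c(1) b]
      by (intro finsum_arr_cong) auto
    finally show ?thesis using \<rho> by blast
  qed
  obtain P f h where tri: "(P, Q, X, f, p, h) \<in> Triangles D" using cocone_exists[OF p] by blast
  note a = triangle_arr[OF tri]
  have Pob: "P \<in> Obj D" using arrD(1)[OF a(1)] .
  have QA: "Q \<in> Add D T" using Add_direct_sum[OF Q N] .
  \<comment> \<open>A map T -> P[1] becomes zero in Q[1], so it comes from \<open>X\<close>, hence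
    from \<open>Q\<close>, and is killed by \<open>h \<bullet> p = 0\<close>. Membership in add T is
    tested by such maps.\<close>
  have PA: "P \<in> Add D T"
  proof (rule cluster_tiltingD(3)[OF T Pob])
    fix \<phi> assume \<phi>: "arr \<phi> T (Shift D P)"
    note r = rotate[OF rotate[OF tri]] and r1 = rotate[OF tri]
    note a1 = triangle_arr[OF r1]
    have "(\<ominus>\<^bsub>Hm (Shift D P) (Shift D Q)\<^esub> (ShiftM D f)) \<bullet> \<phi> = \<zero>\<^bsub>Hm T (Shift D Q)\<^esub>"
      using cluster_tiltingD(2)[OF T QA arr_comp[OF \<phi> a1(3)]] .
    then obtain \<theta> where \<theta>: "arr \<theta> T X" "\<phi> = h \<bullet> \<theta>" using triangle_weak_kernel[OF r \<phi>] by blast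
    obtain \<rho> where \<rho>: "arr \<rho> T Q" "\<theta> = p \<bullet> \<rho>" using lift[OF \<theta>(1)] by blast
    show "\<phi> = \<zero>\<^bsub>Hm T (Shift D P)\<^esub>"
      unfolding \<theta>(2) \<rho>(2) using comp_assoc[OF \<rho>(1) a(2,3)] triangle_comp_zero[OF r1]
        comp_zero_left[OF \<rho>(1) shift_obj[OF Pob]] by simp
  qed
  have "zero_object D Q" if "Mor D T X = {\<zero>\<^bsub>Hm T X\<^esub>}"
    using bs(2)[OF that] Q direct_sum_Nil by simp
  then have "presentation T P Q X f p h" unfolding presentation_def using tri PA QA lift by blast
  then show ?thesis by blast
qed

section \<open>Vanishing of morphisms X -> Y[1] that factor through add T[1]\<close>

text \<open>\<open>ext_zero T X Y\<close> is \<open>[T[1]](X, Y[1]) = 0\<close>.\<close>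

definition ext_zero :: "'o \<Rightarrow> 'o \<Rightarrow> 'o \<Rightarrow> bool" where
  "ext_zero T X Y \<longleftrightarrow> (\<forall>Z a b. Z \<in> Add D (Shift D T) \<longrightarrow> arr a X Z \<longrightarrow> arr b Z (Shift D Y) \<longrightarrow>
     b \<bullet> a = \<zero>\<^bsub>Hm X (Shift D Y)\<^esub>)"

lemma ext_zeroD: "\<lbrakk>ext_zero T X Y; Z \<in> Add D (Shift D T); arr a X Z; arr b Z (Shift D Y)\<rbrakk>
    \<Longrightarrow> b \<bullet> a = \<zero>\<^bsub>Hm X (Shift D Y)\<^esub>"
  unfolding ext_zero_def by blast

lemma shift_rigid_ext_zero: "shift_rigid D T X \<Longrightarrow> ext_zero T X X"
  unfolding shift_rigid_def ext_zero_def factors_through_def arr_def by blast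

text \<open>A composite X -> Z -> Y[1] is enlarged to M -> Z -> N[1], where it vanishes;
  \<open>p\<close> is split epi and the shifted inclusion \<open>v\<close> is split mono, so both
  can be cancelled.\<close>

lemma ext_zero_retract:
  assumes E: "ext_zero T M N" and X: "retract X M" and Y: "retract Y N"
  shows "ext_zero T X Y"
  unfolding ext_zero_def
proof (intro allI impI)
  fix Z a b assume Z: "Z \<in> Add D (Shift D T)" and a: "arr a X Z" and b: "arr b Z (Shift D Y)"
  obtain u p where up: "arr u X M" "arr p M X" "p \<bullet> u = Id D X" using X unfolding retract_def by blast
  obtain v q where vq: "arr v (Shift D Y) (Shift D N)" "arr q (Shift D N) (Shift D Y)" "q \<bullet> v = Id D (Shift D Y)"
    using functor_retract[OF shift_functor Y] unfolding retract_def by blast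
  have ob: "Shift D N \<in> Obj D" "X \<in> Obj D" "M \<in> Obj D" using arrD(2)[OF vq(1)] arrD[OF up(1)] by blast+
  have ba: "arr (b \<bullet> a) X (Shift D Y)" using a b by blast
  have "(v \<bullet> b) \<bullet> (a \<bullet> p) = \<zero>\<^bsub>Hm M (Shift D N)\<^esub>"
    using ext_zeroD[OF E Z arr_comp[OF up(2) a] arr_comp[OF b vq(1)]] .
  then have "v \<bullet> ((b \<bullet> a) \<bullet> p) = \<zero>\<^bsub>Hm M (Shift D N)\<^esub>"
    using comp_assoc[OF arr_comp[OF up(2) a] b vq(1)] comp_assoc[OF up(2) a b] by simp
  moreover have "v \<bullet> \<zero>\<^bsub>Hm M (Shift D Y)\<^esub> = \<zero>\<^bsub>Hm M (Shift D N)\<^esub>" using comp_zero_right[OF vq(1) ob(3)] .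
  ultimately have "(b \<bullet> a) \<bullet> p = \<zero>\<^bsub>Hm M (Shift D Y)\<^esub>"
    using split_mono_cancel[OF vq arr_comp[OF up(2) ba] arr_zero[OF ob(3) arrD(2)[OF b]]] by simp
  moreover have "\<zero>\<^bsub>Hm X (Shift D Y)\<^esub> \<bullet> p = \<zero>\<^bsub>Hm M (Shift D Y)\<^esub>" using comp_zero_left[OF up(2) arrD(2)[OF b]] .
  ultimately show "b \<bullet> a = \<zero>\<^bsub>Hm X (Shift D Y)\<^esub>"
    using split_epi_cancel[OF up(2,1,3) ba arr_zero[OF ob(2) arrD(2)[OF b]]] by simp
qed

lemma ext_zero_Add:
  assumes E: "ext_zero T X M" and Y: "Y \<in> Add D M"
  shows "ext_zero T X Y"
  unfolding ext_zero_def
proof (intro allI impI)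
  fix Z a b assume Z: "Z \<in> Add D (Shift D T)" and a: "arr a X Z" and b: "arr b Z (Shift D Y)"
  show "b \<bullet> a = \<zero>\<^bsub>Hm X (Shift D Y)\<^esub>"
  proof (rule zero_on_Add_target[OF functor_Add[OF shift_functor Y] arr_comp[OF a b]])
    fix k assume k: "arr k (Shift D Y) (Shift D M)"
    show "k \<bullet> b \<bullet> a = \<zero>\<^bsub>Hm X (Shift D M)\<^esub>"
      using ext_zeroD[OF E Z a arr_comp[OF b k]] comp_assoc[OF a b k] by simp
  qed
qed

text \<open>The obstruction \<open>ShiftM D \<psi> \<bullet> h\<close> runs through P[1] in add T[1]
  and so vanishes. Hence \<open>ShiftM D \<psi>\<close> factors through -f[1], the map after
  \<open>h\<close> in the rotated triangle; the sign is absorbed into \<open>d\<close> and the shift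
  is removed by full faithfulness.\<close>

lemma extend_along_presentation:
  assumes E: "ext_zero T X Y" and pr: "presentation T P Q X f p h" and \<psi>: "arr \<psi> P Y"
  obtains \<phi> where "arr \<phi> Q Y" "\<psi> = \<phi> \<bullet> f"
proof -
  have tri: "(P, Q, X, f, p, h) \<in> Triangles D" and P: "P \<in> Add D T" using pr by (auto simp: presentation_def)
  note a = triangle_arr[OF tri] and r = rotate[OF rotate[OF tri]]
  have S\<psi>: "arr (ShiftM D \<psi>) (Shift D P) (Shift D Y)" using shift_arr[OF \<psi>] .
  have Sf: "arr (ShiftM D f) (Shift D P) (Shift D Q)" using shift_arr[OF a(1)] .
  have "ShiftM D \<psi> \<bullet> h = \<zero>\<^bsub>Hm X (Shift D Y)\<^esub>"
    using ext_zeroD[OF E functor_Add[OF shift_functor P] a(3) S\<psi>] .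
  then obtain c where c: "arr c (Shift D Q) (Shift D Y)"
      "ShiftM D \<psi> = c \<bullet> (\<ominus>\<^bsub>Hm (Shift D P) (Shift D Q)\<^esub> (ShiftM D f))"
    using triangle_weak_cokernel[OF r S\<psi>] by blast
  have ob: "Q \<in> Obj D" "Y \<in> Obj D" using arrD(2)[OF a(1)] arrD(2)[OF \<psi>] .
  obtain d where d: "arr d Q Y" "ShiftM D d = \<ominus>\<^bsub>Hm (Shift D Q) (Shift D Y)\<^esub> c"
    using shift_full[OF arr_neg[OF c(1)] ob] by blast
  have "ShiftM D \<psi> = ShiftM D d \<bullet> ShiftM D f"
    unfolding d(2) c(2) using comp_neg_right[OF Sf c(1)] comp_neg_left[OF Sf c(1)] by simp
  also have "\<dots> = ShiftM D (d \<bullet> f)" using shift_comp[OF a(1) d(1)] by simp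
  finally have "\<psi> = d \<bullet> f" using shift_faithful[OF \<psi> arr_comp[OF a(1) d(1)]] by blast
  then show ?thesis using that d(1) by blast
qed

text \<open>Splitting both arguments reduces the claim to Hom(T[1], T[2]), which the shift
  identifies with Hom(T, T[1]) = 0.\<close>

lemma shift_Add_orthogonal:
  assumes T: "cluster_tilting D T" and Z: "Z \<in> Add D (Shift D T)" "Z' \<in> Add D (Shift D T)"
    and f: "arr f Z (Shift D Z')"
  shows "f = \<zero>\<^bsub>Hm Z (Shift D Z')\<^esub>"
proof (rule zero_on_Add_target[OF functor_Add[OF shift_functor Z(2)] f])
  fix k assume k: "arr k (Shift D Z') (Shift D (Shift D T))"
  obtain N where N: "zero_object D N" using zero_object_exists by blast
  have Tob: "T \<in> Obj D" using cluster_tiltingD(1)[OF T] .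
  have TA: "T \<in> Add D T" using Add_self[OF Tob N] .
  show "k \<bullet> f = \<zero>\<^bsub>Hm Z (Shift D (Shift D T))\<^esub>"
  proof (rule zero_on_Add_source[OF Z(1) arr_comp[OF f k]])
    fix g assume g: "arr g (Shift D T) (Shift D (Shift D T))"
    obtain g' where g': "arr g' T (Shift D T)" "ShiftM D g' = g"
      using shift_full[OF g Tob shift_obj[OF Tob]] by blast
    have "g' = \<zero>\<^bsub>Hm T (Shift D T)\<^esub>" using cluster_tiltingD(2)[OF T TA g'(1)] .
    then show "g = \<zero>\<^bsub>Hm (Shift D T) (Shift D (Shift D T))\<^esub>"
      using g'(2) shift_zero[OF Tob shift_obj[OF Tob]] by simp
  qed
qed

text \<open>\<open>b\<close> lifts because \<eta>[1] factors through add T[2], to which add T[1] has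
  no nonzero maps. The lift ends in M'[1] with M' in add M, whence
  \<open>ext_zero_Add\<close>.\<close>

lemma star_shift_ext_zero:
  assumes T: "cluster_tilting D T" and M: "ext_zero T M M" and N: "N \<in> star_shift D T M"
  shows "ext_zero T M N"
  unfolding ext_zero_def
proof (intro allI impI)
  fix Z a b assume Z: "Z \<in> Add D (Shift D T)" and a: "arr a M Z" and b: "arr b Z (Shift D N)"
  obtain M' E f \<eta> h where M': "M' \<in> Add D M" and tri: "(M', N, E, f, \<eta>, h) \<in> Triangles D"
    and \<eta>: "\<eta> \<in> factors_through D (Shift D T) N E"
    using N unfolding star_shift_def by blast
  note ar = triangle_arr[OF tri]
  have ob: "N \<in> Obj D" "E \<in> Obj D" using arrD[OF ar(2)] by blast+
  obtain g1 g2 W where W: "\<eta> = g2 \<bullet> g1" "W \<in> Add D (Shift D T)" "arr g1 N W" "arr g2 W E"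
    using \<eta> ob Add_obj unfolding factors_through_def arr_def by blast
  have Sg: "arr (ShiftM D g1) (Shift D N) (Shift D W)" "arr (ShiftM D g2) (Shift D W) (Shift D E)"
    using shift_arr W by blast+
  have "ShiftM D g1 \<bullet> b = \<zero>\<^bsub>Hm Z (Shift D W)\<^esub>"
    using shift_Add_orthogonal[OF T Z W(2) arr_comp[OF b Sg(1)]] .
  then have "ShiftM D \<eta> \<bullet> b = \<zero>\<^bsub>Hm Z (Shift D E)\<^esub>"
    unfolding W(1) using shift_comp[OF W(3,4)] comp_assoc[OF b Sg] comp_zero_right[OF Sg(2) arrD(1)[OF b]] by simp
  moreover have S\<eta>: "arr (ShiftM D \<eta>) (Shift D N) (Shift D E)" using shift_arr[OF ar(2)] .
  ultimately have z: "(\<ominus>\<^bsub>Hm (Shift D N) (Shift D E)\<^esub> ShiftM D \<eta>) \<bullet> b = \<zero>\<^bsub>Hm Z (Shift D E)\<^esub>"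
    using comp_neg_left[OF b S\<eta>] neg_eqI[OF arr_zero arr_zero, of Z "Shift D E"] add_zero_left[OF arr_zero, of Z "Shift D E"]
      arrD(1)[OF b] shift_obj[OF ob(2)] by simp
  \<comment> \<open>Three rotations give the shifted triangle with all signs reversed; its first two
    maps are -f[1] and -\<eta>[1].\<close>
  obtain c where c: "arr c Z (Shift D M')" "b = (\<ominus>\<^bsub>Hm (Shift D M') (Shift D N)\<^esub> ShiftM D f) \<bullet> c"
    using triangle_weak_kernel[OF rotate[OF rotate[OF rotate[OF tri]]] b z] by blast
  have nf: "arr (\<ominus>\<^bsub>Hm (Shift D M') (Shift D N)\<^esub> ShiftM D f) (Shift D M') (Shift D N)"
    using arr_neg[OF shift_arr[OF ar(1)]] .
  have "c \<bullet> a = \<zero>\<^bsub>Hm M (Shift D M')\<^esub>" using ext_zeroD[OF ext_zero_Add[OF M M'] Z a c(1)] .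
  then show "b \<bullet> a = \<zero>\<^bsub>Hm M (Shift D N)\<^esub>"
    unfolding c(2) using comp_assoc[OF a c(1) nf] comp_zero_right[OF nf arrD(1)[OF a]] by simp
qed

text \<open>The triangle N = N -> 0 serves, as its second map factors through a zero object and thus
  through add T[1].\<close>

lemma star_shift_self:
  assumes N: "N \<in> Obj D"
  shows "N \<in> star_shift D T N"
proof -
  obtain O' where O': "zero_object D O'" using zero_object_exists by blast
  have ob: "O' \<in> Obj D" using zero_objectD(1)[OF O'] .
  have "\<zero>\<^bsub>Hm N O'\<^esub> = Id D O' \<bullet> \<zero>\<^bsub>Hm N O'\<^esub>" using comp_id_left[OF arr_zero[OF N ob]] by simp
  then have "\<zero>\<^bsub>Hm N O'\<^esub> \<in> factors_through D (Shift D T) N O'"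
    unfolding factors_through_def
    using Add_zero[OF O'] arrD(3)[OF arr_zero[OF N ob]] Id_in[OF ob] by blast
  then show ?thesis
    unfolding star_shift_def using N Add_self[OF N O'] TR1_id[OF N O'] by blast
qed

lemma star_shift_iso: "(M, N) \<in> iso_rel D \<Longrightarrow> star_shift D T M \<subseteq> star_shift D T N"
  using Add_iso[of M N] unfolding star_shift_def by blast

text \<open>Here \<open>Q\<close> is zero, so \<open>h\<close> acquires a left inverse from the weak
  cokernel property (everything from \<open>Q\<close> vanishes) and a right inverse from the weak
  kernel property (everything to Q[1] vanishes).\<close>

lemma presentation_zero_iso:
  assumes pr: "presentation T P Q X f p h" and X: "Mor D T X = {\<zero>\<^bsub>Hm T X\<^esub>}"
  shows "(X, Shift D P) \<in> iso_rel D"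
proof -
  have tri: "(P, Q, X, f, p, h) \<in> Triangles D" and Q: "zero_object D Q"
    using pr X by (auto simp: presentation_def)
  note a = triangle_arr[OF tri] and r = rotate[OF tri]
  have Xob: "X \<in> Obj D" and SPob: "Shift D P \<in> Obj D" using arrD[OF a(3)] by blast+
  have Qob: "Q \<in> Obj D" using arrD(1)[OF a(2)] .
  have "Id D X \<bullet> p = \<zero>\<^bsub>Hm Q X\<^esub>" using zero_objectD(4)[OF Q a(2)] a(2) by simp
  then obtain c where c: "arr c (Shift D P) X" "Id D X = c \<bullet> h"
    using triangle_weak_cokernel[OF r arr_id[OF Xob]] by blast
  have SQ: "zero_object D (Shift D Q)"
    using zero_objectI[OF shift_obj[OF Qob]] zero_objectD(2)[OF Q] shift_id[OF Qob] shift_zero[OF Qob Qob] by simp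
  have nf: "arr (\<ominus>\<^bsub>Hm (Shift D P) (Shift D Q)\<^esub> ShiftM D f) (Shift D P) (Shift D Q)"
    using arr_neg[OF shift_arr[OF a(1)]] .
  have "(\<ominus>\<^bsub>Hm (Shift D P) (Shift D Q)\<^esub> ShiftM D f) \<bullet> Id D (Shift D P) = \<zero>\<^bsub>Hm (Shift D P) (Shift D Q)\<^esub>"
    using zero_objectD(3)[OF SQ nf] nf by simp
  then obtain d where d: "arr d (Shift D P) X" "Id D (Shift D P) = h \<bullet> d"
    using triangle_weak_kernel[OF rotate[OF r] arr_id[OF SPob]] by blast
  have "c = d"
  proof -
    have "c = c \<bullet> (h \<bullet> d)" using d(2) comp_id_right[OF c(1)] by simp
    also have "\<dots> = (c \<bullet> h) \<bullet> d" using comp_assoc[OF d(1) a(3) c(1)] by simp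
    also have "\<dots> = d" using c(2) comp_id_left[OF d(1)] by simp
    finally show ?thesis .
  qed
  then show ?thesis using iso_relI[OF a(3) c(1)] c(2) d(2) by simp
qed

end

section \<open>Dimensions of subfunctors of representable functors\<close>

text \<open>Gaussian elimination without division: with a pivot \<open>c k i\<close>,
  cross-multiplication eliminates the coordinate \<open>i\<close> from the remaining vectors and
  keeps the coefficients integral.\<close>

lemma integer_dependency:
  fixes c :: "'j \<Rightarrow> 'i \<Rightarrow> int"
  assumes "finite I" "finite J" "card I < card J"
  shows "\<exists>a. (\<exists>j\<in>J. a j \<noteq> 0) \<and> (\<forall>i\<in>I. (\<Sum>j\<in>J. a j * c j i) = 0)"
  using assms
proof (induct I arbitrary: J c rule: finite_induct)
  case empty
  then obtain j where "j \<in> J" by fastforce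
  then show ?case by (intro exI[of _ "\<lambda>_. 1"]) auto
next
  case (insert i I)
  show ?case
  proof (cases "\<forall>j\<in>J. c j i = 0")
    case True
    have "card I < card J" using insert by simp
    then show ?thesis using insert.hyps(3)[OF insert.prems(1)] True by simp
  next
    case False
    then obtain k where k: "k \<in> J" "c k i \<noteq> 0" by blast
    define J' where "J' = J - {k}"
    have J': "finite J'" "k \<notin> J'" "J = insert k J'" using k insert.prems(1) by (auto simp: J'_def)
    have "card I < card J'" using insert J' by simp
    then obtain a where a: "\<exists>j\<in>J'. a j \<noteq> 0"
      "\<And>i'. i' \<in> I \<Longrightarrow> (\<Sum>j\<in>J'. a j * (c k i * c j i' - c j i * c k i')) = 0"
      using insert.hyps(3)[OF J'(1), of "\<lambda>j i'. c k i * c j i' - c j i * c k i'"] by blast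
    \<comment> \<open>A relation \<open>a\<close> among the eliminated vectors is scaled by the
      pivot, which keeps it nonzero; the coefficient at \<open>k\<close> is the one that makes
      coordinate \<open>i\<close> cancel.\<close>
    define b where "b j = (if j = k then - (\<Sum>j\<in>J'. a j * c j i) else c k i * a j)" for j
    have sum: "(\<Sum>j\<in>J. b j * c j i') = (\<Sum>j\<in>J'. a j * (c k i * c j i' - c j i * c k i'))" for i'
    proof -
      have "(\<Sum>j\<in>J'. b j * c j i') = (\<Sum>j\<in>J'. c k i * a j * c j i')"
        using J'(2) by (intro sum.cong) (auto simp: b_def)
      then have "(\<Sum>j\<in>J. b j * c j i') = - (\<Sum>j\<in>J'. a j * c j i) * c k i' + (\<Sum>j\<in>J'. c k i * a j * c j i')"
        using J' by (simp add: b_def)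
      also have "\<dots> = (\<Sum>j\<in>J'. a j * (c k i * c j i' - c j i * c k i'))"
        by (simp add: sum_distrib_left sum_distrib_right right_diff_distrib sum_subtractf mult.assoc mult.left_commute mult.commute)
      finally show ?thesis .
    qed
    have "(\<Sum>j\<in>J. b j * c j i) = 0" unfolding sum by (simp add: mult.commute)
    moreover have "(\<Sum>j\<in>J. b j * c j i') = 0" if "i' \<in> I" for i' unfolding sum using a(2) that by blast
    moreover have "\<exists>j\<in>J. b j \<noteq> 0" using a(1) k J' by (auto simp: b_def)
    ultimately show ?thesis by blast
  qed
qed

section \<open>Dimensions of nested subspaces\<close>

context vectorspace
begin

lemma subspace_lin_indpt:
  assumes "subspace K W V" "A \<subseteq> W"
  shows "LinearCombinations.module.lin_indpt K (vs W) A \<longleftrightarrow> lin_indpt A" "LinearCombinations.module.span K (vs W) A = span A"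
  using assms span_li_not_depend[of A W] by (auto simp: subspace_def)

text \<open>Independent sets of \<open>W\<close> are independent in \<open>V\<close> and hence
  bounded in size, so a maximal one exists; it is a basis.\<close>

lemma subspace_fin_dim:
  assumes fin: "fin_dim" and W: "subspace K W V"
  shows "vectorspace.fin_dim K (vs W)"
proof -
  interpret W: vectorspace K "vs W" using subspace_is_vs[OF W] .
  have sub: "W \<subseteq> carrier V" using W by (simp add: subspace_def submodule_def)
  let ?P = "\<lambda>S. S \<subseteq> carrier (vs W) \<and> W.lin_indpt S"
  have bound: "finite A \<and> card A \<le> dim" if A: "?P A" for A
  proof -
    have "A \<subseteq> carrier V" "lin_indpt A" using A sub subspace_lin_indpt[OF W] by auto
    then show ?thesis using li_le_dim[OF fin] by blast
  qed
  have "?P {}" by (auto simp: W.lin_dep_def)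
  then obtain A where A: "finite A" "maximal A ?P" using maximal_exists[of ?P, OF bound] by blast
  then have "W.basis A" using W.max_li_is_basis by blast
  then show ?thesis using A(1) unfolding W.fin_dim_def W.basis_def by blast
qed

text \<open>A basis of \<open>W1\<close> remains independent in \<open>W2\<close>, and it is a basis
  of \<open>W2\<close> as soon as its size is the dimension of \<open>W2\<close>.\<close>

lemma nested_subspace_dim:
  assumes fin: "fin_dim" and W1: "subspace K W1 V" and W2: "subspace K W2 V" and sub: "W1 \<subseteq> W2"
  shows "vectorspace.dim K (vs W1) \<le> vectorspace.dim K (vs W2)"
    "vectorspace.dim K (vs W1) = vectorspace.dim K (vs W2) \<Longrightarrow> W1 = W2"
proof -
  interpret W1: vectorspace K "vs W1" using subspace_is_vs[OF W1] .
  interpret W2: vectorspace K "vs W2" using subspace_is_vs[OF W2] .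
  have f1: "W1.fin_dim" and f2: "W2.fin_dim" using subspace_fin_dim fin W1 W2 by blast+
  obtain b where b: "finite b" "W1.basis b" using W1.finite_basis_exists[OF f1] by blast
  then have b1: "W1.lin_indpt b" "W1.gen_set b" "b \<subseteq> W1" by (auto simp: W1.basis_def)
  have b2: "b \<subseteq> W2" using b1 sub by blast
  have li2: "W2.lin_indpt b" using b1 subspace_lin_indpt[OF W1 b1(3)] subspace_lin_indpt[OF W2 b2] by blast
  have card: "card b = W1.dim" using W1.dim_basis[OF b] by simp
  show "W1.dim \<le> W2.dim" using W2.li_le_dim(2)[OF f2 _ li2] b2 card by simp
  show "W1 = W2" if "W1.dim = W2.dim"
  proof -
    have "W2.basis b" using W2.dim_li_is_basis[OF f2 b(1) _ li2] b2 card that by simp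
    then have "W2.span b = W2" by (simp add: W2.basis_def)
    moreover have "W1.span b = W1" using b1(2) by simp
    ultimately show ?thesis
      using subspace_lin_indpt(2)[OF W1 b1(3)] subspace_lin_indpt(2)[OF W2 b2] by simp
  qed
qed

end

context klinear_category
begin

text \<open>Stated with \<open>arr\<close> to fit the arithmetic of morphisms; since zero belongs to
  \<open>W\<close>, the clause on \<open>arr\<close> also yields that \<open>A\<close> and
  \<open>B\<close> are objects.\<close>

definition hom_subspace :: "'o \<Rightarrow> 'o \<Rightarrow> 'm set \<Rightarrow> bool" where
  "hom_subspace A B W \<longleftrightarrow> (\<forall>f\<in>W. arr f A B) \<and> \<zero>\<^bsub>Hm A B\<^esub> \<in> W \<and>
     (\<forall>f\<in>W. \<forall>g\<in>W. f \<oplus>\<^bsub>Hm A B\<^esub> g \<in> W) \<and> (\<forall>c\<in>carrier K. \<forall>f\<in>W. c \<odot>\<^bsub>Hm A B\<^esub> f \<in> W)"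

text \<open>\<open>A\<close> and \<open>B\<close> are arguments because the operations on
  \<open>W\<close> are those of Hom(A, B), which \<open>W\<close> as a bare set does not
  determine.\<close>

definition hom_dim :: "'o \<Rightarrow> 'o \<Rightarrow> 'm set \<Rightarrow> nat" where
  "hom_dim A B W = vectorspace.dim K ((Hm A B)\<lparr>carrier := W\<rparr>)"

lemma hom_subspace_obj: "hom_subspace A B W \<Longrightarrow> A \<in> Obj C \<and> B \<in> Obj C"
  unfolding hom_subspace_def using arrD by blast

lemma hom_subspace_subspace: "hom_subspace A B W \<Longrightarrow> subspace K W (Hm A B)"
  using hom_subspace_obj[of A B W] hom_vectorspace[of A B] hom_module[of A B]
  unfolding subspace_def submodule_def hom_subspace_def by (auto dest: arrD(3))

lemma hom_subspace_UNIV: "\<lbrakk>A \<in> Obj C; B \<in> Obj C\<rbrakk> \<Longrightarrow> hom_subspace A B (Mor C A B)"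
  unfolding hom_subspace_def
  using arr_zero[of A B] arr_add[of _ A B] arr_smult[of _ _ A B] by (auto simp: arr_def)

lemma hom_subspace_zero:
  assumes "A \<in> Obj C" "B \<in> Obj C"
  shows "hom_subspace A B {\<zero>\<^bsub>Hm A B\<^esub>}" "hom_dim A B {\<zero>\<^bsub>Hm A B\<^esub>} = 0"
proof -
  interpret V: vectorspace K "Hm A B" using hom_vectorspace assms by blast
  show s: "hom_subspace A B {\<zero>\<^bsub>Hm A B\<^esub>}"
    unfolding hom_subspace_def using assms arr_zero by auto
  interpret W: vectorspace K "V.vs {\<zero>\<^bsub>Hm A B\<^esub>}" using V.subspace_is_vs[OF hom_subspace_subspace[OF s]] .
  have "W.gen_set {\<zero>\<^bsub>V.vs {\<zero>\<^bsub>Hm A B\<^esub>}\<^esub>}"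
    using W.span_is_subset2[of "{\<zero>\<^bsub>Hm A B\<^esub>}"] W.in_own_span[of "{\<zero>\<^bsub>Hm A B\<^esub>}"] by auto
  then show "hom_dim A B {\<zero>\<^bsub>Hm A B\<^esub>} = 0" unfolding hom_dim_def by (rule W.dim0I)
qed

lemma hom_dim_mono:
  assumes fin: "hom_finite K C" and W: "hom_subspace A B W1" "hom_subspace A B W2" "W1 \<subseteq> W2"
  shows "hom_dim A B W1 \<le> hom_dim A B W2" "hom_dim A B W1 = hom_dim A B W2 \<Longrightarrow> W1 = W2"
proof -
  have ob: "A \<in> Obj C" "B \<in> Obj C" using hom_subspace_obj W by blast+
  interpret V: vectorspace K "Hm A B" using hom_vectorspace ob by blast
  have "V.fin_dim" using fin ob by (simp add: hom_finite_def)
  note * = V.nested_subspace_dim[OF this hom_subspace_subspace[OF W(1)] hom_subspace_subspace[OF W(2)] W(3)]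
  show "hom_dim A B W1 \<le> hom_dim A B W2" "hom_dim A B W1 = hom_dim A B W2 \<Longrightarrow> W1 = W2"
    using * by (simp_all add: hom_dim_def)
qed

text \<open>Isomorphism invariance, additivity over direct sums and the count along a presentation
  all come from this instance of rank-nullity, for different \<open>f\<close> and
  \<open>W\<close>.\<close>

lemma precomp_rank_nullity:
  assumes fin: "hom_finite K C" and W: "hom_subspace B Y W" and f: "arr f A B"
  shows "hom_dim B Y W = hom_dim A Y ((\<lambda>\<phi>. \<phi> \<bullet> f) ` W) + hom_dim B Y {\<phi> \<in> W. \<phi> \<bullet> f = \<zero>\<^bsub>Hm A Y\<^esub>}"
proof -
  have ob: "A \<in> Obj C" "B \<in> Obj C" "Y \<in> Obj C" using hom_subspace_obj[OF W] arrD[OF f] by blast+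
  interpret V: vectorspace K "Hm B Y" using hom_vectorspace ob by blast
  interpret VA: vectorspace K "Hm A Y" using hom_vectorspace ob by blast
  have sub: "subspace K W (Hm B Y)" using hom_subspace_subspace[OF W] .
  interpret W: vectorspace K "V.vs W" using V.subspace_is_vs[OF sub] .
  have "V.fin_dim" using fin ob by (simp add: hom_finite_def)
  then have Wfin: "W.fin_dim" using V.subspace_fin_dim sub by blast
  have Warr: "\<And>\<phi>. \<phi> \<in> W \<Longrightarrow> arr \<phi> B Y" using W by (simp add: hom_subspace_def)
  have "(\<lambda>\<phi>. \<phi> \<bullet> f) \<in> module_hom K (V.vs W) (Hm A Y)"
    unfolding module_hom_def
    using comp_add_left[OF f Warr Warr] comp_smult_left[OF f Warr] arrD(3)[OF arr_comp[OF f Warr]] by auto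
  then interpret L: linear_map K "V.vs W" "Hm A Y" "\<lambda>\<phi>. \<phi> \<bullet> f"
    by unfold_locales
  have "L.ker = {\<phi> \<in> W. \<phi> \<bullet> f = \<zero>\<^bsub>Hm A Y\<^esub>}" "L.im = (\<lambda>\<phi>. \<phi> \<bullet> f) ` W"
    by (auto simp: L.ker_def L.im_def)
  then show ?thesis using L.rank_nullity[OF Wfin] by (simp add: hom_dim_def)
qed

definition subfunctor :: "('o \<Rightarrow> 'm set) \<Rightarrow> 'o \<Rightarrow> bool" where
  "subfunctor I Y \<longleftrightarrow> (\<forall>Z\<in>Obj C. hom_subspace Z Y (I Z)) \<and>
     (\<forall>f Z Z' \<phi>. arr f Z Z' \<longrightarrow> \<phi> \<in> I Z' \<longrightarrow> \<phi> \<bullet> f \<in> I Z)"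

lemma subfunctorD:
  assumes "subfunctor I Y"
  shows "Z \<in> Obj C \<Longrightarrow> hom_subspace Z Y (I Z)" "arr f Z Z' \<Longrightarrow> \<phi> \<in> I Z' \<Longrightarrow> \<phi> \<bullet> f \<in> I Z"
    "Z \<in> Obj C \<Longrightarrow> \<phi> \<in> I Z \<Longrightarrow> arr \<phi> Z Y"
  using assms unfolding subfunctor_def hom_subspace_def by blast+

lemma subfunctor_Hom: "Y \<in> Obj C \<Longrightarrow> subfunctor (\<lambda>Z. Mor C Z Y) Y"
  unfolding subfunctor_def
proof (intro conjI ballI allI impI)
  assume Y: "Y \<in> Obj C"
  show "hom_subspace Z Y (Mor C Z Y)" if "Z \<in> Obj C" for Z using hom_subspace_UNIV[OF that Y] .
  show "\<phi> \<bullet> f \<in> Mor C Z Y" if f: "arr f Z Z'" and \<phi>: "\<phi> \<in> Mor C Z' Y" for f Z Z' \<phi>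
    using arrD(3)[OF arr_comp[OF f]] \<phi> arrD(2)[OF f] Y by (simp add: arr_def)
qed

text \<open>Precomposition with an isomorphism maps \<open>I Z'\<close> onto \<open>I Z\<close> with
  zero kernel.\<close>

lemma subfunctor_dim_iso:
  assumes fin: "hom_finite K C" and I: "subfunctor I Y" and iso: "(Z, Z') \<in> iso_rel C"
  shows "hom_dim Z Y (I Z) = hom_dim Z' Y (I Z')"
proof -
  obtain a b where ab: "arr a Z Z'" "arr b Z' Z" "b \<bullet> a = Id C Z" "a \<bullet> b = Id C Z'" using iso by (rule iso_relE)
  have ob: "Z \<in> Obj C" "Z' \<in> Obj C" using arrD[OF ab(1)] by blast+
  have Iarr: "\<And>\<phi>. \<phi> \<in> I Z \<Longrightarrow> arr \<phi> Z Y" "\<And>\<phi>. \<phi> \<in> I Z' \<Longrightarrow> arr \<phi> Z' Y"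
    using subfunctorD(3)[OF I] ob by blast+
  have Y: "Y \<in> Obj C" and z: "\<zero>\<^bsub>Hm Z' Y\<^esub> \<in> I Z'"
    using subfunctorD(1)[OF I ob(2)] hom_subspace_obj[of Z' Y "I Z'"] by (auto simp: hom_subspace_def)
  have im: "(\<lambda>\<phi>. \<phi> \<bullet> a) ` I Z' = I Z"
  proof
    show "(\<lambda>\<phi>. \<phi> \<bullet> a) ` I Z' \<subseteq> I Z" using subfunctorD(2)[OF I ab(1)] by blast
    show "I Z \<subseteq> (\<lambda>\<phi>. \<phi> \<bullet> a) ` I Z'"
    proof
      fix \<phi> assume \<phi>: "\<phi> \<in> I Z"
      then have "\<phi> = (\<phi> \<bullet> b) \<bullet> a" using comp_assoc[OF ab(1,2) Iarr(1)[OF \<phi>]] ab(3) Iarr(1)[OF \<phi>] by simp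
      then show "\<phi> \<in> (\<lambda>\<phi>. \<phi> \<bullet> a) ` I Z'" using subfunctorD(2)[OF I ab(2) \<phi>] by blast
    qed
  qed
  have ker: "{\<phi> \<in> I Z'. \<phi> \<bullet> a = \<zero>\<^bsub>Hm Z Y\<^esub>} = {\<zero>\<^bsub>Hm Z' Y\<^esub>}"
  proof -
    have "\<phi> = \<zero>\<^bsub>Hm Z' Y\<^esub>" if "\<phi> \<in> I Z'" "\<phi> \<bullet> a = \<zero>\<^bsub>Hm Z Y\<^esub>" for \<phi>
      using split_epi_cancel[OF ab(1,2,4) Iarr(2)[OF that(1)] arr_zero[OF ob(2) Y]] that(2)
        comp_zero_left[OF ab(1) Y] by simp
    then show ?thesis using z comp_zero_left[OF ab(1) Y] by blast
  qed
  show ?thesis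
    using precomp_rank_nullity[OF fin subfunctorD(1)[OF I ob(2)] ab(1)] im ker hom_subspace_zero(2)[OF ob(2) Y] by simp
qed

lemma subfunctor_dim_direct_sum:
  assumes fin: "hom_finite K C" and I: "subfunctor I Y" and S: "direct_sum C Zs S"
  shows "hom_dim S Y (I S) = (\<Sum>i<length Zs. hom_dim (Zs ! i) Y (I (Zs ! i)))"
proof -
  let ?n = "length Zs"
  obtain u p where up: "S \<in> Obj C" "\<And>i. i < ?n \<Longrightarrow> Zs ! i \<in> Obj C"
    "\<And>i. i < ?n \<Longrightarrow> arr (u i) (Zs ! i) S" "\<And>i. i < ?n \<Longrightarrow> arr (p i) S (Zs ! i)"
    "\<And>i. i < ?n \<Longrightarrow> p i \<bullet> u i = Id C (Zs ! i)"
    "\<And>i j. \<lbrakk>i < ?n; j < ?n; i \<noteq> j\<rbrakk> \<Longrightarrow> p i \<bullet> u j = \<zero>\<^bsub>Hm (Zs ! j) (Zs ! i)\<^esub>"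
    "(\<Oplus>\<^bsub>Hm S S\<^esub>i\<in>{..<?n}. u i \<bullet> p i) = Id C S"
    using direct_sumE[OF S] by blast
  have IS: "hom_subspace S Y (I S)" using subfunctorD(1)[OF I up(1)] .
  have Y: "Y \<in> Obj C" using hom_subspace_obj[OF IS] by blast
  have Sarr: "\<And>\<phi>. \<phi> \<in> I S \<Longrightarrow> arr \<phi> S Y" using subfunctorD(3)[OF I up(1)] .
  \<comment> \<open>The successive quotients of this filtration are the values of \<open>I\<close> at the summands.\<close>
  define F where "F m = {\<phi> \<in> I S. \<forall>i<m. \<phi> \<bullet> u i = \<zero>\<^bsub>Hm (Zs ! i) Y\<^esub>}" for m
  have Fsub: "hom_subspace S Y (F m)" if m: "m \<le> ?n" for m
    unfolding hom_subspace_def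
  proof (intro conjI ballI)
    have uim: "arr (u i) (Zs ! i) S" and ob: "Zs ! i \<in> Obj C" if "i < m" for i using up(2,3) m that by auto
    show "arr f S Y" if "f \<in> F m" for f using that Sarr by (simp add: F_def)
    show "\<zero>\<^bsub>Hm S Y\<^esub> \<in> F m" using IS comp_zero_left[OF uim Y] by (auto simp: F_def hom_subspace_def)
    fix f assume f: "f \<in> F m"
    show "f \<oplus>\<^bsub>Hm S Y\<^esub> g \<in> F m" if g: "g \<in> F m" for g
      using f g IS comp_add_left[OF uim Sarr Sarr] add_zero_left[OF arr_zero[OF ob Y]]
      by (auto simp: F_def hom_subspace_def)
    show "c \<odot>\<^bsub>Hm S Y\<^esub> f \<in> F m" if c: "c \<in> carrier K" for c
    proof -
      have "c \<odot>\<^bsub>Hm (Zs ! i) Y\<^esub> \<zero>\<^bsub>Hm (Zs ! i) Y\<^esub> = \<zero>\<^bsub>Hm (Zs ! i) Y\<^esub>" if "i < m" for i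
        using module.smult_r_null[OF hom_module[OF ob[OF that] Y] c] .
      then show ?thesis
        using f c IS comp_smult_left[OF uim Sarr c] by (auto simp: F_def hom_subspace_def)
    qed
  qed
  have step: "hom_dim S Y (F m) = hom_dim (Zs ! m) Y (I (Zs ! m)) + hom_dim S Y (F (Suc m))" if m: "m < ?n" for m
  proof -
    have im: "(\<lambda>\<phi>. \<phi> \<bullet> u m) ` F m = I (Zs ! m)"
    proof
      show "(\<lambda>\<phi>. \<phi> \<bullet> u m) ` F m \<subseteq> I (Zs ! m)" using subfunctorD(2)[OF I up(3)[OF m]] by (auto simp: F_def)
      show "I (Zs ! m) \<subseteq> (\<lambda>\<phi>. \<phi> \<bullet> u m) ` F m"
      proof
        fix \<psi> assume \<psi>: "\<psi> \<in> I (Zs ! m)"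
        have a\<psi>: "arr \<psi> (Zs ! m) Y" using subfunctorD(3)[OF I up(2)[OF m] \<psi>] .
        have eq: "(\<psi> \<bullet> p m) \<bullet> u i = \<psi> \<bullet> (p m \<bullet> u i)" if "i < ?n" for i
          using comp_assoc[OF up(3)[OF that] up(4)[OF m] a\<psi>] .
        have "\<psi> \<bullet> p m \<in> F m"
          using subfunctorD(2)[OF I up(4)[OF m] \<psi>] eq up(6)[OF m] comp_zero_right[OF a\<psi> up(2)] m by (auto simp: F_def)
        moreover have "\<psi> = (\<psi> \<bullet> p m) \<bullet> u m" using eq[OF m] up(5)[OF m] a\<psi> by simp
        ultimately show "\<psi> \<in> (\<lambda>\<phi>. \<phi> \<bullet> u m) ` F m" by blast
      qed
    qed
    have ker: "{\<phi> \<in> F m. \<phi> \<bullet> u m = \<zero>\<^bsub>Hm (Zs ! m) Y\<^esub>} = F (Suc m)" by (auto simp: F_def less_Suc_eq)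
    show ?thesis using precomp_rank_nullity[OF fin Fsub up(3)[OF m]] m im ker by simp
  qed
  have filt: "hom_dim S Y (I S) = (\<Sum>i<m. hom_dim (Zs ! i) Y (I (Zs ! i))) + hom_dim S Y (F m)" if "m \<le> ?n" for m
    using that
  proof (induct m)
    case 0
    then show ?case by (simp add: F_def)
  next
    case (Suc m)
    then show ?case using step[of m] by simp
  qed
  have "F ?n = {\<zero>\<^bsub>Hm S Y\<^esub>}"
  proof -
    have "\<phi> = \<zero>\<^bsub>Hm S Y\<^esub>" if \<phi>: "\<phi> \<in> F ?n" for \<phi>
    proof -
      have a\<phi>: "arr \<phi> S Y" using \<phi> Sarr by (simp add: F_def)
      have "\<phi> \<bullet> Id C S = (\<Oplus>\<^bsub>Hm S Y\<^esub>i\<in>{..<?n}. (\<phi> \<bullet> u i) \<bullet> (p i \<bullet> Id C S))"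
        by (rule direct_sum_comp[OF up(3,4,7) arr_id[OF up(1)] a\<phi>])
      also have "\<dots> = \<zero>\<^bsub>Hm S Y\<^esub>"
        using \<phi> comp_zero_left[OF up(4) Y] comp_id_right[OF up(4)] up(1) Y by (intro finsum_arr_zero) (auto simp: F_def)
      finally show ?thesis using a\<phi> by simp
    qed
    moreover have "\<zero>\<^bsub>Hm S Y\<^esub> \<in> F ?n" using Fsub[of ?n] by (simp add: hom_subspace_def)
    ultimately show ?thesis by blast
  qed
  then show ?thesis using filt[of ?n] hom_subspace_zero(2)[OF up(1) Y] by simp
qed

text \<open>The ideal of morphisms generated by the objects in \<open>Xs\<close>. Sums are built one
  composite at a time, so that closure, extension along a presentation and the Nakayama argument are
  inductions on the terms.\<close>

inductive_set through :: "'o set \<Rightarrow> 'o \<Rightarrow> 'o \<Rightarrow> 'm set" for Xs A B where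
  through_zero: "\<lbrakk>A \<in> Obj C; B \<in> Obj C\<rbrakk> \<Longrightarrow> \<zero>\<^bsub>Hm A B\<^esub> \<in> through Xs A B"
| through_step: "\<lbrakk>X \<in> Xs; arr \<psi> A X; arr g X B; v \<in> through Xs A B\<rbrakk> \<Longrightarrow> g \<bullet> \<psi> \<oplus>\<^bsub>Hm A B\<^esub> v \<in> through Xs A B"

lemma through_arr: "v \<in> through Xs A B \<Longrightarrow> arr v A B"
  by (induct rule: through.induct) blast+

lemma through_single: "\<lbrakk>X \<in> Xs; arr \<psi> A X; arr g X B\<rbrakk> \<Longrightarrow> g \<bullet> \<psi> \<in> through Xs A B"
  using through_step[of X Xs \<psi> A g B "\<zero>\<^bsub>Hm A B\<^esub>"] through_zero[of A B Xs] add_zero_right[of "g \<bullet> \<psi>" A B]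
    arr_comp[of \<psi> A X g B] arrD(1)[of \<psi> A X] arrD(2)[of g X B] by simp

lemma through_add:
  assumes "v \<in> through Xs A B" "w \<in> through Xs A B"
  shows "v \<oplus>\<^bsub>Hm A B\<^esub> w \<in> through Xs A B"
  using assms(1)
proof induct
  case through_zero
  then show ?case using add_zero_left[OF through_arr[OF assms(2)]] assms(2) by simp
next
  case (through_step X \<psi> g v)
  then show ?case
    using through.through_step[OF through_step(1-3,5)]
      add_assoc[OF arr_comp[OF through_step(2,3)] through_arr[OF through_step(4)] through_arr[OF assms(2)]] by simp
qed

lemma through_smult:
  assumes c: "c \<in> carrier K" and v: "v \<in> through Xs A B"
  shows "c \<odot>\<^bsub>Hm A B\<^esub> v \<in> through Xs A B"
  using v
proof induct
  case through_zero
  then show ?case using module.smult_r_null[OF hom_module c] through.through_zero by simp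
next
  case (through_step X \<psi> g v)
  have ob: "A \<in> Obj C" "B \<in> Obj C" using through_step arrD by blast+
  have "c \<odot>\<^bsub>Hm A B\<^esub> (g \<bullet> \<psi> \<oplus>\<^bsub>Hm A B\<^esub> v) = ((c \<odot>\<^bsub>Hm X B\<^esub> g) \<bullet> \<psi>) \<oplus>\<^bsub>Hm A B\<^esub> (c \<odot>\<^bsub>Hm A B\<^esub> v)"
    using module.smult_r_distr[OF hom_module[OF ob] c arrD(3)[OF arr_comp[OF through_step(2,3)]] arrD(3)[OF through_arr[OF through_step(4)]]]
      comp_smult_left[OF through_step(2,3) c] by simp
  then show ?case using through.through_step[OF through_step(1,2) arr_smult[OF c through_step(3)] through_step(5)] by simp
qed

lemma through_precomp:
  assumes f: "arr f A' A" and v: "v \<in> through Xs A B"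
  shows "v \<bullet> f \<in> through Xs A' B"
  using v
proof induct
  case through_zero
  then show ?case using comp_zero_left[OF f] through.through_zero arrD(1)[OF f] by simp
next
  case (through_step X \<psi> g v)
  have "(g \<bullet> \<psi> \<oplus>\<^bsub>Hm A B\<^esub> v) \<bullet> f = g \<bullet> (\<psi> \<bullet> f) \<oplus>\<^bsub>Hm A' B\<^esub> v \<bullet> f"
    using comp_add_left[OF f arr_comp[OF through_step(2,3)] through_arr[OF through_step(4)]]
      comp_assoc[OF f through_step(2,3)] by simp
  then show ?case using through.through_step[OF through_step(1) arr_comp[OF f through_step(2)] through_step(3,5)] by simp
qed

lemma subfunctor_through: "Y \<in> Obj C \<Longrightarrow> subfunctor (\<lambda>Z. through Xs Z Y) Y"
  unfolding subfunctor_def hom_subspace_def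
  by (auto intro: through_arr through_zero through_add through_smult through_precomp)

section \<open>A Nakayama lemma\<close>

text \<open>The subfunctor of Hom(A, -) generated by the listed elements, evaluated at
  \<open>Y\<close>. A pair records a target and a morphism, as the morphism does not determine its
  target; recursion on the list makes it easy to discard one generator.\<close>

primrec generated :: "'o \<Rightarrow> ('o \<times> 'm) list \<Rightarrow> 'o \<Rightarrow> 'm set" where
  "generated A [] Y = {\<zero>\<^bsub>Hm A Y\<^esub>}"
| "generated A (w # ws) Y = {h \<bullet> snd w \<oplus>\<^bsub>Hm A Y\<^esub> v | h v. arr h (fst w) Y \<and> v \<in> generated A ws Y}"

definition generators :: "'o \<Rightarrow> ('o \<times> 'm) list \<Rightarrow> bool" where
  "generators A ws \<longleftrightarrow> A \<in> Obj C \<and> (\<forall>w\<in>set ws. arr (snd w) A (fst w))"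

lemma generators_Cons: "generators A (w # ws) \<longleftrightarrow> generators A ws \<and> arr (snd w) A (fst w)"
  by (auto simp: generators_def)

lemma generated_arr: "\<lbrakk>generators A ws; Y \<in> Obj C; v \<in> generated A ws Y\<rbrakk> \<Longrightarrow> arr v A Y"
proof (induct ws arbitrary: v)
  case Nil
  then show ?case using arr_zero by (auto simp: generators_def)
next
  case (Cons w ws)
  then show ?case using arr_comp[of "snd w" A "fst w"] arr_add by (fastforce simp: generators_Cons)
qed

lemma generated_zero: "\<lbrakk>generators A ws; Y \<in> Obj C\<rbrakk> \<Longrightarrow> \<zero>\<^bsub>Hm A Y\<^esub> \<in> generated A ws Y"
proof (induct ws)
  case (Cons w ws)
  have w: "arr (snd w) A (fst w)" and ws: "generators A ws" using Cons(2) by (auto simp: generators_Cons)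
  have A: "A \<in> Obj C" using arrD(1)[OF w] .
  have "\<zero>\<^bsub>Hm A Y\<^esub> = \<zero>\<^bsub>Hm (fst w) Y\<^esub> \<bullet> snd w \<oplus>\<^bsub>Hm A Y\<^esub> \<zero>\<^bsub>Hm A Y\<^esub>"
    using comp_zero_left[OF w Cons(3)] add_zero_left[OF arr_zero[OF A Cons(3)]] by simp
  then show ?case using Cons(1)[OF ws Cons(3)] arr_zero[OF arrD(2)[OF w] Cons(3)] unfolding generated.simps by blast
qed simp

lemma generated_add:
  "\<lbrakk>generators A ws; Y \<in> Obj C; v \<in> generated A ws Y; v' \<in> generated A ws Y\<rbrakk> \<Longrightarrow> v \<oplus>\<^bsub>Hm A Y\<^esub> v' \<in> generated A ws Y"
proof (induct ws arbitrary: v v')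
  case Nil
  then show ?case using add_zero_left[OF arr_zero, of A Y] by (simp add: generators_def)
next
  case (Cons w ws)
  have w: "arr (snd w) A (fst w)" and ws: "generators A ws" using Cons(2) by (auto simp: generators_Cons)
  obtain h x where h: "v = h \<bullet> snd w \<oplus>\<^bsub>Hm A Y\<^esub> x" "arr h (fst w) Y" "x \<in> generated A ws Y" using Cons(4) by auto
  obtain h' x' where h': "v' = h' \<bullet> snd w \<oplus>\<^bsub>Hm A Y\<^esub> x'" "arr h' (fst w) Y" "x' \<in> generated A ws Y" using Cons(5) by auto
  have a: "arr x A Y" "arr x' A Y" using generated_arr[OF ws Cons(3)] h h' by blast+
  have hw: "arr (h \<bullet> snd w) A Y" "arr (h' \<bullet> snd w) A Y" using w h h' by blast+
  interpret abelian_group "Hm A Y" using hom_group arrD(1)[OF w] Cons(3) by blast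
  have "v \<oplus>\<^bsub>Hm A Y\<^esub> v' = (h \<bullet> snd w \<oplus>\<^bsub>Hm A Y\<^esub> h' \<bullet> snd w) \<oplus>\<^bsub>Hm A Y\<^esub> (x \<oplus>\<^bsub>Hm A Y\<^esub> x')"
    unfolding h(1) h'(1) using a[THEN arrD(3)] hw[THEN arrD(3)] by (simp add: a_ac)
  also have "\<dots> = (h \<oplus>\<^bsub>Hm (fst w) Y\<^esub> h') \<bullet> snd w \<oplus>\<^bsub>Hm A Y\<^esub> (x \<oplus>\<^bsub>Hm A Y\<^esub> x')"
    using comp_add_left[OF w h(2) h'(2)] by simp
  finally show ?case
    using arr_add[OF h(2) h'(2)] Cons(1)[OF ws Cons(3) h(3) h'(3)] by auto
qed

lemma generated_postcomp:
  "\<lbrakk>generators A ws; arr g Y Y'; v \<in> generated A ws Y\<rbrakk> \<Longrightarrow> g \<bullet> v \<in> generated A ws Y'"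
proof (induct ws arbitrary: v)
  case Nil
  then show ?case using comp_zero_right by (simp add: generators_def)
next
  case (Cons w ws)
  have w: "arr (snd w) A (fst w)" and ws: "generators A ws" using Cons(2) by (auto simp: generators_Cons)
  obtain h x where h: "v = h \<bullet> snd w \<oplus>\<^bsub>Hm A Y\<^esub> x" "arr h (fst w) Y" "x \<in> generated A ws Y" using Cons(4) by auto
  have "g \<bullet> v = (g \<bullet> h) \<bullet> snd w \<oplus>\<^bsub>Hm A Y'\<^esub> g \<bullet> x"
    unfolding h(1) using comp_add_right[OF arr_comp[OF w h(2)] generated_arr[OF ws arrD(1)[OF Cons(3)] h(3)] Cons(3)]
      comp_assoc[OF w h(2) Cons(3)] by simp
  then show ?case using arr_comp[OF h(2) Cons(3)] Cons(1)[OF ws Cons(3) h(3)] by auto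
qed

lemma generated_member:
  "\<lbrakk>generators A ws; w \<in> set ws; arr h (fst w) Y\<rbrakk> \<Longrightarrow> h \<bullet> snd w \<in> generated A ws Y"
proof (induct ws)
  case (Cons w' ws)
  have w': "arr (snd w') A (fst w')" and ws: "generators A ws" using Cons(2) by (auto simp: generators_Cons)
  have Y: "Y \<in> Obj C" using arrD(2)[OF Cons(4)] .
  show ?case
  proof (cases "w = w'")
    case True
    then have "h \<bullet> snd w = h \<bullet> snd w' \<oplus>\<^bsub>Hm A Y\<^esub> \<zero>\<^bsub>Hm A Y\<^esub>"
      using add_zero_right[OF arr_comp[OF w']] Cons(4) by simp
    then show ?thesis using generated_zero[OF ws Y] Cons(4) True unfolding generated.simps by blast
  next
    case False
    then have hw: "h \<bullet> snd w \<in> generated A ws Y" using Cons ws by simp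
    have "h \<bullet> snd w = \<zero>\<^bsub>Hm (fst w') Y\<^esub> \<bullet> snd w' \<oplus>\<^bsub>Hm A Y\<^esub> h \<bullet> snd w"
      using comp_zero_left[OF w' Y] add_zero_left[OF generated_arr[OF ws Y hw]] by simp
    then show ?thesis using hw arr_zero[OF arrD(2)[OF w'] Y] unfolding generated.simps by blast
  qed
qed simp

lemma generated_finsum:
  assumes "generators A ws" "Y \<in> Obj C" "finite I" "\<And>i. i \<in> I \<Longrightarrow> f i \<in> generated A ws Y"
  shows "(\<Oplus>\<^bsub>Hm A Y\<^esub>i\<in>I. f i) \<in> generated A ws Y"
  using assms(3,4)
proof (induct I rule: finite_induct)
  case empty
  interpret abelian_group "Hm A Y" using hom_group assms(1,2) by (simp add: generators_def)
  show ?case using generated_zero[OF assms(1,2)] by simp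
next
  case (insert i I)
  interpret abelian_group "Hm A Y" using hom_group assms(1,2) by (simp add: generators_def)
  have "\<And>j. j \<in> insert i I \<Longrightarrow> f j \<in> Mor C A Y" using generated_arr[OF assms(1,2)] insert(4) arrD(3) by blast
  then show ?case using insert generated_add[OF assms(1,2)] by (simp add: Pi_iff)
qed

text \<open>Finite generating lists of the spaces Hom(A, Y) are collected over the finite set
  \<open>L\<close>.\<close>

lemma generators_exist:
  assumes fin: "hom_finite K C" and L: "finite L" "L \<subseteq> Obj C" and A: "A \<in> Obj C"
  obtains ws where "generators A ws" "\<And>w. w \<in> set ws \<Longrightarrow> fst w \<in> L"
    "\<And>Y f. Y \<in> L \<Longrightarrow> arr f A Y \<Longrightarrow> f \<in> generated A ws Y"
proof -
  have "\<exists>bs. (\<forall>b\<in>set bs. arr b A Y) \<and> (\<forall>f. arr f A Y \<longrightarrow> (\<exists>c. (\<forall>i<length bs. c i \<in> carrier K) \<and>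
       f = (\<Oplus>\<^bsub>Hm A Y\<^esub>i\<in>{..<length bs}. c i \<odot>\<^bsub>Hm A Y\<^esub> (bs ! i))))" if Y: "Y \<in> L" for Y
    by (rule finite_generators[OF fin A subsetD[OF L(2) Y]], rule exI, intro conjI ballI allI impI) blast+
  then obtain bs where bs: "\<And>Y b. \<lbrakk>Y \<in> L; b \<in> set (bs Y)\<rbrakk> \<Longrightarrow> arr b A Y"
    "\<And>Y f. \<lbrakk>Y \<in> L; arr f A Y\<rbrakk> \<Longrightarrow> \<exists>c. (\<forall>i<length (bs Y). c i \<in> carrier K) \<and>
       f = (\<Oplus>\<^bsub>Hm A Y\<^esub>i\<in>{..<length (bs Y)}. c i \<odot>\<^bsub>Hm A Y\<^esub> (bs Y ! i))"
    by metis
  obtain Ls where Ls: "set Ls = L" using L(1) finite_list by blast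
  define ws where "ws = concat (map (\<lambda>Y. map (Pair Y) (bs Y)) Ls)"
  have set: "set ws = {(Y, b). Y \<in> L \<and> b \<in> set (bs Y)}" unfolding ws_def using Ls by auto
  have gens: "generators A ws" unfolding generators_def set using A bs(1) by auto
  have "f \<in> generated A ws Y" if Y: "Y \<in> L" and f: "arr f A Y" for Y f
  proof -
    have Yob: "Y \<in> Obj C" using L(2) Y by blast
    obtain c where c: "\<And>i. i < length (bs Y) \<Longrightarrow> c i \<in> carrier K"
      "f = (\<Oplus>\<^bsub>Hm A Y\<^esub>i\<in>{..<length (bs Y)}. c i \<odot>\<^bsub>Hm A Y\<^esub> (bs Y ! i))"
      using bs(2)[OF Y f] by blast
    show ?thesis
      unfolding c(2)
    proof (rule generated_finsum[OF gens Yob])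
      fix i assume "i \<in> {..<length (bs Y)}"
      then have i: "i < length (bs Y)" by simp
      have b: "arr (bs Y ! i) A Y" using bs(1)[OF Y] i by simp
      have "(Y, bs Y ! i) \<in> set ws" unfolding set using Y i by simp
      \<comment> \<open>Linear coefficients become morphism coefficients: the scalar is carried by a
        multiple of the identity of \<open>Y\<close>.\<close>
      from generated_member[OF gens this, of "c i \<odot>\<^bsub>Hm Y Y\<^esub> Id C Y" Y]
      show "c i \<odot>\<^bsub>Hm A Y\<^esub> (bs Y ! i) \<in> generated A ws Y"
        using comp_smult_left[OF b arr_id[OF Yob] c(1)[OF i]] arr_smult[OF c(1)[OF i] arr_id[OF Yob]] b by simp
    qed simp
  qed
  then show ?thesis using that gens set by fastforce
qed

text \<open>Generators are discarded one by one until none is left. A generator \<open>x\<close> at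
  \<open>X\<close> is a sum of composites A -> X' -> X; expanding the first factors in all
  generators, \<open>x\<close> itself reappears with coefficients X -> X' -> X, which are non-units
  because X' is not isomorphic to \<open>X\<close>.\<close>

lemma nakayama_generated:
  assumes local: "\<And>X. X \<in> L \<Longrightarrow> X \<in> Obj C \<and> local_endomorphisms C X"
    and opp: "\<And>X X'. \<lbrakk>X \<in> L; X' \<in> opp X\<rbrakk> \<Longrightarrow> X' \<in> L \<and> (X, X') \<notin> iso_rel C"
    and through: "\<And>X w. \<lbrakk>X \<in> L; arr w A X\<rbrakk> \<Longrightarrow> w \<in> through (opp X) A X"
  shows "\<lbrakk>generators A ws; \<And>w. w \<in> set ws \<Longrightarrow> fst w \<in> L; \<And>Y f. Y \<in> L \<Longrightarrow> arr f A Y \<Longrightarrow> f \<in> generated A ws Y;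
     Y \<in> L; arr f A Y\<rbrakk> \<Longrightarrow> f = \<zero>\<^bsub>Hm A Y\<^esub>"
proof (induct ws)
  case Nil
  then show ?case by fastforce
next
  case (Cons w ws)
  define X where "X = fst w"
  define x where "x = snd w"
  have x: "arr x A X" and ws: "generators A ws" using Cons(2) by (auto simp: generators_Cons x_def X_def)
  have X: "X \<in> L" using Cons(3)[of w] by (simp add: X_def)
  then have Xob: "X \<in> Obj C" and Xloc: "local_endomorphisms C X" using local by blast+
  have gen: "\<exists>h v. f = h \<bullet> x \<oplus>\<^bsub>Hm A Y\<^esub> v \<and> arr h X Y \<and> v \<in> generated A ws Y" if "Y \<in> L" "arr f A Y" for Y f
    using Cons(4)[OF that] unfolding generated.simps x_def X_def by blast
  \<comment> \<open>The non-unit multiples of \<open>x\<close> are gathered in the single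
    coefficient \<open>r\<close>; locality keeps it a non-unit when terms are added, and
    \<open>v'\<close> uses only the other generators.\<close>
  have claim: "\<exists>r v'. arr r X X \<and> \<not> iso_mor C X X r \<and> v' \<in> generated A ws X \<and> v = r \<bullet> x \<oplus>\<^bsub>Hm A X\<^esub> v'"
    if "v \<in> through (opp X) A X" for v
    using that
  proof induct
    case through_zero
    have "\<zero>\<^bsub>Hm A X\<^esub> = \<zero>\<^bsub>Hm X X\<^esub> \<bullet> x \<oplus>\<^bsub>Hm A X\<^esub> \<zero>\<^bsub>Hm A X\<^esub>"
      using comp_zero_left[OF x Xob] add_zero_left[OF arr_zero[OF through_zero]] by simp
    then show ?case
      using generated_zero[OF ws Xob] local_zero_not_iso[OF Xloc Xob] arr_zero[OF Xob Xob] by blast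
  next
    case (through_step X' \<psi> g v)
    obtain r v' where r: "arr r X X" "\<not> iso_mor C X X r" "v' \<in> generated A ws X" "v = r \<bullet> x \<oplus>\<^bsub>Hm A X\<^esub> v'"
      using through_step(5) by blast
    have X': "X' \<in> L" "(X, X') \<notin> iso_rel C" using opp[OF X through_step(1)] by blast+
    obtain h y where h: "\<psi> = h \<bullet> x \<oplus>\<^bsub>Hm A X'\<^esub> y" "arr h X X'" "y \<in> generated A ws X'"
      using gen[OF X'(1) through_step(2)] by blast
    have X'ob: "X' \<in> Obj C" using arrD(2)[OF h(2)] .
    have ya: "arr y A X'" using generated_arr[OF ws X'ob h(3)] .
    have gh: "arr (g \<bullet> h) X X" using h(2) through_step(3) by blast
    have ngh: "\<not> iso_mor C X X (g \<bullet> h)"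
    proof
      assume "iso_mor C X X (g \<bullet> h)"
      then have "retract X X'" using iso_factor_retract[OF h(2) through_step(3)] by blast
      then have "(X, X') \<in> iso_rel C"
        using retract_of_local_iso[of X' X] local[OF X'(1)] Xloc by (auto simp: local_endomorphisms_def)
      then show False using X'(2) by blast
    qed
    have gy: "g \<bullet> y \<in> generated A ws X" using generated_postcomp[OF ws through_step(3) h(3)] .
    have va: "arr v' A X" using generated_arr[OF ws Xob r(3)] .
    have g\<psi>: "g \<bullet> \<psi> = (g \<bullet> h) \<bullet> x \<oplus>\<^bsub>Hm A X\<^esub> g \<bullet> y"
      unfolding h(1) using comp_add_right[OF arr_comp[OF x h(2)] ya through_step(3)] comp_assoc[OF x h(2) through_step(3)] by simp
    interpret abelian_group "Hm A X" using hom_group arrD(1)[OF x] Xob by blast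
    have "g \<bullet> \<psi> \<oplus>\<^bsub>Hm A X\<^esub> v = ((g \<bullet> h) \<bullet> x \<oplus>\<^bsub>Hm A X\<^esub> r \<bullet> x) \<oplus>\<^bsub>Hm A X\<^esub> (g \<bullet> y \<oplus>\<^bsub>Hm A X\<^esub> v')"
      unfolding g\<psi> r(4)
      using arrD(3)[OF arr_comp[OF x gh]] arrD(3)[OF arr_comp[OF ya through_step(3)]] arrD(3)[OF arr_comp[OF x r(1)]] arrD(3)[OF va]
      by (simp add: a_ac)
    also have "\<dots> = (g \<bullet> h \<oplus>\<^bsub>Hm X X\<^esub> r) \<bullet> x \<oplus>\<^bsub>Hm A X\<^esub> (g \<bullet> y \<oplus>\<^bsub>Hm A X\<^esub> v')"
      using comp_add_left[OF x gh r(1)] by simp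
    finally have "g \<bullet> \<psi> \<oplus>\<^bsub>Hm A X\<^esub> v = (g \<bullet> h \<oplus>\<^bsub>Hm X X\<^esub> r) \<bullet> x \<oplus>\<^bsub>Hm A X\<^esub> (g \<bullet> y \<oplus>\<^bsub>Hm A X\<^esub> v')" .
    moreover have "\<not> iso_mor C X X (g \<bullet> h \<oplus>\<^bsub>Hm X X\<^esub> r)" using local_add[OF Xloc gh r(1)] ngh r(2) by blast
    ultimately show ?case
      using arr_add[OF gh r(1)] generated_add[OF ws Xob gy r(3)] by blast
  qed
  obtain r v where r: "arr r X X" "\<not> iso_mor C X X r" "v \<in> generated A ws X" "x = r \<bullet> x \<oplus>\<^bsub>Hm A X\<^esub> v"
    using claim[OF through[OF X x]] by blast
  \<comment> \<open>\<open>r\<close> is not invertible, so \<open>1 - r\<close> is, and the generator \<open>x\<close> is redundant.\<close>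
  let ?s = "Id C X \<oplus>\<^bsub>Hm X X\<^esub> \<ominus>\<^bsub>Hm X X\<^esub> r"
  have s: "arr ?s X X" using r(1) Xob by blast
  have "iso_mor C X X ?s"
    using local_add[OF Xloc r(1) s] add_complement[OF r(1) arr_id[OF Xob]] iso_mor_Id[OF Xob] r(2) by simp
  then obtain t where t: "arr t X X" "t \<bullet> ?s = Id C X" using Xob by (auto simp: iso_mor_iff)
  have va: "arr v A X" using generated_arr[OF ws Xob r(3)] .
  have rx: "arr (r \<bullet> x) A X" using x r(1) by blast
  have "?s \<bullet> x = x \<oplus>\<^bsub>Hm A X\<^esub> \<ominus>\<^bsub>Hm A X\<^esub> (r \<bullet> x)"
    using comp_add_left[OF x arr_id[OF Xob] arr_neg[OF r(1)]] comp_neg_left[OF x r(1)] x by simp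
  also have "\<dots> = (r \<bullet> x \<oplus>\<^bsub>Hm A X\<^esub> v) \<oplus>\<^bsub>Hm A X\<^esub> \<ominus>\<^bsub>Hm A X\<^esub> (r \<bullet> x)" using r(4) by simp
  also have "\<dots> = v"
  proof -
    interpret abelian_group "Hm A X" using hom_group arrD(1)[OF x] Xob by blast
    show ?thesis using arrD(3)[OF rx] arrD(3)[OF va] by (simp add: a_ac r_neg)
  qed
  finally have sx: "?s \<bullet> x = v" .
  have "x = t \<bullet> v" using comp_assoc[OF x s t(1)] t(2) sx x by simp
  then have xgen: "x \<in> generated A ws X" using generated_postcomp[OF ws t(1) r(3)] by simp
  show ?case
  proof (rule Cons(1)[OF ws])
    show "fst w' \<in> L" if "w' \<in> set ws" for w' using Cons(3) that by simp
    show "f \<in> generated A ws Y" if Yf: "Y \<in> L" "arr f A Y" for Y f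
    proof -
      obtain h v where h: "f = h \<bullet> x \<oplus>\<^bsub>Hm A Y\<^esub> v" "arr h X Y" "v \<in> generated A ws Y" using gen[OF Yf] by blast
      have "h \<bullet> x \<in> generated A ws Y" using generated_postcomp[OF ws h(2) xgen] .
      then show ?thesis unfolding h(1) using generated_add[OF ws arrD(2)[OF h(2)] _ h(3)] by blast
    qed
  qed (use Cons in auto)
qed

text \<open>The hypothesis says that Hom(A, -) on \<open>L\<close> is contained in its own radical
  part, since maps between non-isomorphic objects with local endomorphism rings are radical; finite
  generation then forces it to vanish.\<close>

lemma nakayama:
  assumes fin: "hom_finite K C" and L: "finite L" and A: "A \<in> Obj C"
    and local: "\<And>X. X \<in> L \<Longrightarrow> X \<in> Obj C \<and> local_endomorphisms C X"
    and opp: "\<And>X X'. \<lbrakk>X \<in> L; X' \<in> opp X\<rbrakk> \<Longrightarrow> X' \<in> L \<and> (X, X') \<notin> iso_rel C"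
    and through: "\<And>X w. \<lbrakk>X \<in> L; arr w A X\<rbrakk> \<Longrightarrow> w \<in> through (opp X) A X"
    and Y: "Y \<in> L" and f: "arr f A Y"
  shows "f = \<zero>\<^bsub>Hm A Y\<^esub>"
proof -
  have "L \<subseteq> Obj C" using local by blast
  then obtain ws where "generators A ws" "\<And>w. w \<in> set ws \<Longrightarrow> fst w \<in> L"
    "\<And>Y f. Y \<in> L \<Longrightarrow> arr f A Y \<Longrightarrow> f \<in> generated A ws Y"
    using generators_exist[OF fin L _ A] by blast
  then show ?thesis using nakayama_generated[of L opp A ws Y f] local opp through Y f by blast
qed

end

section \<open>The bound on ext-orthogonal families\<close>

lemma (in klinear_category) local_retract_of_Add:
  assumes X: "local_endomorphisms C X" "retract X P" and P: "P \<in> Add C M"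
  shows "retract X M"
proof -
  obtain n S where S: "direct_sum C (replicate n M) S" "direct_summand C P S"
    using P unfolding Add_def by blast
  have "retract X S" using retract_trans[OF X(2) direct_summand_retract[OF S(2)]] .
  then show ?thesis using local_retract_direct_sum[OF X(1) S(1)] by auto
qed

lemma (in klinear_category) retract_zero:
  assumes "retract X Z" "Id C Z = \<zero>\<^bsub>Hm Z Z\<^esub>"
  shows "Id C X = \<zero>\<^bsub>Hm X X\<^esub>"
proof -
  obtain u p where up: "arr u X Z" "arr p Z X" "p \<bullet> u = Id C X" using assms(1) unfolding retract_def by blast
  have "zero_object C Z" using zero_objectI[OF arrD(2)[OF up(1)] assms(2)] .
  then have "u = \<zero>\<^bsub>Hm X Z\<^esub>" using zero_objectD(3) up(1) by blast
  then show ?thesis using up(3) comp_zero_right[OF up(2) arrD(1)[OF up(1)]] by simp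
qed

lemma (in klinear_category) hom_subspace_kernel:
  assumes W: "hom_subspace B Y W" and f: "arr f A B"
  shows "hom_subspace B Y {\<phi> \<in> W. \<phi> \<bullet> f = \<zero>\<^bsub>Hm A Y\<^esub>}"
proof -
  have Y: "Y \<in> Obj C" and A: "A \<in> Obj C" using hom_subspace_obj[OF W] arrD(1)[OF f] by blast+
  have a: "\<And>\<phi>. \<phi> \<in> W \<Longrightarrow> arr \<phi> B Y" using W by (simp add: hom_subspace_def)
  show ?thesis
    unfolding hom_subspace_def
  proof (intro conjI ballI)
    show "\<zero>\<^bsub>Hm B Y\<^esub> \<in> {\<phi> \<in> W. \<phi> \<bullet> f = \<zero>\<^bsub>Hm A Y\<^esub>}"
      using W comp_zero_left[OF f Y] by (simp add: hom_subspace_def)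
    fix \<phi> assume \<phi>: "\<phi> \<in> {\<phi> \<in> W. \<phi> \<bullet> f = \<zero>\<^bsub>Hm A Y\<^esub>}"
    show "arr \<phi> B Y" using \<phi> a by blast
    show "\<phi> \<oplus>\<^bsub>Hm B Y\<^esub> \<psi> \<in> {\<phi> \<in> W. \<phi> \<bullet> f = \<zero>\<^bsub>Hm A Y\<^esub>}" if "\<psi> \<in> {\<phi> \<in> W. \<phi> \<bullet> f = \<zero>\<^bsub>Hm A Y\<^esub>}" for \<psi>
      using \<phi> that W comp_add_left[OF f, of \<phi> Y \<psi>] a add_zero_left[OF arr_zero[OF A Y]]
      by (simp add: hom_subspace_def)
    show "c \<odot>\<^bsub>Hm B Y\<^esub> \<phi> \<in> {\<phi> \<in> W. \<phi> \<bullet> f = \<zero>\<^bsub>Hm A Y\<^esub>}" if "c \<in> carrier K" for c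
      using \<phi> that W comp_smult_left[OF f, of \<phi> Y c] a module.smult_r_null[OF hom_module[OF A Y]]
      by (simp add: hom_subspace_def)
  qed
qed

section \<open>Multiplicities of isomorphism classes\<close>

definition iso_class :: "('o, 'k, 'm, 'z) lin_category_scheme \<Rightarrow> 'o \<Rightarrow> 'o set" where
  "iso_class C X = iso_rel C `` {X}"

text \<open>A coordinate of the class of an object in the split Grothendieck group, read from a
  decomposition list; positions are counted, since a list may repeat an object.\<close>

definition class_multiplicity :: "('o, 'k, 'm, 'z) lin_category_scheme \<Rightarrow> 'o list \<Rightarrow> 'o set \<Rightarrow> nat" where
  "class_multiplicity C Zs c = card {i \<in> {..<length Zs}. iso_class C (Zs ! i) = c}"

lemma (in klinear_category) iso_class_eq_iff:
  "\<lbrakk>X \<in> Obj C; Y \<in> Obj C\<rbrakk> \<Longrightarrow> iso_class C X = iso_class C Y \<longleftrightarrow> (X, Y) \<in> iso_rel C"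
  unfolding iso_class_def using eq_equiv_class_iff[OF equiv_iso_rel] by blast

text \<open>Summands are grouped by isomorphism class, on which the dimension is constant. The
  representative chosen for a class depends neither on \<open>S\<close> nor on \<open>Zs\<close>, so
  the weights are common to all objects and the dimension is linear in the multiplicities.\<close>

lemma (in klinear_category) subfunctor_dim_multiplicity:
  assumes fin: "hom_finite K C" and I: "subfunctor I Y" and S: "direct_sum C Zs S"
    and Cl: "finite Cl" "\<And>Z. Z \<in> set Zs \<Longrightarrow> iso_class C Z \<in> Cl"
  shows "hom_dim S Y (I S) =
    (\<Sum>c\<in>Cl. class_multiplicity C Zs c * (hom_dim (SOME Z. Z \<in> c) Y (I (SOME Z. Z \<in> c))))"
proof -
  let ?d = "\<lambda>c. hom_dim (SOME Z. Z \<in> c) Y (I (SOME Z. Z \<in> c))"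
  have d: "hom_dim (Zs ! i) Y (I (Zs ! i)) = ?d (iso_class C (Zs ! i))" if i: "i < length Zs" for i
  proof -
    have "Zs ! i \<in> Obj C" using direct_sum_obj(2)[OF S] i by (meson nth_mem subsetD)
    then have "Zs ! i \<in> iso_class C (Zs ! i)" using iso_rel_refl by (simp add: iso_class_def)
    then have "(SOME Z. Z \<in> iso_class C (Zs ! i)) \<in> iso_class C (Zs ! i)" by (rule someI)
    then have "(Zs ! i, SOME Z. Z \<in> iso_class C (Zs ! i)) \<in> iso_rel C" by (simp add: iso_class_def)
    then show ?thesis using subfunctor_dim_iso[OF fin I] by blast
  qed
  have "hom_dim S Y (I S) = (\<Sum>i<length Zs. hom_dim (Zs ! i) Y (I (Zs ! i)))"
    by (rule subfunctor_dim_direct_sum[OF fin I S])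
  also have "\<dots> = (\<Sum>c\<in>Cl. \<Sum>i\<in>{i \<in> {..<length Zs}. iso_class C (Zs ! i) = c}. hom_dim (Zs ! i) Y (I (Zs ! i)))"
    by (rule sum.group[symmetric]) (use Cl in auto)
  also have "\<dots> = (\<Sum>c\<in>Cl. class_multiplicity C Zs c * ?d c)"
    using d by (intro sum.cong) (auto simp: class_multiplicity_def)
  finally show ?thesis .
qed

locale cluster_tilted_category = klinear_triangulated_category K D
  for K :: "'k ring" and D :: "('o, 'k, 'm, 'z) tri_category_scheme" (structure) +
  fixes T :: 'o
  assumes krull_schmidt_D: "krull_schmidt D" and hom_finite_D: "hom_finite K D"
    and cluster_tilting_T: "cluster_tilting D T"

sublocale cluster_tilted_category \<subseteq> krull_schmidt_category K D
  by unfold_locales (rule krull_schmidt_D)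

context cluster_tilted_category
begin

lemma presentation_rank_nullity:
  assumes pr: "presentation T P Q X f p h" and I: "subfunctor I Y"
    and ext: "\<And>\<psi>. \<psi> \<in> I P \<Longrightarrow> \<exists>\<phi>\<in>I Q. \<psi> = \<phi> \<bullet> f"
  shows "hom_dim Q Y (I Q) = hom_dim P Y (I P) + hom_dim Q Y {\<phi> \<in> I Q. \<phi> \<bullet> f = \<zero>\<^bsub>Hm P Y\<^esub>}"
proof -
  have f: "arr f P Q" using triangle_arr(1) pr unfolding presentation_def by blast
  have "(\<lambda>\<phi>. \<phi> \<bullet> f) ` I Q = I P" using ext subfunctorD(2)[OF I f] by blast
  then show ?thesis using precomp_rank_nullity[OF hom_finite_D subfunctorD(1)[OF I arrD(2)[OF f]] f] by simp
qed

text \<open>Each term P -> X' -> Y is extended separately: only its first factor is replaced, by a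
  map Q -> X'.\<close>

lemma through_extend:
  assumes pr: "presentation T P Q X f p h" and ext: "\<And>X'. X' \<in> Xs \<Longrightarrow> ext_zero T X X'"
    and \<psi>: "\<psi> \<in> through Xs P Y"
  shows "\<exists>\<phi>\<in>through Xs Q Y. \<psi> = \<phi> \<bullet> f"
  using \<psi>
proof induct
  have f: "arr f P Q" using triangle_arr(1) pr unfolding presentation_def by blast
  {
    case through_zero
    then show ?case
      using through.through_zero[OF arrD(2)[OF f] through_zero(2), of Xs] comp_zero_left[OF f through_zero(2)]
      by (intro bexI[of _ "\<zero>\<^bsub>Hm Q Y\<^esub>"]) auto
  next
    case (through_step X' \<psi> g v)
    obtain \<phi> where \<phi>: "\<phi> \<in> through Xs Q Y" "v = \<phi> \<bullet> f" using through_step(5) by blast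
    obtain \<psi>' where \<psi>': "arr \<psi>' Q X'" "\<psi> = \<psi>' \<bullet> f"
      using extend_along_presentation[OF ext[OF through_step(1)] pr through_step(2)] by blast
    have "g \<bullet> \<psi> \<oplus>\<^bsub>Hm P Y\<^esub> v = (g \<bullet> \<psi>' \<oplus>\<^bsub>Hm Q Y\<^esub> \<phi>) \<bullet> f"
      using comp_add_left[OF f arr_comp[OF \<psi>'(1) through_step(3)] through_arr[OF \<phi>(1)]]
        comp_assoc[OF f \<psi>'(1) through_step(3)] \<psi>'(2) \<phi>(2) by simp
    then show ?case
      using through.through_step[OF through_step(1) \<psi>'(1) through_step(3) \<phi>(1)] by blast
  }
qed

theorem ext_orthogonal_family_bound:
  assumes J: "finite J" "\<And>X. X \<in> J \<Longrightarrow> X \<in> Obj D" "\<And>X. X \<in> J \<Longrightarrow> local_endomorphisms D X"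
    and noniso: "\<And>X X'. \<lbrakk>X \<in> J; X' \<in> J; (X, X') \<in> iso_rel D\<rbrakk> \<Longrightarrow> X = X'"
    and ext: "\<And>X X'. \<lbrakk>X \<in> J; X' \<in> J\<rbrakk> \<Longrightarrow> ext_zero T X X'"
  shows "card J \<le> num_summands D T"
proof (rule ccontr)
  assume "\<not> card J \<le> num_summands D T"
  have Tob: "T \<in> Obj D" using cluster_tiltingD(1)[OF cluster_tilting_T] .
  obtain Ts where Ts: "direct_sum D Ts T" "\<And>Y. Y \<in> set Ts \<Longrightarrow> local_endomorphisms D Y"
    using local_decomposition[OF Tob] by blast
  have Tsob: "set Ts \<subseteq> Obj D" using direct_sum_obj(2)[OF Ts(1)] .
  \<comment> \<open>The coordinates of the index; there are |T| of them by
    \<open>num_summands_eq\<close>.\<close>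
  define Cl where "Cl = iso_class D ` set Ts"
  have finCl: "finite Cl" by (simp add: Cl_def)
  have "card Cl < card J"
    using num_summands_eq[OF Ts] \<open>\<not> card J \<le> num_summands D T\<close> by (simp add: Cl_def iso_class_def)
  have "\<exists>P Q f p h. presentation T P Q X f p h" if "X \<in> J" for X
    using presentation_exists[OF hom_finite_D cluster_tilting_T J(2)[OF that]] .
  then obtain P Q f p h where pr: "\<And>X. X \<in> J \<Longrightarrow> presentation T (P X) (Q X) X (f X) (p X) (h X)"
    by metis
  have tri: "(P X, Q X, X, f X, p X, h X) \<in> Triangles D" and PA: "P X \<in> Add D T" and QA: "Q X \<in> Add D T"
    if "X \<in> J" for X using pr[OF that] by (simp_all add: presentation_def)
  have f: "arr (f X) (P X) (Q X)" and p: "arr (p X) (Q X) X" if "X \<in> J" for X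
    using triangle_arr[OF tri[OF that]] by blast+
  have "\<exists>Zs. direct_sum D Zs (P X) \<and> (\<forall>Y\<in>set Zs. local_endomorphisms D Y)" if "X \<in> J" for X
    using krull_schmidt_D Add_obj[OF PA[OF that]] by (simp add: krull_schmidt_def)
  then obtain Ps where Ps: "\<And>X. X \<in> J \<Longrightarrow> direct_sum D (Ps X) (P X)"
    "\<And>X Y. \<lbrakk>X \<in> J; Y \<in> set (Ps X)\<rbrakk> \<Longrightarrow> local_endomorphisms D Y" by metis
  have "\<exists>Zs. direct_sum D Zs (Q X) \<and> (\<forall>Y\<in>set Zs. local_endomorphisms D Y)" if "X \<in> J" for X
    using krull_schmidt_D Add_obj[OF QA[OF that]] by (simp add: krull_schmidt_def)
  then obtain Qs where Qs: "\<And>X. X \<in> J \<Longrightarrow> direct_sum D (Qs X) (Q X)"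
    "\<And>X Y. \<lbrakk>X \<in> J; Y \<in> set (Qs X)\<rbrakk> \<Longrightarrow> local_endomorphisms D Y" by metis
  \<comment> \<open>A local summand of an object of add T is a retract of \<open>T\<close>, hence
    isomorphic to a member of \<open>Ts\<close>; so no coordinate outside \<open>Cl\<close>
    occurs.\<close>
  have class_in: "iso_class D Z \<in> Cl" if Zs: "direct_sum D Zs S" and S: "S \<in> Add D T"
    and Z: "Z \<in> set Zs" "local_endomorphisms D Z" for Zs S Z
  proof -
    have Zob: "Z \<in> Obj D" using direct_sum_obj(2)[OF Zs] Z by blast
    obtain i where "i < length Zs" "Zs ! i = Z" using Z(1) by (auto simp: in_set_conv_nth)
    then have "retract Z S" using direct_sum_retract[OF Zs] by blast
    then have "retract Z T" using local_retract_of_Add Z(2) S by blast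
    then obtain k where k: "k < length Ts" "retract Z (Ts ! k)" using local_retract_direct_sum[OF Z(2) Ts(1)] by blast
    have "(Z, Ts ! k) \<in> iso_rel D"
      using retract_of_local_iso[of "Ts ! k" Z] Ts(2)[of "Ts ! k"] k Z(2) by (auto simp: local_endomorphisms_def)
    then have "iso_class D Z = iso_class D (Ts ! k)" using iso_class_eq_iff Zob Tsob k(1) by (meson nth_mem subsetD)
    then show ?thesis using k(1) by (auto simp: Cl_def)
  qed
  let ?\<mu> = "class_multiplicity D"
  obtain a where a: "\<exists>X\<in>J. a X \<noteq> 0"
    "\<And>c. c \<in> Cl \<Longrightarrow> (\<Sum>X\<in>J. a X * (int (?\<mu> (Qs X) c) - int (?\<mu> (Ps X) c))) = 0"
    using integer_dependency[OF finCl J(1) \<open>card Cl < card J\<close>, of "\<lambda>X c. int (?\<mu> (Qs X) c) - int (?\<mu> (Ps X) c)"] by blast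
  define ker where "ker I Y X = hom_dim (Q X) Y {\<phi> \<in> I (Q X). \<phi> \<bullet> f X = \<zero>\<^bsub>Hm (P X) Y\<^esub>}" for I Y X
  have index: "(\<Sum>X\<in>J. a X * int (ker I Y X)) = 0"
    if I: "subfunctor I Y" and extend: "\<And>X \<psi>. \<lbrakk>X \<in> J; \<psi> \<in> I (P X)\<rbrakk> \<Longrightarrow> \<exists>\<phi>\<in>I (Q X). \<psi> = \<phi> \<bullet> f X" for I Y
  proof -
    let ?d = "\<lambda>c. hom_dim (SOME Z. Z \<in> c) Y (I (SOME Z. Z \<in> c))"
    have k: "int (ker I Y X) = (\<Sum>c\<in>Cl. (int (?\<mu> (Qs X) c) - int (?\<mu> (Ps X) c)) * int (?d c))" if X: "X \<in> J" for X
    proof -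
      have "hom_dim (Q X) Y (I (Q X)) = hom_dim (P X) Y (I (P X)) + ker I Y X"
        unfolding ker_def by (rule presentation_rank_nullity[OF pr[OF X] I extend[OF X]])
      moreover have "hom_dim (Q X) Y (I (Q X)) = (\<Sum>c\<in>Cl. ?\<mu> (Qs X) c * ?d c)"
        by (rule subfunctor_dim_multiplicity[OF hom_finite_D I Qs(1)[OF X] finCl])
          (rule class_in[OF Qs(1)[OF X] QA[OF X] _ Qs(2)[OF X]])
      moreover have "hom_dim (P X) Y (I (P X)) = (\<Sum>c\<in>Cl. ?\<mu> (Ps X) c * ?d c)"
        by (rule subfunctor_dim_multiplicity[OF hom_finite_D I Ps(1)[OF X] finCl])
          (rule class_in[OF Ps(1)[OF X] PA[OF X] _ Ps(2)[OF X]])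
      ultimately have "int (\<Sum>c\<in>Cl. ?\<mu> (Qs X) c * ?d c) = int (\<Sum>c\<in>Cl. ?\<mu> (Ps X) c * ?d c) + int (ker I Y X)"
        by simp
      then show ?thesis by (simp add: left_diff_distrib sum_subtractf)
    qed
    \<comment> \<open>After exchanging the two sums, the inner sum at each class is the chosen
      relation between indices.\<close>
    have "(\<Sum>X\<in>J. a X * int (ker I Y X)) =
        (\<Sum>X\<in>J. \<Sum>c\<in>Cl. a X * (int (?\<mu> (Qs X) c) - int (?\<mu> (Ps X) c)) * int (?d c))"
      using k by (intro sum.cong) (auto simp: sum_distrib_left mult.assoc)
    also have "\<dots> = (\<Sum>c\<in>Cl. \<Sum>X\<in>J. a X * (int (?\<mu> (Qs X) c) - int (?\<mu> (Ps X) c)) * int (?d c))"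
      by (rule sum.swap)
    also have "\<dots> = (\<Sum>c\<in>Cl. (\<Sum>X\<in>J. a X * (int (?\<mu> (Qs X) c) - int (?\<mu> (Ps X) c))) * int (?d c))"
      by (simp add: sum_distrib_right)
    also have "\<dots> = 0" using a(2) by simp
    finally show ?thesis .
  qed
  \<comment> \<open>\<open>L\<close> is the support of the relation. \<open>opp X\<close> lies in
    \<open>L\<close> and never contains \<open>X\<close>, as a square is not negative; both facts
    are needed for Nakayama's lemma.\<close>
  define L where "L = {X \<in> J. a X \<noteq> 0}"
  define opp where "opp X = {X' \<in> J. a X * a X' < 0}" for X
  \<comment> \<open>The two kernels agree for \<open>X\<close> in \<open>opp Y\<close>, since maps killed by \<open>f X\<close> factor through \<open>X\<close>;
    the remaining terms of the relation, multiplied by \<open>a Y\<close>, are nonnegative and hence vanish.\<close>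
  have p_through: "p Y \<in> through (opp Y) (Q Y) Y" if Y: "Y \<in> L" for Y
  proof -
    have YJ: "Y \<in> J" "a Y \<noteq> 0" using Y by (auto simp: L_def)
    have Yob: "Y \<in> Obj D" using J(2)[OF YJ(1)] .
    let ?I = "\<lambda>Z. Mor D Z Y" and ?I' = "\<lambda>Z. through (opp Y) Z Y"
    have I: "subfunctor ?I Y" and I': "subfunctor ?I' Y" using subfunctor_Hom subfunctor_through Yob by blast+
    have "(\<Sum>X\<in>J. a X * int (ker ?I Y X)) = 0"
    proof (rule index[OF I])
      fix X \<psi> assume X: "X \<in> J" and \<psi>: "\<psi> \<in> Mor D (P X) Y"
      then have "arr \<psi> (P X) Y" using arrD(1)[OF f[OF X]] Yob by (simp add: arr_def)
      then show "\<exists>\<phi>\<in>Mor D (Q X) Y. \<psi> = \<phi> \<bullet> f X"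
        using extend_along_presentation[OF ext[OF X YJ(1)] pr[OF X]] arrD(3) by metis
    qed
    moreover have "(\<Sum>X\<in>J. a X * int (ker ?I' Y X)) = 0"
    proof (rule index[OF I'])
      fix X \<psi> assume X: "X \<in> J" and \<psi>: "\<psi> \<in> through (opp Y) (P X) Y"
      show "\<exists>\<phi>\<in>through (opp Y) (Q X) Y. \<psi> = \<phi> \<bullet> f X"
        by (rule through_extend[OF pr[OF X] _ \<psi>]) (use ext[OF X] in \<open>auto simp: opp_def\<close>)
    qed
    ultimately have "(\<Sum>X\<in>J. a X * (int (ker ?I Y X) - int (ker ?I' Y X))) = 0"
      by (simp add: right_diff_distrib sum_subtractf)
    then have "(\<Sum>X\<in>J. a Y * (a X * (int (ker ?I Y X) - int (ker ?I' Y X)))) = 0"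
      by (simp add: sum_distrib_left[symmetric])
    moreover have Ksub: "hom_subspace (Q X) Y {\<phi> \<in> I (Q X). \<phi> \<bullet> f X = \<zero>\<^bsub>Hm (P X) Y\<^esub>}"
      if X: "X \<in> J" and I: "subfunctor I Y" for X I
      by (rule hom_subspace_kernel[OF subfunctorD(1)[OF I arrD(2)[OF f[OF X]]] f[OF X]])
    have sub: "{\<phi> \<in> ?I' (Q X). \<phi> \<bullet> f X = \<zero>\<^bsub>Hm (P X) Y\<^esub>} \<subseteq> {\<phi> \<in> ?I (Q X). \<phi> \<bullet> f X = \<zero>\<^bsub>Hm (P X) Y\<^esub>}" for X
      using arrD(3)[OF through_arr] by blast
    have le: "ker ?I' Y X \<le> ker ?I Y X" if X: "X \<in> J" for X
      unfolding ker_def using hom_dim_mono(1)[OF hom_finite_D Ksub[OF X I'] Ksub[OF X I] sub] .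
    have eq: "ker ?I' Y X = ker ?I Y X" if X: "X \<in> opp Y" for X
    proof -
      have XJ: "X \<in> J" using X by (simp add: opp_def)
      have "\<phi> \<in> ?I' (Q X)" if \<phi>: "\<phi> \<in> ?I (Q X)" "\<phi> \<bullet> f X = \<zero>\<^bsub>Hm (P X) Y\<^esub>" for \<phi>
      proof -
        have "arr \<phi> (Q X) Y" using \<phi>(1) Yob arrD(2)[OF f[OF XJ]] by (simp add: arr_def)
        then obtain g where g: "arr g X Y" "\<phi> = g \<bullet> p X"
          using triangle_weak_cokernel[OF tri[OF XJ] _ \<phi>(2)] by blast
        then show ?thesis using through_single[OF X p[OF XJ] g(1)] by simp
      qed
      then have "{\<phi> \<in> ?I' (Q X). \<phi> \<bullet> f X = \<zero>\<^bsub>Hm (P X) Y\<^esub>} = {\<phi> \<in> ?I (Q X). \<phi> \<bullet> f X = \<zero>\<^bsub>Hm (P X) Y\<^esub>}"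
        using sub by blast
      then show ?thesis by (simp add: ker_def)
    qed
    have nonneg: "0 \<le> a Y * (a X * (int (ker ?I Y X) - int (ker ?I' Y X)))" if X: "X \<in> J" for X
    proof (cases "X \<in> opp Y")
      case True
      then show ?thesis using eq by simp
    next
      case False
      then have "0 \<le> a Y * a X" using X by (auto simp: opp_def)
      then show ?thesis using le[OF X] by (simp add: mult.assoc[symmetric])
    qed
    \<comment> \<open>The term at \<open>X = Y\<close> carries the positive factor (a Y)^2, so its
      vanishing makes the two kernels equal; \<open>p Y\<close> lies in the larger one.\<close>
    ultimately have "a Y * (a Y * (int (ker ?I Y Y) - int (ker ?I' Y Y))) = 0"
      using sum_nonneg_eq_0_iff[OF J(1), of "\<lambda>X. a Y * (a X * (int (ker ?I Y X) - int (ker ?I' Y X)))"] YJ(1) by auto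
    then have "ker ?I' Y Y = ker ?I Y Y" using YJ(2) by simp
    then have "{\<phi> \<in> ?I' (Q Y). \<phi> \<bullet> f Y = \<zero>\<^bsub>Hm (P Y) Y\<^esub>} = {\<phi> \<in> ?I (Q Y). \<phi> \<bullet> f Y = \<zero>\<^bsub>Hm (P Y) Y\<^esub>}"
      unfolding ker_def using hom_dim_mono(2)[OF hom_finite_D Ksub[OF YJ(1) I'] Ksub[OF YJ(1) I] sub] by blast
    moreover have "p Y \<in> {\<phi> \<in> ?I (Q Y). \<phi> \<bullet> f Y = \<zero>\<^bsub>Hm (P Y) Y\<^esub>}"
      using arrD(3)[OF p[OF YJ(1)]] triangle_comp_zero[OF tri[OF YJ(1)]] by simp
    ultimately show ?thesis by blast
  qed
  \<comment> \<open>Every map T -> X factors through \<open>p X\<close>, so the factorization of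
    \<open>p X\<close> passes to all of Hom(T, X).\<close>
  have vanish: "w = \<zero>\<^bsub>Hm T Y\<^esub>" if Y: "Y \<in> L" and w: "arr w T Y" for Y w
  proof (rule nakayama[OF hom_finite_D _ Tob _ _ _ Y w, of opp])
    show "finite L" using J(1) by (simp add: L_def)
    show "X \<in> Obj D \<and> local_endomorphisms D X" if "X \<in> L" for X using that J by (simp add: L_def)
    show "X' \<in> L \<and> (X, X') \<notin> iso_rel D" if "X \<in> L" "X' \<in> opp X" for X X'
      using that noniso[of X X'] by (auto simp: L_def opp_def mult_less_0_iff)
    show "v \<in> through (opp X) T X" if X: "X \<in> L" and v: "arr v T X" for X v
    proof -
      have XJ: "X \<in> J" using X by (simp add: L_def)
      obtain \<rho> where \<rho>: "arr \<rho> T (Q X)" "v = p X \<bullet> \<rho>" using pr[OF XJ] v unfolding presentation_def by blast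
      then show ?thesis using through_precomp[OF \<rho>(1) p_through[OF X]] by simp
    qed
  qed
  have iso: "(X, Shift D (P X)) \<in> iso_rel D" and Q0: "Qs X = []" if X: "X \<in> L" for X
  proof -
    have XJ: "X \<in> J" using X by (simp add: L_def)
    have zero: "Mor D T X = {\<zero>\<^bsub>Hm T X\<^esub>}"
    proof -
      have "w = \<zero>\<^bsub>Hm T X\<^esub>" if "w \<in> Mor D T X" for w
        using vanish[OF X, of w] that Tob J(2)[OF XJ] by (simp add: arr_def)
      then show ?thesis using arrD(3)[OF arr_zero[OF Tob J(2)[OF XJ]]] by blast
    qed
    show "(X, Shift D (P X)) \<in> iso_rel D" using presentation_zero_iso[OF pr[OF XJ] zero] .
    have QZ: "zero_object D (Q X)" using pr[OF XJ] zero by (simp add: presentation_def)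
    show "Qs X = []"
    proof (rule ccontr)
      assume "Qs X \<noteq> []"
      then have 0: "0 < length (Qs X)" by simp
      have "Id D (Qs X ! 0) = \<zero>\<^bsub>Hm (Qs X ! 0) (Qs X ! 0)\<^esub>"
        using retract_zero[OF direct_sum_retract[OF Qs(1)[OF XJ] 0] zero_objectD(2)[OF QZ]] .
      then show False using Qs(2)[OF XJ nth_mem[OF 0]] by (simp add: local_endomorphisms_def)
    qed
  qed
  \<comment> \<open>Z[1] is a nonzero retract of P[1], which is isomorphic to \<open>X\<close>; as
    \<open>X\<close> is local, Z[1] is isomorphic to \<open>X\<close>. Thus a class occurring in
    \<open>P X\<close> determines \<open>X\<close>.\<close>
  have shift_iso: "(Shift D Z, X) \<in> iso_rel D" if X: "X \<in> L" and Z: "Z \<in> set (Ps X)" for X Z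
  proof -
    have XJ: "X \<in> J" using X by (simp add: L_def)
    have Zob: "Z \<in> Obj D" using direct_sum_obj(2)[OF Ps(1)[OF XJ]] Z by blast
    obtain i where "i < length (Ps X)" "Ps X ! i = Z" using Z by (auto simp: in_set_conv_nth)
    then have "retract Z (P X)" using direct_sum_retract[OF Ps(1)[OF XJ]] by blast
    then have "retract (Shift D Z) X"
      using retract_trans[OF functor_retract[OF shift_functor] iso_retract[OF iso_rel_sym[OF iso[OF X]]]] by blast
    moreover have "Id D (Shift D Z) \<noteq> \<zero>\<^bsub>Hm (Shift D Z) (Shift D Z)\<^esub>"
    proof
      assume "Id D (Shift D Z) = \<zero>\<^bsub>Hm (Shift D Z) (Shift D Z)\<^esub>"
      then have "Id D Z = \<zero>\<^bsub>Hm Z Z\<^esub>"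
        using shift_faithful[OF arr_id[OF Zob] arr_zero[OF Zob Zob]] shift_id[OF Zob] shift_zero[OF Zob Zob] by simp
      then show False using Ps(2)[OF XJ Z] by (simp add: local_endomorphisms_def)
    qed
    ultimately show ?thesis using retract_of_local_iso[OF J(3)[OF XJ]] by blast
  qed
  obtain Y where Y: "Y \<in> L" using a(1) by (auto simp: L_def)
  have YJ: "Y \<in> J" "a Y \<noteq> 0" using Y by (auto simp: L_def)
  have "Ps Y \<noteq> []"
  proof
    assume "Ps Y = []"
    then have Z: "zero_object D (P Y)" using Ps(1)[OF YJ(1)] direct_sum_Nil by simp
    have Pob: "P Y \<in> Obj D" using zero_objectD(1)[OF Z] .
    have "Id D (Shift D (P Y)) = \<zero>\<^bsub>Hm (Shift D (P Y)) (Shift D (P Y))\<^esub>"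
      using zero_objectD(2)[OF Z] shift_id[OF Pob] shift_zero[OF Pob Pob] by simp
    then have "Id D Y = \<zero>\<^bsub>Hm Y Y\<^esub>" using retract_zero[OF iso_retract[OF iso[OF Y]]] by blast
    then show False using J(3)[OF YJ(1)] by (simp add: local_endomorphisms_def)
  qed
  then have 0: "0 < length (Ps Y)" by simp
  \<comment> \<open>At this coordinate only \<open>Y\<close> contributes: \<open>Qs\<close> is empty
    on \<open>L\<close>, and a common class in \<open>Ps X\<close> and \<open>Ps Y\<close> would
    make \<open>X\<close> and \<open>Y\<close> isomorphic.\<close>
  let ?c = "iso_class D (Ps Y ! 0)"
  have Z0: "Ps Y ! 0 \<in> set (Ps Y)" "Ps Y ! 0 \<in> Obj D"
    using nth_mem[OF 0] direct_sum_obj(2)[OF Ps(1)[OF YJ(1)]] by blast+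
  have cCl: "?c \<in> Cl" using class_in[OF Ps(1)[OF YJ(1)] PA[OF YJ(1)] Z0(1) Ps(2)[OF YJ(1) Z0(1)]] .
  have other: "a X * (int (?\<mu> (Qs X) ?c) - int (?\<mu> (Ps X) ?c)) = 0" if X: "X \<in> J - {Y}" for X
  proof (cases "a X = 0")
    case False
    then have XL: "X \<in> L" using X by (simp add: L_def)
    have "iso_class D (Ps X ! i) \<noteq> ?c" if i: "i < length (Ps X)" for i
    proof
      assume "iso_class D (Ps X ! i) = ?c"
      moreover have "Ps X ! i \<in> Obj D" using direct_sum_obj(2)[OF Ps(1)[of X]] X i nth_mem[OF i] by blast
      ultimately have "(Ps X ! i, Ps Y ! 0) \<in> iso_rel D" using iso_class_eq_iff Z0(2) by blast
      then have "(Shift D (Ps X ! i), Shift D (Ps Y ! 0)) \<in> iso_rel D" using functor_iso_rel[OF shift_functor] by blast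
      then have "(X, Y) \<in> iso_rel D"
        using shift_iso[OF XL nth_mem[OF i]] shift_iso[OF Y Z0(1)] iso_rel_sym iso_rel_trans by blast
      then show False using noniso[of X Y] X YJ(1) by blast
    qed
    then have "?\<mu> (Ps X) ?c = 0" by (simp add: class_multiplicity_def)
    moreover have "?\<mu> (Qs X) ?c = 0" using Q0[OF XL] by (simp add: class_multiplicity_def)
    ultimately show ?thesis by simp
  qed simp
  have "0 \<in> {i \<in> {..<length (Ps Y)}. iso_class D (Ps Y ! i) = ?c}" using 0 by simp
  then have "?\<mu> (Ps Y) ?c \<noteq> 0" unfolding class_multiplicity_def by (subst card_0_eq) auto
  moreover have "?\<mu> (Qs Y) ?c = 0" using Q0[OF Y] by (simp add: class_multiplicity_def)
  moreover have "(\<Sum>X\<in>J. a X * (int (?\<mu> (Qs X) ?c) - int (?\<mu> (Ps X) ?c))) =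
      a Y * (int (?\<mu> (Qs Y) ?c) - int (?\<mu> (Ps Y) ?c))"
    using sum.remove[OF J(1) YJ(1), of "\<lambda>X. a X * (int (?\<mu> (Qs X) ?c) - int (?\<mu> (Ps X) ?c))"] other by simp
  ultimately show False using a(2)[OF cCl] YJ(2) by simp
qed

section \<open>Comparison of two basic objects and the partial order\<close>

lemma basic_num_summands:
  assumes Ms: "direct_sum D Ms M" "\<And>Y. Y \<in> set Ms \<Longrightarrow> local_endomorphisms D Y"
    and noniso: "\<And>i j. \<lbrakk>i < length Ms; j < length Ms; i \<noteq> j\<rbrakk> \<Longrightarrow> (Ms ! i, Ms ! j) \<notin> iso_rel D"
  shows "num_summands D M = length Ms" "distinct Ms"
proof -
  have ob: "Ms ! i \<in> Obj D" if "i < length Ms" for i using direct_sum_obj(2)[OF Ms(1)] nth_mem[OF that] by blast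
  show dist: "distinct Ms" unfolding distinct_conv_nth using noniso ob iso_rel_refl by fastforce
  have "inj_on (iso_class D) (set Ms)"
  proof (rule inj_onI)
    fix X Y assume "X \<in> set Ms" "Y \<in> set Ms" and eq: "iso_class D X = iso_class D Y"
    then obtain i j where ij: "i < length Ms" "X = Ms ! i" "j < length Ms" "Y = Ms ! j" by (auto simp: in_set_conv_nth)
    then have "(Ms ! i, Ms ! j) \<in> iso_rel D" using eq iso_class_eq_iff ob by blast
    then show "X = Y" using noniso[of i j] ij by auto
  qed
  then have "card (iso_class D ` set Ms) = length Ms" using dist by (simp add: card_image distinct_card)
  then show "num_summands D M = length Ms" using num_summands_eq[OF Ms] by (simp add: iso_class_def)
qed

text \<open>Both objects have exactly |T| summands, so by the bound the summands of \<open>M\<close>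
  form a maximal orthogonal family and must already contain each summand of \<open>N\<close> up to
  isomorphism. The resulting matching is injective because \<open>N\<close> is basic, hence
  bijective by counting.\<close>

theorem star_shift_determines:
  assumes M: "M \<in> Obj D" "basic D M" "shift_cluster_tilting D T M"
    and N: "N \<in> Obj D" "basic D N" "shift_cluster_tilting D T N"
    and star: "star_shift D T M = star_shift D T N"
  shows "(M, N) \<in> iso_rel D"
proof -
  obtain Ms where Ms: "direct_sum D Ms M" "\<And>Y. Y \<in> set Ms \<Longrightarrow> local_endomorphisms D Y"
    "\<And>i j. \<lbrakk>i < length Ms; j < length Ms; i \<noteq> j\<rbrakk> \<Longrightarrow> (Ms ! i, Ms ! j) \<notin> iso_rel D"
    using M(2) indecomposable_local unfolding basic_def by blast
  obtain Ns where Ns: "direct_sum D Ns N" "\<And>Y. Y \<in> set Ns \<Longrightarrow> local_endomorphisms D Y"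
    "\<And>i j. \<lbrakk>i < length Ns; j < length Ns; i \<noteq> j\<rbrakk> \<Longrightarrow> (Ns ! i, Ns ! j) \<notin> iso_rel D"
    using N(2) indecomposable_local unfolding basic_def by blast
  note lenM = basic_num_summands[OF Ms] and lenN = basic_num_summands[OF Ns]
  have len: "length Ms = num_summands D T" "length Ns = num_summands D T"
    using lenM(1) lenN(1) M(3) N(3) by (simp_all add: shift_cluster_tilting_def)
  have MM: "ext_zero T M M" and NN: "ext_zero T N N"
    using shift_rigid_ext_zero M(3) N(3) by (simp_all add: shift_cluster_tilting_def)
  have MN: "ext_zero T M N" using star_shift_ext_zero[OF cluster_tilting_T MM] star_shift_self[OF N(1)] star by blast
  have NM: "ext_zero T N M" using star_shift_ext_zero[OF cluster_tilting_T NN] star_shift_self[OF M(1)] star by blast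
  have retM: "retract Y M" if "Y \<in> set Ms" for Y using that direct_sum_retract[OF Ms(1)] by (auto simp: in_set_conv_nth)
  have retN: "retract Y N" if "Y \<in> set Ns" for Y using that direct_sum_retract[OF Ns(1)] by (auto simp: in_set_conv_nth)
  have obs: "set Ms \<subseteq> Obj D" "set Ns \<subseteq> Obj D" using direct_sum_obj(2) Ms(1) Ns(1) by blast+
  have "\<exists>i<length Ms. (Ms ! i, Ns ! j) \<in> iso_rel D" if j: "j < length Ns" for j
  proof (rule ccontr)
    assume none: "\<not> ?thesis"
    let ?y = "Ns ! j"
    have y: "?y \<in> set Ns" using j by simp
    have notin: "(X, ?y) \<notin> iso_rel D" if "X \<in> set Ms" for X using none that by (auto simp: in_set_conv_nth)
    have inj: "X = X'" if "X \<in> set Ms" "X' \<in> set Ms" "(X, X') \<in> iso_rel D" for X X'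
      using that Ms(3) by (metis in_set_conv_nth)
    \<comment> \<open>All four vanishing conditions between \<open>M\<close> and \<open>N\<close>
      pass to retracts, so the family enlarged to |T| + 1 members satisfies the hypotheses of the
      bound.\<close>
    have "card (insert ?y (set Ms)) \<le> num_summands D T"
    proof (rule ext_orthogonal_family_bound)
      show "X \<in> Obj D" if "X \<in> insert ?y (set Ms)" for X using that y obs by blast
      show "local_endomorphisms D X" if "X \<in> insert ?y (set Ms)" for X using that y Ms(2) Ns(2) by blast
      show "X = X'" if "X \<in> insert ?y (set Ms)" "X' \<in> insert ?y (set Ms)" "(X, X') \<in> iso_rel D" for X X'
        using that notin inj iso_rel_sym by blast
      show "ext_zero T X X'" if "X \<in> insert ?y (set Ms)" "X' \<in> insert ?y (set Ms)" for X X'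
        using that retM retN[OF y] MM NN MN NM ext_zero_retract by blast
    qed simp
    moreover have "?y \<notin> set Ms" using notin obs y iso_rel_refl by blast
    ultimately show False using lenM(2) len(1) by (simp add: distinct_card)
  qed
  then obtain \<sigma> where \<sigma>: "\<And>j. j < length Ns \<Longrightarrow> \<sigma> j < length Ms" "\<And>j. j < length Ns \<Longrightarrow> (Ms ! \<sigma> j, Ns ! j) \<in> iso_rel D"
    by metis
  have "inj_on \<sigma> {..<length Ns}"
  proof (rule inj_onI)
    fix i j assume ij: "i \<in> {..<length Ns}" "j \<in> {..<length Ns}" "\<sigma> i = \<sigma> j"
    then have "(Ns ! i, Ms ! \<sigma> j) \<in> iso_rel D" "(Ms ! \<sigma> j, Ns ! j) \<in> iso_rel D"
      using \<sigma>(2)[of i] \<sigma>(2)[of j] iso_rel_sym by auto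
    then have "(Ns ! i, Ns ! j) \<in> iso_rel D" using iso_rel_trans by blast
    then show "i = j" using Ns(3)[of i j] ij by auto
  qed
  moreover have "\<sigma> ` {..<length Ns} = {..<length Ms}"
    using \<sigma>(1) len calculation by (intro card_subset_eq) (auto simp: card_image)
  ultimately have "bij_betw \<sigma> {..<length Ns} {..<length Ms}" by (simp add: bij_betw_def)
  then have "direct_sum D Ns M" using direct_sum_iso_summands[OF Ms(1)] \<sigma>(2) by blast
  then show ?thesis using direct_sum_unique Ns(1) by blast
qed

text \<open>As the relation is tested on all representatives, reflexivity rests on the invariance of
  \<open>star_shift\<close> under isomorphism, and transitivity on the middle class being
  nonempty.\<close>

lemma tilt_ge_partial_order:
  "partial_order_on (shift_tilt D T)
    {(P, Q). P \<in> shift_tilt D T \<and> Q \<in> shift_tilt D T \<and> tilt_ge D T P Q}"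
proof -
  let ?r = "{(P, Q). P \<in> shift_tilt D T \<and> Q \<in> shift_tilt D T \<and> tilt_ge D T P Q}"
  have rep: "\<exists>M. P = iso_rel D `` {M} \<and> M \<in> P \<and> M \<in> Obj D \<and> basic D M \<and> shift_cluster_tilting D T M"
    if "P \<in> shift_tilt D T" for P
    using that iso_rel_refl unfolding shift_tilt_def by (auto elim!: quotientE)
  have "tilt_ge D T P P" if P: "P \<in> shift_tilt D T" for P
    unfolding tilt_ge_def
  proof (intro ballI)
    fix M N assume MN: "M \<in> P" "N \<in> P"
    obtain L where "P = iso_rel D `` {L}" using rep[OF P] by blast
    then have "(N, M) \<in> iso_rel D" using MN iso_rel_sym iso_rel_trans by blast
    then show "star_shift D T N \<subseteq> star_shift D T M" by (rule star_shift_iso)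
  qed
  then have refl: "refl_on (shift_tilt D T) ?r" unfolding refl_on_def by auto
  have "tilt_ge D T P R" if PQ: "tilt_ge D T P Q" and QR: "tilt_ge D T Q R" and Q: "Q \<in> shift_tilt D T" for P Q R
  proof -
    obtain N where N: "N \<in> Q" using rep[OF Q] by blast
    show ?thesis unfolding tilt_ge_def
    proof (intro ballI)
      fix L M assume "L \<in> P" "M \<in> R"
      then have "star_shift D T N \<subseteq> star_shift D T L" "star_shift D T M \<subseteq> star_shift D T N"
        using PQ QR N unfolding tilt_ge_def by blast+
      then show "star_shift D T M \<subseteq> star_shift D T L" by blast
    qed
  qed
  then have trans: "trans ?r" unfolding trans_def by blast
  have "P = Q" if PQ: "tilt_ge D T P Q" and QP: "tilt_ge D T Q P"
    and mem: "P \<in> shift_tilt D T" "Q \<in> shift_tilt D T" for P Q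
  proof -
    obtain M where M: "P = iso_rel D `` {M}" "M \<in> P" "M \<in> Obj D" "basic D M" "shift_cluster_tilting D T M"
      using rep[OF mem(1)] by blast
    obtain N where N: "Q = iso_rel D `` {N}" "N \<in> Q" "N \<in> Obj D" "basic D N" "shift_cluster_tilting D T N"
      using rep[OF mem(2)] by blast
    have "star_shift D T M = star_shift D T N" using PQ QP M(2) N(2) unfolding tilt_ge_def by blast
    then have "(M, N) \<in> iso_rel D" using star_shift_determines M N by blast
    then show ?thesis using M(1) N(1) equiv_class_eq[OF equiv_iso_rel] by blast
  qed
  then have antisym: "antisym ?r" unfolding antisym_def by blast
  show ?thesis
    using refl trans antisym unfolding partial_order_on_def preorder_on_def by auto
qed

end

theorem theorem4p2:
  fixes K :: "'k ring"
    and D :: "('o, 'k, 'm) tri_category"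
    and T :: 'o
  assumes "algebraically_closed K"
    and "klinear_triangulated_category K D"
    and "krull_schmidt D"
    and "hom_finite K D"
    and "cluster_tilting D T"
    and "\<exists>S S'. serre_functor K D S S'"
  shows "partial_order_on (shift_tilt D T)
    {(P, Q). P \<in> shift_tilt D T \<and> Q \<in> shift_tilt D T \<and> tilt_ge D T P Q}"
proof -
  interpret klinear_triangulated_category K D by fact
  interpret cluster_tilted_category K D T
    by unfold_locales (fact assms)+
  show ?thesis by (rule tilt_ge_partial_order)
qed

end
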